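(* Let $d\in\mathbb{N}$ and $\alpha>d/2$. Then there exists a mean-zero random variable $Q(d,\alpha)$, which is non-Gaussian if $\alpha>d$, such that: (i) as $n\to\infty$, $\tilde{\mathcal O}^{d,\alpha}(\mathcal U_n)\to Q(d,\alpha)$ in $L^2$; and (ii) with the coupling of $\mathcal U_n$ and $\mathcal P_n$ given by $\mathcal P_n:=\mathcal U_{N(n)}$, as $n\to\infty$, $\tilde{\mathcal O}^{d,\alpha}(\mathcal P_n)\to Q(d,\alpha)$ in $L^2$.
   Context: $\mathbb{N}=\{1,2,3,\ldots\}$ and $\|\cdot\|$ is the Euclidean norm on $\mathbb{R}^d$. On a probability space $(\Omega,\mathcal F,\mathbb{P})$ let $\mathbf U_1,\mathbf U_2,\ldots$ be independent uniformly distributed random vectors in $(0,1)^d$, and let $\mathcal U_n:=(\mathbf U_1,\ldots,\mathbf U_n)$. The on-line nearest-neighbour graph on $\mathcal U_n$ joins each $\mathbf U_i$, $2\le i\le n$, by an edge to its Euclidean nearest neighbour among $\mathbf U_1,\ldots,\mathbf U_{i-1}$. For $\mathbf x\in\mathbb{R}^d$ and $\mathcal X\subset\mathbb{R}^d$ let $d(\mathbf x;\mathcal X):=\inf_{\mathbf y\in\mathcal X\setminus\{\mathbf x\}}\|\mathbf x-\mathbf y\|$. For $\alpha>0$ the total power-weighted edge length is $\mathcal O^{d,\alpha}(\mathcal U_n):=\sum_{i=2}^n \big(d(\mathbf U_i;\{\mathbf U_1,\ldots,\mathbf U_{i-1}\})\big)^\alpha$ for $n\ge2$, with $\mathcal O^{d,\alpha}(\mathcal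 U_1):=0$ and $\mathcal O^{d,\alpha}(\mathcal U_0):=0$ ($\mathcal U_0$ the empty sequence). Let $(N(t);t\ge0)$ be the counting process of a homogeneous Poisson process of unit rate on $(0,\infty)$, independent of $(\mathbf U_1,\mathbf U_2,\ldots)$ (so $N(\lambda)$ is Poisson with mean $\lambda$). For $\lambda>0$, $\mathcal P_\lambda:=\mathcal U_{N(\lambda)}$. The centred versions are $\tilde{\mathcal O}^{d,\alpha}(\mathcal U_n):=\mathcal O^{d,\alpha}(\mathcal U_n)-\mathbb{E}[\mathcal O^{d,\alpha}(\mathcal U_n)]$ and $\tilde{\mathcal O}^{d,\alpha}(\mathcal P_\lambda):=\mathcal O^{d,\alpha}(\mathcal P_\lambda)-\mathbb{E}[\mathcal O^{d,\alpha}(\mathcal P_\lambda)]$. "Non-Gaussian" means that the random variable does not have a normal law $\mathcal N(0,\sigma^2)$ with $\sigma^2\ge0$ (the degenerate case $\sigma^2=0$ counts as normal). *)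

theory Defs
  imports "HOL-Probability.Probability"
begin

text \<open>
  The space \<open>real ^ 'd\<close> stands for $d$-dimensional Euclidean space with \<open>d = CARD('d)\<close>;
  sequences of points are functions on \<open>nat\<close> of which only the values at indices
  \<open>1, 2, ...\<close> matter.
\<close>

definition unit_cube :: "(real ^ 'd) set"
  where "unit_cube = {x. \<forall>j. 0 < x $ j \<and> x $ j < 1}"

text \<open>
  \<^const>\<open>infdist\<close> is 0 on the empty set; below this concerns only the null event that all
  earlier points coincide with the new one.
\<close>

definition nn_dist :: "'a::metric_space \<Rightarrow> 'a set \<Rightarrow> real"
  where "nn_dist x X = infdist x (X - {x})"

definition onng_weight :: "real \<Rightarrow> (nat \<Rightarrow> 'a::metric_space) \<Rightarrow> nat \<Rightarrow> real"
  where "onng_weight \<alpha> u n = (\<Sum>i=2..n. nn_dist (u i) (u ` {1..<i}) powr \<alpha>)"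

definition centred :: "'w measure \<Rightarrow> ('w \<Rightarrow> real) \<Rightarrow> 'w \<Rightarrow> real"
  where "centred M X \<omega> = X \<omega> - (\<integral>\<omega>'. X \<omega>' \<partial>M)"

definition square_integrable :: "'w measure \<Rightarrow> ('w \<Rightarrow> real) \<Rightarrow> bool"
  where "square_integrable M X \<longleftrightarrow>
    X \<in> borel_measurable M \<and> integrable M (\<lambda>\<omega>. (X \<omega>)\<^sup>2)"

definition tendsto_L2 :: "'w measure \<Rightarrow> (nat \<Rightarrow> 'w \<Rightarrow> real) \<Rightarrow> ('w \<Rightarrow> real) \<Rightarrow> bool"
  where "tendsto_L2 M X Y \<longleftrightarrow>
    (\<forall>n. square_integrable M (X n)) \<and> square_integrable M Y \<and>
    (\<lambda>n. \<integral>\<omega>. (X n \<omega> - Y \<omega>)\<^sup>2 \<partial>M) \<longlonglongrightarrow> 0"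

text \<open>The parameter \<open>\<sigma>\<close> is the standard deviation; \<open>\<sigma> = 0\<close> gives the point mass at 0.\<close>

definition centred_normal_law :: "real \<Rightarrow> real measure"
  where "centred_normal_law \<sigma> =
    (if \<sigma> = 0 then return borel 0 else density lborel (\<lambda>x. ennreal (normal_density 0 \<sigma> x)))"

definition has_centred_normal_law :: "'w measure \<Rightarrow> ('w \<Rightarrow> real) \<Rightarrow> bool"
  where "has_centred_normal_law M X \<longleftrightarrow>
    (\<exists>\<sigma>\<ge>0. distr M borel X = centred_normal_law \<sigma>)"

text \<open>
  Since the paths are almost surely nondecreasing, the truncated subtraction on \<open>nat\<close>
  almost surely gives the true increments.  That almost all paths have only unit jumps is a
  consequence of the Poisson law of the increments.
\<close>

definition unit_rate_poisson_process :: "'w measure \<Rightarrow> (real \<Rightarrow> 'w \<Rightarrow> nat) \<Rightarrow> bool"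
  where "unit_rate_poisson_process M N \<longleftrightarrow>
    (\<forall>t\<ge>0. N t \<in> measurable M (count_space UNIV)) \<and>
    (AE \<omega> in M. N 0 \<omega> = 0 \<and>
       mono_on {0..} (\<lambda>t. N t \<omega>) \<and>
       (\<forall>t\<ge>0. continuous (at_right t) (\<lambda>s. N s \<omega>))) \<and>
    (\<forall>s t. 0 \<le> s \<longrightarrow> s < t \<longrightarrow>
       distr M (count_space UNIV) (\<lambda>\<omega>. N t \<omega> - N s \<omega>) = measure_pmf (poisson_pmf (t - s))) \<and>
    (\<forall>(\<tau> :: nat \<Rightarrow> real) k. 0 \<le> \<tau> 0 \<longrightarrow> mono \<tau> \<longrightarrow>
       prob_space.indep_vars M (\<lambda>_. count_space UNIV)
         (\<lambda>i \<omega>. N (\<tau> (Suc i)) \<omega> - N (\<tau> i) \<omega>) {..<k})"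

text \<open>
  The sigma-algebra generated by a family of random variables.  Independence of two processes
  is independence of these sigma-algebras; \<^const>\<open>prob_space.indep_var\<close> does not apply, as it
  requires both variables to have the same type of values.
\<close>

definition process_events :: "'w measure \<Rightarrow> 'b measure \<Rightarrow> 'i set \<Rightarrow> ('i \<Rightarrow> 'w \<Rightarrow> 'b) \<Rightarrow> 'w set set"
  where "process_events M S I X =
    sets (vimage_algebra (space M) (\<lambda>\<omega>. \<lambda>i\<in>I. X i \<omega>) (\<Pi>\<^sub>M i\<in>I. S))"

end

theory Submission
  imports Defs "HOL-Real_Asymp.Real_Asymp"
begin

text \<open>
Let \<open>w k y\<close> be the distance from a point \<open>y\<close> of the cube to the first \<open>k\<close> sample points, and \<open>d\<close> the
dimension. Almost surely the centred weight of the graph on \<open>n\<close> points is the sum over \<open>k < n\<close> of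
the centred edge weights \<open>w k (U (k + 1)) powr \<alpha>\<close>. Averaging such a weight over the new point gives
a function \<open>V k\<close> of the first \<open>k\<close> points, so the sum splits into a martingale, whose increments are
\<open>w k (U (k + 1)) powr \<alpha> - V k\<close>, and the sum of the variables \<open>V k - E (V k)\<close>.

Both parts converge in mean square. A ball of radius \<open>r\<close> around a point of the cube has probability
at least a constant times \<open>r ^ d\<close>, so \<open>w k y ^ d\<close> has exponential tails on the scale \<open>1 / k\<close>, and
the \<open>p\<close>-th moment of \<open>w k y\<close> is of order \<open>k powr (-p/d)\<close> (\<open>nn_moment_le\<close>). For \<open>2 * \<alpha> > d\<close> this
makes the second moments of the martingale increments summable. For the other part, the variance of \<open>V k\<close> is the
integral over \<open>y\<close> and \<open>z\<close> of the covariance of \<open>w k y powr \<alpha>\<close> and \<open>w k z powr \<alpha>\<close>. That the balls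
around \<open>y\<close> and \<open>z\<close> of radii \<open>r\<close> and \<open>s\<close> are both empty is, when they are disjoint and have
probabilities \<open>p\<close> and \<open>q\<close>, an event of probability \<open>(1 - p - q) ^ k \<le> (1 - p) ^ k * (1 - q) ^ k\<close>:
disjoint empty balls are negatively correlated. A positive covariance therefore comes only from the
event that one of the two distances exceeds half the distance from \<open>y\<close> to \<open>z\<close>, and integrating over
\<open>z\<close> turns this restriction into a factor \<open>w k y ^ d\<close>. Hence the variance of \<open>V k\<close> is of order
\<open>k powr (-(1 + 2 * \<alpha> / d))\<close> (\<open>mean_nn_power_variance_le\<close>), and the standard deviations are
summable, again because \<open>2 * \<alpha> > d\<close>.

Suppose \<open>\<alpha> > d\<close>. Then the expected edge weights are summable, so the centred sums, and with them the
limit, are bounded below. A normal law bounded below is a point mass, so it remains to see that the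
limit is not almost surely 0. Exchanging the second and the third sample point changes neither the
law of the sample nor the weight of any edge after the first three points. If the variance of the
centred sums tended to 0, the weight of the first three points would therefore almost surely be
invariant under this exchange; but it changes whenever the side from the first to the third point is
strictly the longest of the triangle (\<open>centred_sum_second_moment_not_tendsto_0\<close>).

For the Poisson sample, let \<open>S n\<close> be the centred sum and \<open>a n\<close> the expected weight. The process \<open>N\<close> is
independent of the points, so the mean square of \<open>S (N n) - S n\<close> is a Poisson average of quantities
that tend to 0. Because the expected edge weights decrease, \<open>a\<close> is nearly concave and the mean square
of \<open>a (N n) - a n\<close> is at most about \<open>(a n / n)^2\<close> times the variance \<open>n\<close> of \<open>N n\<close>; and
\<open>(a n)^2 / n\<close> tends to 0 because the expected edge weights are square summable.
\<close>

section \<open>Mean-square convergence\<close>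

lemma square_sum_le: "(x + y)\<^sup>2 \<le> 2 * x\<^sup>2 + 2 * (y::real)\<^sup>2"
proof -
  have "0 \<le> (x - y)\<^sup>2" by simp
  then show ?thesis by (simp add: power2_eq_square algebra_simps)
qed

lemma square_integrable_bounded:
  assumes "finite_measure M" "X \<in> borel_measurable M" "\<And>\<omega>. \<bar>X \<omega>\<bar> \<le> B"
  shows "square_integrable M X"
proof -
  interpret finite_measure M by fact
  have "(X \<omega>)\<^sup>2 \<le> B\<^sup>2" for \<omega>
    using assms(3)[of \<omega>] by (metis abs_ge_zero power2_abs power_mono)
  then show ?thesis using assms(2)
    unfolding square_integrable_def by (auto intro!: integrable_const_bound[where B="B\<^sup>2"])
qed

lemma square_integrable_add:
  assumes "square_integrable M X" "square_integrable M Y"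
  shows "square_integrable M (\<lambda>\<omega>. X \<omega> + Y \<omega>)"
  unfolding square_integrable_def
proof
  have [measurable]: "X \<in> borel_measurable M" "Y \<in> borel_measurable M"
    using assms by (auto simp: square_integrable_def)
  show "(\<lambda>\<omega>. X \<omega> + Y \<omega>) \<in> borel_measurable M" by simp
  show "integrable M (\<lambda>\<omega>. (X \<omega> + Y \<omega>)\<^sup>2)"
  proof (rule Bochner_Integration.integrable_bound)
    show "integrable M (\<lambda>\<omega>. 2 * (X \<omega>)\<^sup>2 + 2 * (Y \<omega>)\<^sup>2)"
      using assms by (auto simp: square_integrable_def)
    show "AE \<omega> in M. norm ((X \<omega> + Y \<omega>)\<^sup>2) \<le> norm (2 * (X \<omega>)\<^sup>2 + 2 * (Y \<omega>)\<^sup>2)"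
      using square_sum_le by (auto intro!: AE_I2)
  qed simp
qed

lemma square_integrable_cmult:
  assumes "square_integrable M X"
  shows "square_integrable M (\<lambda>\<omega>. c * X \<omega>)"
  using assms by (auto simp: square_integrable_def power_mult_distrib)

lemma square_integrable_diff:
  assumes "square_integrable M X" "square_integrable M Y"
  shows "square_integrable M (\<lambda>\<omega>. X \<omega> - Y \<omega>)"
  using square_integrable_add[OF assms(1) square_integrable_cmult[OF assms(2), of "-1"]] by simp

lemma square_integrable_sum:
  assumes "\<And>i. i \<in> I \<Longrightarrow> square_integrable M (X i)"
  shows "square_integrable M (\<lambda>\<omega>. \<Sum>i\<in>I. X i \<omega>)"
  using assms
proof (induction I rule: infinite_finite_induct)
  case (insert x F)
  then show ?case by (auto intro!: square_integrable_add)
qed (auto simp: square_integrable_def)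

lemma (in prob_space) square_integrable_const: "square_integrable M (\<lambda>\<omega>. c)"
  by (simp add: square_integrable_def)

text \<open>
Centring at the mean minimises the mean square. This allows a limit to be checked with any convenient
centring constant in place of the expectation.
\<close>

lemma (in prob_space) second_moment_centred_le:
  fixes X :: "'a \<Rightarrow> real"
  assumes "square_integrable M X"
  shows "expectation (\<lambda>\<omega>. (X \<omega> - expectation X)\<^sup>2) \<le> expectation (\<lambda>\<omega>. (X \<omega>)\<^sup>2)"
proof -
  have "integrable M X" "integrable M (\<lambda>\<omega>. (X \<omega>)\<^sup>2)"
    using assms square_integrable_imp_integrable[of X] unfolding square_integrable_def by blast+
  then show ?thesis by (simp add: variance_eq)
qed

lemma (in prob_space) square_of_expectation_le:
  fixes X :: "'a \<Rightarrow> real"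
  assumes "square_integrable M X"
  shows "(expectation X)\<^sup>2 \<le> expectation (\<lambda>\<omega>. (X \<omega>)\<^sup>2)"
proof -
  have "integrable M X" "integrable M (\<lambda>\<omega>. (X \<omega>)\<^sup>2)"
    using assms square_integrable_imp_integrable[of X] unfolding square_integrable_def by blast+
  then have "variance X = expectation (\<lambda>\<omega>. (X \<omega>)\<^sup>2) - (expectation X)\<^sup>2" by (rule variance_eq)
  then show ?thesis using variance_positive[of X] by linarith
qed

text \<open>
The triangle inequality for the mean-square norm, with the norms replaced by upper bounds \<open>s i\<close>. It
follows from the Cauchy-Schwarz inequality for sums, applied pointwise with the weights \<open>s i\<close>; these
must be positive to be divided by.
\<close>

lemma (in prob_space) second_moment_sum_le:
  fixes X :: "'i \<Rightarrow> 'a \<Rightarrow> real"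
  assumes "finite I" and X: "\<And>i. i \<in> I \<Longrightarrow> square_integrable M (X i)"
    and s: "\<And>i. i \<in> I \<Longrightarrow> s i > 0" and le: "\<And>i. i \<in> I \<Longrightarrow> expectation (\<lambda>\<omega>. (X i \<omega>)\<^sup>2) \<le> (s i)\<^sup>2"
  shows "expectation (\<lambda>\<omega>. (\<Sum>i\<in>I. X i \<omega>)\<^sup>2) \<le> (\<Sum>i\<in>I. s i)\<^sup>2"
proof -
  have s': "0 \<le> s i" if "i \<in> I" for i
    using s[OF that] by simp
  have pointwise: "(\<Sum>i\<in>I. X i \<omega>)\<^sup>2 \<le> (\<Sum>i\<in>I. s i) * (\<Sum>i\<in>I. (X i \<omega>)\<^sup>2 / s i)" for \<omega>
  proof -
    have "X i \<omega> = sqrt (s i) * (X i \<omega> / sqrt (s i))" if "i \<in> I" for i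
      using s[OF that] by simp
    then have "(\<Sum>i\<in>I. X i \<omega>) = (\<Sum>i\<in>I. sqrt (s i) * (X i \<omega> / sqrt (s i)))"
      by (intro sum.cong) blast+
    then have "(\<Sum>i\<in>I. X i \<omega>)\<^sup>2 \<le> (\<Sum>i\<in>I. (sqrt (s i))\<^sup>2) * (\<Sum>i\<in>I. (X i \<omega> / sqrt (s i))\<^sup>2)"
      by (metis Cauchy_Schwarz_ineq_sum)
    also have "\<dots> = (\<Sum>i\<in>I. s i) * (\<Sum>i\<in>I. (X i \<omega>)\<^sup>2 / s i)"
      by (intro arg_cong2[where f="(*)"] sum.cong refl) (simp_all add: power_divide s')
    finally show ?thesis .
  qed
  have int: "integrable M (\<lambda>\<omega>. (X i \<omega>)\<^sup>2)" if "i \<in> I" for i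
    using X[OF that] by (simp add: square_integrable_def)
  have "expectation (\<lambda>\<omega>. (\<Sum>i\<in>I. X i \<omega>)\<^sup>2) \<le> expectation (\<lambda>\<omega>. (\<Sum>i\<in>I. s i) * (\<Sum>i\<in>I. (X i \<omega>)\<^sup>2 / s i))"
  proof (rule integral_mono')
    show "integrable M (\<lambda>\<omega>. (\<Sum>i\<in>I. s i) * (\<Sum>i\<in>I. (X i \<omega>)\<^sup>2 / s i))"
      by (intro Bochner_Integration.integrable_mult_right
        Bochner_Integration.integrable_sum Bochner_Integration.integrable_divide int)
    show "0 \<le> (\<Sum>i\<in>I. s i) * (\<Sum>i\<in>I. (X i \<omega>)\<^sup>2 / s i)" for \<omega>
      by (intro mult_nonneg_nonneg sum_nonneg divide_nonneg_nonneg s') simp_all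
  qed (rule pointwise)
  also have "\<dots> = (\<Sum>i\<in>I. s i) * (\<Sum>i\<in>I. expectation (\<lambda>\<omega>. (X i \<omega>)\<^sup>2) / s i)"
    using int by (simp add: Bochner_Integration.integral_sum)
  also have "\<dots> \<le> (\<Sum>i\<in>I. s i) * (\<Sum>i\<in>I. s i)"
    by (intro mult_left_mono sum_mono sum_nonneg)
      (simp_all add: divide_le_eq power2_eq_square[symmetric] s' s le)
  finally show ?thesis by (simp add: power2_eq_square)
qed

text \<open>
Along a subsequence with increments of norm at most \<open>2 ^ (-j)\<close> the increments are absolutely
summable almost surely, which gives a pointwise limit; Fatou's lemma shows that the whole sequence
converges to it in mean square.
\<close>

lemma (in prob_space) L2_complete:
  fixes X :: "nat \<Rightarrow> 'a \<Rightarrow> real"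
  assumes X: "\<And>n. square_integrable M (X n)"
    and Cauchy: "\<And>e. e > 0 \<Longrightarrow> \<exists>K. \<forall>m\<ge>K. \<forall>n\<ge>K. (\<integral>\<omega>. (X m \<omega> - X n \<omega>)\<^sup>2 \<partial>M) \<le> e"
  obtains Q where "square_integrable M Q" "tendsto_L2 M X Q"
proof -
  have [measurable]: "X n \<in> borel_measurable M" for n
    using X by (auto simp: square_integrable_def)
  have dX2: "integrable M (\<lambda>\<omega>. (X m \<omega> - X n \<omega>)\<^sup>2)" for m n
    using square_integrable_diff[OF X X] by (simp add: square_integrable_def)
  have "\<exists>K. \<forall>j. \<forall>m\<ge>K j. \<forall>n\<ge>K j. (\<integral>\<omega>. (X m \<omega> - X n \<omega>)\<^sup>2 \<partial>M) \<le> (1/4)^j"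
    by (intro choice allI Cauchy) auto
  then obtain K where K: "\<And>j m n. m \<ge> K j \<Longrightarrow> n \<ge> K j \<Longrightarrow> (\<integral>\<omega>. (X m \<omega> - X n \<omega>)\<^sup>2 \<partial>M) \<le> (1/4)^j"
    by blast
  \<comment> \<open>summing makes the indices \<open>r j \<ge> K j\<close> monotone\<close>
  define r where "r j = (\<Sum>i\<le>j. K i)" for j
  have rK: "r j \<ge> K j" for j
    unfolding r_def by (rule member_le_sum) auto
  have rmono: "r j \<le> r (Suc j)" for j
    by (simp add: r_def)
  have rmono': "r i \<le> r j" if "i \<le> j" for i j
    using that rmono by (rule lift_Suc_mono_le[rotated])
  define Y where "Y j = X (r j)" for j
  have [measurable]: "Y n \<in> borel_measurable M" for n
    by (simp add: Y_def)
  define Q where "Q \<omega> = lim (\<lambda>j. Y j \<omega>)" for \<omega>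
  have Qm[measurable]: "Q \<in> borel_measurable M"
    unfolding Q_def by (rule borel_measurable_lim_metric) simp
  have step: "(\<integral>\<^sup>+\<omega>. ennreal \<bar>Y (Suc j) \<omega> - Y j \<omega>\<bar> \<partial>M) \<le> ennreal ((1/2)^j)" for j
  proof -
    \<comment> \<open>the arithmetic-geometric mean bound with weight \<open>2 ^ j\<close> replaces the Cauchy-Schwarz inequality\<close>
    have *: "\<bar>t\<bar> \<le> (2^j * t\<^sup>2 + (1/2)^j) / 2" for t :: real
    proof -
      have "0 \<le> 2^j * (\<bar>t\<bar> - (1/2)^j)\<^sup>2" by simp
      also have "\<dots> = 2^j * t\<^sup>2 - 2 * \<bar>t\<bar> + (1/2)^j"
        by (simp add: power2_eq_square algebra_simps power_divide)
      finally show ?thesis by simp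
    qed
    have "(\<integral>\<^sup>+\<omega>. ennreal \<bar>Y (Suc j) \<omega> - Y j \<omega>\<bar> \<partial>M)
        \<le> (\<integral>\<^sup>+\<omega>. ennreal ((2^j * (Y (Suc j) \<omega> - Y j \<omega>)\<^sup>2 + (1/2)^j) / 2) \<partial>M)"
      by (intro nn_integral_mono ennreal_leI *)
    also have "\<dots> = ennreal (\<integral>\<omega>. (2^j * (Y (Suc j) \<omega> - Y j \<omega>)\<^sup>2 + (1/2)^j) / 2 \<partial>M)"
      using dX2 by (intro nn_integral_eq_integral) (auto simp: Y_def)
    also have "(\<integral>\<omega>. (2^j * (Y (Suc j) \<omega> - Y j \<omega>)\<^sup>2 + (1/2)^j) / 2 \<partial>M)
       = (2^j * (\<integral>\<omega>. (Y (Suc j) \<omega> - Y j \<omega>)\<^sup>2 \<partial>M) + (1/2)^j) / 2"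
      using dX2 by (simp add: Y_def prob_space)
    also have "\<dots> \<le> (2^j * (1/4)^j + (1/2)^j) / 2"
      using K[of j "r (Suc j)" "r j"] rK[of j] rmono[of j] by (auto simp: Y_def)
    also have "\<dots> = (1/2)^j"
      by (simp add: power_mult_distrib[symmetric])
    finally show ?thesis by (simp add: ennreal_leI)
  qed
  have "(\<integral>\<^sup>+\<omega>. (\<Sum>j. ennreal \<bar>Y (Suc j) \<omega> - Y j \<omega>\<bar>) \<partial>M)
      = (\<Sum>j. \<integral>\<^sup>+\<omega>. ennreal \<bar>Y (Suc j) \<omega> - Y j \<omega>\<bar> \<partial>M)"
    by (rule nn_integral_suminf) simp
  also have "\<dots> \<le> (\<Sum>j. ennreal ((1/2)^j))"
    by (intro suminf_le step) auto
  also have "\<dots> = ennreal (\<Sum>j. (1/2)^j)"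
    by (intro suminf_ennreal2) (auto intro!: summable_geometric)
  also have "\<dots> < \<infinity>" by simp
  finally have "AE \<omega> in M. (\<Sum>j. ennreal \<bar>Y (Suc j) \<omega> - Y j \<omega>\<bar>) \<noteq> \<infinity>"
    by (intro nn_integral_PInf_AE) auto
  then have lim: "AE \<omega> in M. (\<lambda>j. Y j \<omega>) \<longlonglongrightarrow> Q \<omega>"
  proof eventually_elim
    case (elim \<omega>)
    then have "summable (\<lambda>j. \<bar>Y (Suc j) \<omega> - Y j \<omega>\<bar>)"
      by (intro summable_suminf_not_top) auto
    then have "summable (\<lambda>j. Y (Suc j) \<omega> - Y j \<omega>)"
      by (rule summable_rabs_cancel)
    then have "convergent (\<lambda>n. \<Sum>j<n. Y (Suc j) \<omega> - Y j \<omega>)"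
      by (simp add: summable_iff_convergent)
    then have "convergent (\<lambda>n. Y n \<omega> - Y 0 \<omega>)"
      by (simp only: sum_lessThan_telescope[of "\<lambda>j. Y j \<omega>"])
    then have "convergent (\<lambda>n. Y n \<omega>)"
      using convergent_diff_const_right_iff by blast
    then show ?case
      by (simp add: Q_def convergent_LIMSEQ_iff)
  qed
  have Fatou: "(\<integral>\<^sup>+\<omega>. ennreal ((X m \<omega> - Q \<omega>)\<^sup>2) \<partial>M) \<le> ennreal ((1/4)^j)" if m: "m \<ge> K j" for j m
  proof -
    have "(\<integral>\<^sup>+\<omega>. ennreal ((X m \<omega> - Q \<omega>)\<^sup>2) \<partial>M)
        = (\<integral>\<^sup>+\<omega>. liminf (\<lambda>i. ennreal ((X m \<omega> - Y i \<omega>)\<^sup>2)) \<partial>M)"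
    proof (intro nn_integral_cong_AE, use lim in eventually_elim)
      case (elim \<omega>)
      then have "(\<lambda>i. ennreal ((X m \<omega> - Y i \<omega>)\<^sup>2)) \<longlonglongrightarrow> ennreal ((X m \<omega> - Q \<omega>)\<^sup>2)"
        by (intro tendsto_intros) auto
      then show ?case
        by (rule lim_imp_Liminf[OF sequentially_bot, symmetric])
    qed
    also have "\<dots> \<le> liminf (\<lambda>i. \<integral>\<^sup>+\<omega>. ennreal ((X m \<omega> - Y i \<omega>)\<^sup>2) \<partial>M)"
      by (rule nn_integral_liminf) simp
    also have "\<dots> \<le> ennreal ((1/4)^j)"
    proof (rule Liminf_le)
      show "\<forall>\<^sub>F i in sequentially. (\<integral>\<^sup>+\<omega>. ennreal ((X m \<omega> - Y i \<omega>)\<^sup>2) \<partial>M) \<le> ennreal ((1/4)^j)"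
      proof (rule eventually_sequentiallyI[of j])
        fix i assume "j \<le> i"
        then have "K j \<le> r i" using rK[of j] rmono'[of j i] by linarith
        then show "(\<integral>\<^sup>+\<omega>. ennreal ((X m \<omega> - Y i \<omega>)\<^sup>2) \<partial>M) \<le> ennreal ((1/4)^j)"
          using dX2 K[OF m, of "r i"] by (subst nn_integral_eq_integral) (auto simp: Y_def intro!: ennreal_leI)
      qed
    qed simp
    finally show ?thesis .
  qed
  have I: "integrable M (\<lambda>\<omega>. (X m \<omega> - Q \<omega>)\<^sup>2)" and le: "(\<integral>\<omega>. (X m \<omega> - Q \<omega>)\<^sup>2 \<partial>M) \<le> (1/4)^j" if "m \<ge> K j" for j m
  proof -
    show *: "integrable M (\<lambda>\<omega>. (X m \<omega> - Q \<omega>)\<^sup>2)"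
      using Fatou[OF that] by (intro integrableI_nonneg) (auto simp: less_top[symmetric] top_unique)
    show "(\<integral>\<omega>. (X m \<omega> - Q \<omega>)\<^sup>2 \<partial>M) \<le> (1/4)^j"
      using Fatou[OF that] * by (subst (asm) nn_integral_eq_integral) auto
  qed
  have "square_integrable M (\<lambda>\<omega>. X (K 0) \<omega> - Q \<omega>)"
    using I[of 0] by (simp add: square_integrable_def)
  from square_integrable_diff[OF X[of "K 0"] this] have Q: "square_integrable M Q" by simp
  have "(\<lambda>n. \<integral>\<omega>. (X n \<omega> - Q \<omega>)\<^sup>2 \<partial>M) \<longlonglongrightarrow> 0"
  proof (rule LIMSEQ_I)
    fix e :: real assume "e > 0"
    then obtain j where j: "(1/4)^j < e"
      using real_arch_pow_inv[of e "1/4"] by auto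
    show "\<exists>n0. \<forall>n\<ge>n0. norm ((\<integral>\<omega>. (X n \<omega> - Q \<omega>)\<^sup>2 \<partial>M) - 0) < e"
    proof (intro exI allI impI)
      fix n assume "n \<ge> K j"
      from le[OF this] j show "norm ((\<integral>\<omega>. (X n \<omega> - Q \<omega>)\<^sup>2 \<partial>M) - 0) < e"
        by (simp add: integral_nonneg_AE)
    qed
  qed
  with Q X show ?thesis
    by (intro that) (auto simp: tendsto_L2_def)
qed

lemma tendsto_L2_cong_AE:
  assumes lim: "tendsto_L2 M X Q" and [measurable]: "\<And>n. Y n \<in> borel_measurable M"
    and eq: "\<And>n. AE \<omega> in M. X n \<omega> = Y n \<omega>"
  shows "tendsto_L2 M Y Q"
proof -
  have [measurable]: "X n \<in> borel_measurable M" "Q \<in> borel_measurable M" for n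
    using lim by (auto simp: tendsto_L2_def square_integrable_def)
  have "square_integrable M (Y n)" for n
  proof -
    have "integrable M (\<lambda>\<omega>. (X n \<omega>)\<^sup>2)" using lim by (auto simp: tendsto_L2_def square_integrable_def)
    then have "integrable M (\<lambda>\<omega>. (Y n \<omega>)\<^sup>2)"
      by (rule integrable_cong_AE_imp) (use eq[of n] in \<open>auto elim: eventually_mono\<close>)
    then show ?thesis by (simp add: square_integrable_def)
  qed
  moreover have "(\<integral>\<omega>. (X n \<omega> - Q \<omega>)\<^sup>2 \<partial>M) = (\<integral>\<omega>. (Y n \<omega> - Q \<omega>)\<^sup>2 \<partial>M)" for n
    by (rule integral_cong_AE) (use eq[of n] in \<open>auto elim: eventually_mono\<close>)
  ultimately show ?thesis using lim by (simp add: tendsto_L2_def)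
qed

lemma (in prob_space) expectation_L2_limit:
  fixes Q :: "'a \<Rightarrow> real"
  assumes lim: "tendsto_L2 M X Q" and X0: "\<And>n. expectation (X n) = 0"
  shows "integrable M Q" "expectation Q = 0"
proof -
  have sq: "square_integrable M (X n)" "square_integrable M Q" for n
    using lim by (auto simp: tendsto_L2_def)
  have int: "integrable M (X n)" "integrable M Q" for n
    using sq square_integrable_imp_integrable unfolding square_integrable_def by blast+
  then show "integrable M Q" by simp
  have "(expectation Q)\<^sup>2 \<le> expectation (\<lambda>\<omega>. (X n \<omega> - Q \<omega>)\<^sup>2)" for n
    using square_of_expectation_le[OF square_integrable_diff[OF sq(1)[of n] sq(2)]] int X0 by simp
  then have "(expectation Q)\<^sup>2 \<le> 0"
    using lim unfolding tendsto_L2_def by (intro LIMSEQ_le_const) auto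
  then show "expectation Q = 0" by simp
qed

text \<open>
Where \<open>Q < - A\<close>, the distance from \<open>Q\<close> to \<open>X n\<close> is at least the distance from \<open>Q\<close> to \<open>- A\<close>, so the mean
square of the latter on this event is 0.
\<close>

lemma (in prob_space) L2_limit_bounded_below:
  fixes Q :: "'a \<Rightarrow> real"
  assumes lim: "tendsto_L2 M X Q" and X: "\<And>n \<omega>. - A \<le> X n \<omega>"
  shows "AE \<omega> in M. - A \<le> Q \<omega>"
proof -
  have [measurable]: "Q \<in> borel_measurable M" and Q: "square_integrable M Q"
    and Xn: "\<And>n. square_integrable M (X n)" and to0: "(\<lambda>n. \<integral>\<omega>. (X n \<omega> - Q \<omega>)\<^sup>2 \<partial>M) \<longlonglongrightarrow> 0"
    using lim by (auto simp: tendsto_L2_def square_integrable_def)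
  define f where "f \<omega> = (max 0 (- A - Q \<omega>))\<^sup>2" for \<omega>
  have fle: "f \<omega> \<le> (X n \<omega> - Q \<omega>)\<^sup>2" for n \<omega>
    unfolding f_def using X[of n \<omega>] by (intro abs_le_square_iff[THEN iffD1]) auto
  have d: "integrable M (\<lambda>\<omega>. (X n \<omega> - Q \<omega>)\<^sup>2)" for n
    using square_integrable_diff[OF Xn Q] by (simp add: square_integrable_def)
  have f: "integrable M f"
  proof (rule Bochner_Integration.integrable_bound[OF d[of 0]])
    show "f \<in> borel_measurable M" unfolding f_def by measurable
    show "AE \<omega> in M. norm (f \<omega>) \<le> norm ((X 0 \<omega> - Q \<omega>)\<^sup>2)"
      using fle[of _ 0] by (intro AE_I2) (simp add: f_def)
  qed
  have "expectation f \<le> 0"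
    using integral_mono[OF f d fle] by (intro LIMSEQ_le_const[OF to0]) auto
  moreover have "0 \<le> expectation f"
    by (intro Bochner_Integration.integral_nonneg) (simp add: f_def)
  ultimately have "expectation f = 0" by simp
  then have "AE \<omega> in M. f \<omega> = 0"
    using f by (subst (asm) integral_nonneg_eq_0_iff_AE) (auto simp: f_def)
  then show ?thesis
    by eventually_elim (auto simp: f_def max_def split: if_splits)
qed

text \<open>
A normal density with positive variance charges every interval, also those below \<open>- A\<close>; so the
variance is 0.
\<close>

lemma (in prob_space) bounded_below_centred_normal_imp_zero:
  fixes Q :: "'a \<Rightarrow> real"
  assumes [measurable]: "Q \<in> borel_measurable M" and below: "AE \<omega> in M. - A \<le> Q \<omega>"
    and normal: "has_centred_normal_law M Q"
  shows "AE \<omega> in M. Q \<omega> = 0"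
proof -
  obtain s where s: "s \<ge> 0" "distr M borel Q = centred_normal_law s"
    using normal by (auto simp: has_centred_normal_law_def)
  show ?thesis
  proof (cases "s = 0")
    case True
    have "AE x in return borel (0 :: real). x = 0" by (subst AE_return) auto
    then have "AE x in distr M borel Q. x = 0"
      unfolding s(2) centred_normal_law_def True by simp
    then show ?thesis by (subst (asm) AE_distr_iff) auto
  next
    case False
    then have s0: "s > 0" using s by simp
    have "AE x in distr M borel Q. - A \<le> x"
      using below by (subst AE_distr_iff) auto
    then have "AE x in lborel. 0 < ennreal (normal_density 0 s x) \<longrightarrow> - A \<le> x"
      unfolding s(2) centred_normal_law_def using False by (subst (asm) if_not_P, simp, subst (asm) AE_density) auto
    then have "AE x in lborel. x \<notin> {- A - 1 <..< - A}"
      by eventually_elim (use normal_density_pos[OF s0] in auto)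
    then have "emeasure lborel {- A - 1 <..< - A} = 0"
      by (subst (asm) AE_iff_measurable[OF _ refl]) (auto simp: greaterThanLessThan_def greaterThan_def lessThan_def Int_def)
    then show ?thesis by simp
  qed
qed

section \<open>Negative dependence, exponential tails and independence\<close>

lemma (in prob_space) integrable_bounded: "f \<in> borel_measurable M \<Longrightarrow> (\<And>\<omega>. \<bar>f \<omega>\<bar> \<le> B) \<Longrightarrow> integrable M f" for f :: "'a \<Rightarrow> real"
  by (rule integrable_const_bound[where B=B]) auto

text \<open>
A nonnegative variable is the integral over \<open>r \<ge> 0\<close> of the indicator that it exceeds \<open>r\<close>. Hence the two sides are
the integrals over \<open>r\<close> and \<open>s\<close> of the two sides of the hypothesis (Hoeffding's covariance formula).
\<close>

lemma (in prob_space) expectation_mult_le_of_negative_quadrant_dependence: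
  fixes X Y :: "'a \<Rightarrow> real"
  assumes [measurable]: "X \<in> borel_measurable M" "Y \<in> borel_measurable M"
    and X: "\<And>\<omega>. 0 \<le> X \<omega>" "\<And>\<omega>. X \<omega> \<le> B" and Y: "\<And>\<omega>. 0 \<le> Y \<omega>" "\<And>\<omega>. Y \<omega> \<le> B"
    and nqd: "\<And>r s. r \<ge> 0 \<Longrightarrow> s \<ge> 0 \<Longrightarrow>
      prob {\<omega> \<in> space M. r < X \<omega> \<and> s < Y \<omega>} \<le> prob {\<omega> \<in> space M. r < X \<omega>} * prob {\<omega> \<in> space M. s < Y \<omega>}"
  shows "expectation (\<lambda>\<omega>. X \<omega> * Y \<omega>) \<le> expectation X * expectation Y"
proof -
  define J :: "real \<Rightarrow> real \<Rightarrow> ennreal" where "J x r = (if 0 \<le> r \<and> r < x then 1 else 0)" for x r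
  have J[measurable]: "(\<lambda>p. J (f p) (g p)) \<in> borel_measurable N"
    if [measurable]: "f \<in> borel_measurable N" "g \<in> borel_measurable N" for f g and N :: "'n measure"
    unfolding J_def by measurable
  have layer: "ennreal x = (\<integral>\<^sup>+r. J x r \<partial>lborel)" if "0 \<le> x" for x
  proof -
    have "(\<integral>\<^sup>+r. J x r \<partial>lborel) = (\<integral>\<^sup>+r. indicator {0..<x} r \<partial>lborel)"
      by (intro nn_integral_cong) (auto simp: J_def)
    then show ?thesis using that by simp
  qed
  interpret p: pair_sigma_finite M "lborel :: real measure" ..
  have E1: "(\<integral>\<^sup>+\<omega>. ennreal (Z \<omega>) \<partial>M) = (\<integral>\<^sup>+r. (\<integral>\<^sup>+\<omega>. J (Z \<omega>) r \<partial>M) \<partial>lborel)"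
    if [measurable]: "Z \<in> borel_measurable M" and Z: "\<And>\<omega>. 0 \<le> Z \<omega>" for Z
    unfolding layer[OF Z] by (rule p.Fubini'[symmetric]) (simp add: case_prod_unfold)
  have "(\<integral>\<^sup>+\<omega>. ennreal (X \<omega> * Y \<omega>) \<partial>M) = (\<integral>\<^sup>+\<omega>. (\<integral>\<^sup>+r. J (X \<omega>) r * ennreal (Y \<omega>) \<partial>lborel) \<partial>M)"
    using X Y by (simp add: nn_integral_multc ennreal_mult layer[OF X(1), symmetric])
  also have "\<dots> = (\<integral>\<^sup>+r. (\<integral>\<^sup>+\<omega>. J (X \<omega>) r * ennreal (Y \<omega>) \<partial>M) \<partial>lborel)"
    by (rule p.Fubini'[symmetric]) (simp add: case_prod_unfold)
  also have "\<dots> = (\<integral>\<^sup>+r. (\<integral>\<^sup>+\<omega>. (\<integral>\<^sup>+s. J (X \<omega>) r * J (Y \<omega>) s \<partial>lborel) \<partial>M) \<partial>lborel)"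
    using Y by (simp add: nn_integral_cmult layer[OF Y(1), symmetric])
  also have "\<dots> = (\<integral>\<^sup>+r. (\<integral>\<^sup>+s. (\<integral>\<^sup>+\<omega>. J (X \<omega>) r * J (Y \<omega>) s \<partial>M) \<partial>lborel) \<partial>lborel)"
    by (intro nn_integral_cong p.Fubini'[symmetric]) (simp add: case_prod_unfold)
  also have "\<dots> \<le> (\<integral>\<^sup>+r. (\<integral>\<^sup>+s. (\<integral>\<^sup>+\<omega>. J (X \<omega>) r \<partial>M) * (\<integral>\<^sup>+\<omega>. J (Y \<omega>) s \<partial>M) \<partial>lborel) \<partial>lborel)"
  proof (intro nn_integral_mono)
    fix r s :: real
    show "(\<integral>\<^sup>+\<omega>. J (X \<omega>) r * J (Y \<omega>) s \<partial>M) \<le> (\<integral>\<^sup>+\<omega>. J (X \<omega>) r \<partial>M) * (\<integral>\<^sup>+\<omega>. J (Y \<omega>) s \<partial>M)"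
    proof (cases "0 \<le> r \<and> 0 \<le> s")
      case True
      have "(\<integral>\<^sup>+\<omega>. J (X \<omega>) r \<partial>M) = (\<integral>\<^sup>+\<omega>. indicator {\<omega> \<in> space M. r < X \<omega>} \<omega> \<partial>M)"
        "(\<integral>\<^sup>+\<omega>. J (Y \<omega>) s \<partial>M) = (\<integral>\<^sup>+\<omega>. indicator {\<omega> \<in> space M. s < Y \<omega>} \<omega> \<partial>M)"
        "(\<integral>\<^sup>+\<omega>. J (X \<omega>) r * J (Y \<omega>) s \<partial>M) = (\<integral>\<^sup>+\<omega>. indicator {\<omega> \<in> space M. r < X \<omega> \<and> s < Y \<omega>} \<omega> \<partial>M)"
        using True by - (rule nn_integral_cong, simp add: J_def indicator_def)+
      then show ?thesis using nqd[of r s] True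
        by (simp add: emeasure_eq_measure ennreal_mult[symmetric] ennreal_leI)
    qed (auto simp: J_def)
  qed
  also have "\<dots> = (\<integral>\<^sup>+\<omega>. ennreal (X \<omega>) \<partial>M) * (\<integral>\<^sup>+\<omega>. ennreal (Y \<omega>) \<partial>M)"
    using X Y by (simp add: nn_integral_cmult nn_integral_multc E1)
  finally have *: "(\<integral>\<^sup>+\<omega>. ennreal (X \<omega> * Y \<omega>) \<partial>M) \<le> (\<integral>\<^sup>+\<omega>. ennreal (X \<omega>) \<partial>M) * (\<integral>\<^sup>+\<omega>. ennreal (Y \<omega>) \<partial>M)" .
  have "integrable M X" "integrable M Y"
    using X Y by (auto intro!: integrable_const_bound[where B=B])
  moreover have "X \<omega> * Y \<omega> \<le> B * B" for \<omega>
    using X Y by (intro mult_mono) (auto intro: order_trans[OF X(1) X(2)])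
  then have "integrable M (\<lambda>\<omega>. X \<omega> * Y \<omega>)"
    using X Y by (intro integrable_const_bound[where B="B * B"]) (auto simp: abs_mult)
  ultimately show ?thesis
    using * X Y by (simp add: nn_integral_eq_integral ennreal_mult[symmetric] integral_nonneg_AE)
qed

text \<open>
Rounding \<open>T\<close> up to the next integer gives a series in place of an integral over the tail. The bound
depends on \<open>T\<close> only through the tail constants, which is what makes the moments of the
nearest-neighbour distances uniform in the point and in the sample size.
\<close>

lemma (in prob_space) moment_le_of_exponential_tail:
  fixes T :: "'a \<Rightarrow> real" and q c B :: real
  assumes [measurable]: "T \<in> borel_measurable M" and T0: "\<And>\<omega>. 0 \<le> T \<omega>" and q: "q > 0" and c: "c > 0" and B: "B \<ge> 0"
    and tail: "\<And>j::nat. prob {\<omega>\<in>space M. real j < T \<omega>} \<le> B * exp (- c * j)"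
  shows "(\<integral>\<^sup>+\<omega>. ennreal (T \<omega> powr q) \<partial>M) \<le> ennreal (B * (\<Sum>j. (real j + 1) powr q * exp (- c * real j)))"
proof -
  have sm: "summable (\<lambda>j. (real j + 1) powr q * exp (- c * real j))"
  proof (rule summable_comparison_test_bigo)
    show "summable (\<lambda>j. norm (1 / real j ^ 2))"
      using inverse_power_summable[of 2, where 'a=real] by (simp add: field_simps)
    show "(\<lambda>j. (real j + 1) powr q * exp (- c * real j)) \<in> O(\<lambda>j. 1 / real j ^ 2)"
      using c q by real_asymp
  qed
  have le: "ennreal (T \<omega> powr q) \<le> (\<Sum>j. ennreal ((real j + 1) powr q) * indicator {\<omega>\<in>space M. real j < T \<omega>} \<omega>)"
    if "\<omega> \<in> space M" for \<omega>
  proof (cases "T \<omega> = 0")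
    case False
    \<comment> \<open>the integer with \<open>j < T \<omega> \<le> j + 1\<close>\<close>
    define j where "j = nat (\<lceil>T \<omega>\<rceil> - 1)"
    have "T \<omega> > 0" using False T0[of \<omega>] by simp
    then have "\<lceil>T \<omega>\<rceil> \<ge> 1" by linarith
    then have j: "real j = of_int \<lceil>T \<omega>\<rceil> - 1" by (simp add: j_def)
    then have jT: "real j < T \<omega>" "T \<omega> \<le> real j + 1" by linarith+
    have "ennreal (T \<omega> powr q) \<le> ennreal ((real j + 1) powr q) * indicator {\<omega>\<in>space M. real j < T \<omega>} \<omega>"
      using jT that T0[of \<omega>] q by (auto intro!: ennreal_leI powr_mono2)
    also have "\<dots> \<le> (\<Sum>j. ennreal ((real j + 1) powr q) * indicator {\<omega>\<in>space M. real j < T \<omega>} \<omega>)"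
    proof -
      have "g j \<le> suminf g" for g :: "nat \<Rightarrow> ennreal"
        using sum_le_suminf[of g "{j}"] by simp
      then show ?thesis .
    qed
    finally show ?thesis .
  qed simp
  have "(\<integral>\<^sup>+\<omega>. ennreal (T \<omega> powr q) \<partial>M)
     \<le> (\<integral>\<^sup>+\<omega>. (\<Sum>j. ennreal ((real j + 1) powr q) * indicator {\<omega>\<in>space M. real j < T \<omega>} \<omega>) \<partial>M)"
    by (intro nn_integral_mono le)
  also have "\<dots> = (\<Sum>j. ennreal ((real j + 1) powr q) * emeasure M {\<omega>\<in>space M. real j < T \<omega>})"
    by (subst nn_integral_suminf) (auto intro!: suminf_cong simp: nn_integral_cmult)
  also have "\<dots> = (\<Sum>j. ennreal ((real j + 1) powr q * prob {\<omega>\<in>space M. real j < T \<omega>}))"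
    by (simp add: emeasure_eq_measure ennreal_mult)
  also have "\<dots> \<le> (\<Sum>j. ennreal (B * ((real j + 1) powr q * exp (- c * real j))))"
  proof (intro suminf_le ennreal_leI)
    fix j
    show "(real j + 1) powr q * prob {\<omega>\<in>space M. real j < T \<omega>} \<le> B * ((real j + 1) powr q * exp (- c * real j))"
      using mult_left_mono[OF tail[of j], of "(real j + 1) powr q"] by (simp add: algebra_simps)
  qed auto
  also have "\<dots> = ennreal (\<Sum>j. B * ((real j + 1) powr q * exp (- c * real j)))"
    using B sm by (intro suminf_ennreal2 summable_mult) auto
  also have "\<dots> = ennreal (B * (\<Sum>j. (real j + 1) powr q * exp (- c * real j)))"
    by (subst suminf_mult[OF sm]) rule
  finally show ?thesis .
qed

lemma Fubini_bounded:
  fixes f :: "'a \<Rightarrow> 'b \<Rightarrow> real"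
  assumes "prob_space M" "prob_space N"
    and f: "(\<lambda>p. f (fst p) (snd p)) \<in> borel_measurable (M \<Otimes>\<^sub>M N)" and B: "\<And>x y. \<bar>f x y\<bar> \<le> B"
  shows "(\<integral>x. (\<integral>y. f x y \<partial>N) \<partial>M) = (\<integral>y. (\<integral>x. f x y \<partial>M) \<partial>N)"
proof -
  interpret M: prob_space M by fact
  interpret N: prob_space N by fact
  interpret P: pair_prob_space M N ..
  have "integrable (M \<Otimes>\<^sub>M N) (\<lambda>(x, y). f x y)"
    using f B by (intro P.P.integrable_const_bound[where B=B]) (auto simp: case_prod_unfold)
  then show ?thesis by (rule P.Fubini_integral[symmetric])
qed

lemma less_powr_iff:
  fixes r v a :: real
  assumes "0 \<le> r" "0 \<le> v" "0 < a"
  shows "r < v powr a \<longleftrightarrow> r powr (1 / a) < v"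
proof
  assume "r < v powr a"
  then have "r powr (1 / a) < (v powr a) powr (1 / a)"
    using assms by (intro powr_less_mono2) auto
  then show "r powr (1 / a) < v" using assms by (simp add: powr_powr)
next
  assume "r powr (1 / a) < v"
  then have "(r powr (1 / a)) powr a < v powr a"
    using assms by (intro powr_less_mono2) auto
  then show "r < v powr a" using assms by (simp add: powr_powr)
qed

lemma (in prob_space) indep_vars_reindex:
  assumes ind: "indep_vars (\<lambda>_. N) X (f ` I)" and inj: "inj_on f I"
  shows "indep_vars (\<lambda>_. N) (\<lambda>i. X (f i)) I"
  unfolding indep_vars_def2
proof (intro conjI ballI)
  show "random_variable N (X (f i))" if "i \<in> I" for i
    using ind that by (auto simp: indep_vars_def2)
  define F where "F i = {X i -` A \<inter> space M | A. A \<in> sets N}" for i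
  have F: "indep_sets F (f ` I)"
    using ind by (simp add: indep_vars_def2 F_def[abs_def])
  have "indep_sets (\<lambda>i. F (f i)) I"
  proof (rule indep_setsI)
    show "F (f i) \<subseteq> events" if "i \<in> I" for i
      using F that by (auto simp: indep_sets_def)
    fix A J assume J: "J \<noteq> {}" "J \<subseteq> I" "finite J" and A: "\<forall>j\<in>J. A j \<in> F (f j)"
    have injJ: "inj_on f J" using inj J(2) by (rule inj_on_subset)
    define A' where "A' i = A (the_inv_into J f i)" for i
    have A': "A' (f j) = A j" if "j \<in> J" for j
      using that injJ by (simp add: A'_def the_inv_into_f_f)
    have "prob (\<Inter>i\<in>f ` J. A' i) = (\<Prod>i\<in>f ` J. prob (A' i))"
      using J A A' by (intro indep_setsD[OF F]) auto
    then show "prob (\<Inter>j\<in>J. A j) = (\<Prod>j\<in>J. prob (A j))"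
      using A' injJ by (simp add: prod.reindex cong: prod.cong)
  qed
  then show "indep_sets (\<lambda>i. {X (f i) -` A \<inter> space M | A. A \<in> sets N}) I"
    by (simp add: F_def[abs_def])
qed

section \<open>Monotone sums and Poisson averages\<close>

lemma summable_Suc_powr: "s > 1 \<Longrightarrow> summable (\<lambda>k. (real k + 1) powr (- s))"
  using summable_Suc_iff[of "\<lambda>n. real n powr (- s)"] by (simp add: summable_real_powr_iff add.commute)

text \<open>
Partial sums of a decreasing sequence form a concave sequence starting at 0: the graph of the partial
sums lies below the line through its points at 0 and \<open>n\<close> to the right of \<open>n\<close>, and above this line to the left.
\<close>

lemma decreasing_sum_increment_le:
  fixes \<mu> :: "nat \<Rightarrow> real"
  assumes nonneg: "\<And>j. 0 \<le> \<mu> j" and dec: "\<And>j. \<mu> (Suc j) \<le> \<mu> j" and n: "n \<ge> 1"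
  shows "\<bar>(\<Sum>j<k. \<mu> j) - (\<Sum>j<n. \<mu> j)\<bar> \<le> \<bar>real k - real n\<bar> * ((\<Sum>j<n. \<mu> j) / real n)"
proof -
  have anti: "\<mu> j \<le> \<mu> i" if "i \<le> j" for i j
    using that dec by (rule lift_Suc_antimono_le[rotated])
  have low: "real k * \<mu> k \<le> (\<Sum>j<k. \<mu> j)" for k
    using sum_bounded_below[of "{..<k}" "\<mu> k" \<mu>] anti by simp
  have high: "(\<Sum>j=k..<l. \<mu> j) \<le> real (l - k) * \<mu> k" for k l
    using sum_bounded_above[of "{k..<l}" \<mu> "\<mu> k"] anti by simp
  show ?thesis
  proof (cases "n \<le> k")
    case True
    have "(\<Sum>j<k. \<mu> j) - (\<Sum>j<n. \<mu> j) = (\<Sum>j=n..<k. \<mu> j)"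
      using True by (simp add: lessThan_atLeast0 sum_diff_nat_ivl)
    moreover have "0 \<le> (\<Sum>j=n..<k. \<mu> j)" by (intro sum_nonneg nonneg)
    moreover have "real (k - n) * \<mu> n \<le> real (k - n) * ((\<Sum>j<n. \<mu> j) / real n)"
      using low[of n] n by (intro mult_left_mono) (simp_all add: field_simps)
    ultimately show ?thesis using high[of n k] True by (simp add: of_nat_diff)
  next
    case False
    define r s where "r = (\<Sum>j<k. \<mu> j)" and "s = (\<Sum>j=k..<n. \<mu> j)"
    have rs: "(\<Sum>j<n. \<mu> j) = r + s"
      using False sum.atLeastLessThan_concat[of 0 k n \<mu>] by (simp add: r_def s_def lessThan_atLeast0)
    have s0: "0 \<le> s" unfolding s_def by (intro sum_nonneg nonneg)
    have "real k * s \<le> real k * (real (n - k) * \<mu> k)"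
      unfolding s_def by (intro mult_left_mono high) simp
    also have "\<dots> = real (n - k) * (real k * \<mu> k)" by simp
    also have "\<dots> \<le> real (n - k) * r"
      unfolding r_def by (intro mult_left_mono low) simp
    finally have "real n * s \<le> (real n - real k) * (r + s)"
      using False by (simp add: of_nat_diff algebra_simps)
    then have "s \<le> (real n - real k) * ((r + s) / real n)"
      using n by (simp add: field_simps)
    then show ?thesis using s0 False unfolding rs r_def[symmetric] by simp
  qed
qed

text \<open>
By Cauchy-Schwarz the terms from \<open>K\<close> on contribute at most the tail of the series of squares,
while the contribution of the finitely many terms before \<open>K\<close> vanishes in the limit.
\<close>

lemma square_of_sum_over_n_tendsto_0:
  fixes f :: "nat \<Rightarrow> real"
  assumes f: "summable (\<lambda>j. (f j)\<^sup>2)"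
  shows "(\<lambda>n. (\<Sum>j<n. f j)\<^sup>2 / real n) \<longlonglongrightarrow> 0"
proof (rule LIMSEQ_I)
  fix e :: real assume e: "e > 0"
  then obtain K where K: "\<And>m n. m \<ge> K \<Longrightarrow> norm (\<Sum>j=m..<n. (f j)\<^sup>2) < e / 4"
    using f unfolding summable_Cauchy by (meson divide_pos_pos zero_less_numeral)
  define A where "A = (\<Sum>j<K. f j)"
  obtain n0 where n0: "real n0 > 4 * A\<^sup>2 / e" using reals_Archimedean2 by blast
  show "\<exists>N. \<forall>n\<ge>N. norm ((\<Sum>j<n. f j)\<^sup>2 / real n - 0) < e"
  proof (intro exI[of _ "max (max K n0) 1"] allI impI)
    fix n assume n: "max (max K n0) 1 \<le> n"
    have "(\<Sum>j<n. f j) = A + (\<Sum>j=K..<n. f j)"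
      using n sum.atLeastLessThan_concat[of 0 K n f] by (simp add: A_def lessThan_atLeast0)
    then have "(\<Sum>j<n. f j)\<^sup>2 \<le> 2 * A\<^sup>2 + 2 * (\<Sum>j=K..<n. f j)\<^sup>2"
      by (simp add: square_sum_le)
    also have "(\<Sum>j=K..<n. f j)\<^sup>2 \<le> (\<Sum>j=K..<n. 1\<^sup>2) * (\<Sum>j=K..<n. (f j)\<^sup>2)"
      using Cauchy_Schwarz_ineq_sum[of "\<lambda>_. 1" f "{K..<n}"] by simp
    also have "\<dots> \<le> real n * (e / 4)"
      using K[of K n] e by (intro mult_mono) (auto intro: sum_nonneg)
    finally have "(\<Sum>j<n. f j)\<^sup>2 \<le> 2 * A\<^sup>2 + real n * (e / 2)" by (simp add: mult.commute)
    moreover have "4 * A\<^sup>2 < e * real n"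
    proof -
      have "4 * A\<^sup>2 < e * real n0" using n0 e by (simp add: field_simps)
      also have "\<dots> \<le> e * real n" using n e by simp
      finally show ?thesis .
    qed
    ultimately have "(\<Sum>j<n. f j)\<^sup>2 < e * real n" by (simp add: algebra_simps)
    then show "norm ((\<Sum>j<n. f j)\<^sup>2 / real n - 0) < e"
      using n by (simp add: divide_less_eq)
  qed
qed

text \<open>
With the Poisson weights \<open>p\<close>, the identity \<open>(k + 1) * p (k + 1) = r * p k\<close> gives the factorial moments
\<open>r\<close> of \<open>k\<close> and \<open>r^2\<close> of \<open>k * (k - 1)\<close>, of which \<open>(k - r)^2\<close> is a combination.
\<close>

lemma poisson_second_central_moment:
  assumes r: "r > 0"
  shows "(\<integral>\<^sup>+k. ennreal ((real k - r)\<^sup>2) \<partial>measure_pmf (poisson_pmf r)) = ennreal r"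
proof -
  define p where "p k = r ^ k / fact k * exp (- r)" for k
  have p0: "p k \<ge> 0" for k using r by (simp add: p_def)
  have s0: "p sums 1"
  proof -
    have "(\<lambda>k. inverse (fact k) * r ^ k) sums exp r" using exp_converges[of r] by (simp add: scaleR_conv_of_real)
    from sums_mult2[OF this, of "exp (-r)"] show ?thesis
      by (simp add: p_def[abs_def] exp_minus field_simps)
  qed
  have step: "real (Suc k) * p (Suc k) = r * p k" for k
    by (simp add: p_def field_simps del: of_nat_Suc)
  have s1: "(\<lambda>k. real k * p k) sums r"
  proof -
    have "(\<lambda>k. real (Suc k) * p (Suc k)) sums r"
      unfolding step using sums_mult[OF s0, of r] by simp
    then show ?thesis
      using sums_Suc_iff[where f="\<lambda>k. real k * p k" and s=r] by simp
  qed
  have s2: "(\<lambda>k. real k * (real k - 1) * p k) sums r\<^sup>2"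
  proof -
    have "real (Suc k) * (real (Suc k) - 1) * p (Suc k) = r * (real k * p k)" for k
    proof -
      have "real (Suc k) * (real (Suc k) - 1) * p (Suc k) = real k * (real (Suc k) * p (Suc k))"
        by (simp add: algebra_simps)
      then show ?thesis by (simp only: step) (simp add: algebra_simps)
    qed
    moreover have "(\<lambda>k. r * (real k * p k)) sums (r * r)" by (rule sums_mult[OF s1])
    ultimately have "(\<lambda>k. real (Suc k) * (real (Suc k) - 1) * p (Suc k)) sums (r * r)" by (simp only:)
    then show ?thesis
      using sums_Suc_iff[where f="\<lambda>k. real k * (real k - 1) * p k" and s="r * r"] by (simp add: power2_eq_square)
  qed
  have "(\<lambda>k. real k * (real k - 1) * p k + (1 - 2 * r) * (real k * p k) + r\<^sup>2 * p k) sums (r\<^sup>2 + (1 - 2 * r) * r + r\<^sup>2 * 1)"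
    by (intro sums_add sums_mult s0 s1 s2)
  then have s: "(\<lambda>k. p k * (real k - r)\<^sup>2) sums r"
    by (simp add: power2_eq_square algebra_simps)
  have "(\<integral>\<^sup>+k. ennreal ((real k - r)\<^sup>2) \<partial>measure_pmf (poisson_pmf r))
      = (\<Sum>k. ennreal (p k) * ennreal ((real k - r)\<^sup>2))"
    using r by (simp add: nn_integral_measure_pmf nn_integral_count_space_nat p_def)
  also have "\<dots> = (\<Sum>k. ennreal (p k * (real k - r)\<^sup>2))"
    using p0 by (simp add: ennreal_mult)
  also have "\<dots> = ennreal r"
    using s p0 by (subst suminf_ennreal2) (auto simp: sums_iff)
  finally show ?thesis .
qed

text \<open>
The Poisson law with mean \<open>n\<close> puts vanishing mass on every finite set, and outside of a
finite set \<open>\<delta>\<close> is small.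
\<close>

lemma poisson_mean_of_null_sequence:
  fixes \<delta> :: "nat \<Rightarrow> real"
  assumes \<delta>: "\<delta> \<longlonglongrightarrow> 0" "\<And>k. 0 \<le> \<delta> k"
  shows "(\<lambda>n. measure_pmf.expectation (poisson_pmf (real n)) \<delta>) \<longlonglongrightarrow> 0"
proof (rule LIMSEQ_I)
  fix e :: real assume e: "e > 0"
  obtain D where D: "\<And>k. \<bar>\<delta> k\<bar> \<le> D" "D > 0"
    using convergent_imp_Bseq[of \<delta>] \<delta>(1) by (auto simp: convergent_def Bseq_def)
  obtain K where "\<forall>k\<ge>K. norm (\<delta> k - 0) < e / 2"
    using LIMSEQ_D[OF \<delta>(1), of "e / 2"] e by auto
  then have K: "\<And>k. k \<ge> K \<Longrightarrow> \<delta> k < e / 2"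
    by (auto simp: abs_less_iff)
  have "(\<lambda>n. \<Sum>k<K. D * (real n ^ k / fact k * exp (- real n))) \<longlonglongrightarrow> (\<Sum>k<K. D * 0)"
  proof (intro tendsto_intros)
    fix k
    have "((\<lambda>x::real. x ^ k / exp x) \<longlongrightarrow> 0) at_top" by (rule tendsto_power_div_exp_0)
    then have "(\<lambda>n. real n ^ k / exp (real n)) \<longlonglongrightarrow> 0"
      by (rule filterlim_compose) (rule filterlim_real_sequentially)
    from tendsto_mult_left[OF this, of "1 / fact k"]
    show "(\<lambda>n. real n ^ k / fact k * exp (- real n)) \<longlonglongrightarrow> 0"
      by (simp add: exp_minus field_simps)
  qed
  then obtain n1 where "\<forall>n\<ge>n1. norm ((\<Sum>k<K. D * (real n ^ k / fact k * exp (- real n))) - 0) < e / 2"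
    using LIMSEQ_D[OF _ half_gt_zero[OF e], of _ 0] unfolding mult_zero_right sum.neutral_const by blast
  then have n1: "\<And>n. n \<ge> n1 \<Longrightarrow> (\<Sum>k<K. D * (real n ^ k / fact k * exp (- real n))) < e / 2"
    by (auto simp: abs_less_iff)
  show "\<exists>n0. \<forall>n\<ge>n0. norm (measure_pmf.expectation (poisson_pmf (real n)) \<delta> - 0) < e"
  proof (intro exI[of _ "max n1 1"] allI impI)
    fix n assume n: "max n1 1 \<le> n"
    let ?P = "poisson_pmf (real n)"
    have bnd: "\<delta> k \<le> e / 2 + (\<Sum>j<K. D * indicator {j} k)" for k
    proof (cases "k < K")
      case True
      have "(\<Sum>j<K. D * indicator {j} k) = (\<Sum>j<K. if j = k then D else 0)"
        by (intro sum.cong) (auto simp: indicator_def)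
      also have "\<dots> = D" using True by simp
      finally have eqD: "(\<Sum>j<K. D * indicator {j} k) = D" .
      show ?thesis unfolding eqD using D(1)[of k] e by linarith
    next
      case False
      then have "\<delta> k < e / 2" using K by simp
      moreover have "0 \<le> (\<Sum>j<K. D * indicator {j} k)" using D(2) by (intro sum_nonneg) simp
      ultimately show ?thesis by simp
    qed
    have ind: "integrable (measure_pmf ?P) (\<lambda>k. indicator {j} k :: real)" for j
      by (rule measure_pmf.integrable_const_bound[where B=1]) (auto simp: indicator_def)
    have sum_int: "integrable (measure_pmf ?P) (\<lambda>k. \<Sum>j<K. D * indicator {j} k)"
      by (intro Bochner_Integration.integrable_sum Bochner_Integration.integrable_mult_right ind)
    have "measure_pmf.expectation ?P \<delta> \<le> measure_pmf.expectation ?P (\<lambda>k. e / 2 + (\<Sum>j<K. D * indicator {j} k))"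
    proof (intro integral_mono bnd)
      show "integrable (measure_pmf ?P) \<delta>"
        using D by (intro measure_pmf.integrable_const_bound[where B=D]) auto
      show "integrable (measure_pmf ?P) (\<lambda>k. e / 2 + (\<Sum>j<K. D * indicator {j} k))"
        using sum_int by (intro Bochner_Integration.integrable_add) auto
    qed
    also have "\<dots> = e / 2 + measure_pmf.expectation ?P (\<lambda>k. \<Sum>j<K. D * indicator {j} k)"
      using sum_int by (subst Bochner_Integration.integral_add) auto
    also have "measure_pmf.expectation ?P (\<lambda>k. \<Sum>j<K. D * indicator {j} k) = (\<Sum>j<K. D * pmf ?P j)"
      using ind by (subst Bochner_Integration.integral_sum) (auto simp: pmf.rep_eq)
    also have "e / 2 + (\<Sum>j<K. D * pmf ?P j) < e"
      using n1[of n] n by simp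
    finally show "norm (measure_pmf.expectation ?P \<delta> - 0) < e"
      using \<delta>(2) by (simp add: integral_nonneg)
  qed
qed

section \<open>The uniform law on the cube and the capped distance\<close>

definition cube_law :: "(real ^ 'd) measure"
  where "cube_law = uniform_measure lborel unit_cube"

lemma emeasure_lborel_box_cart:
  fixes l u :: "real ^ 'd"
  assumes "\<And>i. l $ i \<le> u $ i"
  shows "emeasure lborel (box l u) = ennreal (\<Prod>i\<in>UNIV. u $ i - l $ i)"
    and "emeasure lborel (cbox l u) = ennreal (\<Prod>i\<in>UNIV. u $ i - l $ i)"
proof -
  have *: "(\<Prod>b\<in>Basis. (u - l) \<bullet> b) = (\<Prod>i\<in>UNIV. u $ i - l $ i)"
    by (subst prod.reindex_bij_betw[of "\<lambda>i. axis i 1" UNIV Basis, symmetric])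
      (auto simp: Basis_vec_def inner_axis axis_eq_axis bij_betw_def inj_on_def)
  have le: "\<And>b. b \<in> Basis \<Longrightarrow> l \<bullet> b \<le> u \<bullet> b"
    using assms by (auto simp: Basis_vec_def inner_axis)
  show "emeasure lborel (box l u) = ennreal (\<Prod>i\<in>UNIV. u $ i - l $ i)"
    "emeasure lborel (cbox l u) = ennreal (\<Prod>i\<in>UNIV. u $ i - l $ i)"
    using le by (simp_all add: emeasure_lborel_box_eq emeasure_lborel_cbox_eq *)
qed

lemma unit_cube_eq_box: "unit_cube = box 0 ((\<chi> i. 1) :: real ^ 'd)"
  by (auto simp: unit_cube_def mem_box_cart)

lemma emeasure_unit_cube: "emeasure lborel (unit_cube :: (real ^ 'd) set) = 1"
  unfolding unit_cube_eq_box by (subst emeasure_lborel_box_cart) auto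

lemma unit_cube_borel[measurable]: "(unit_cube :: (real ^ 'd) set) \<in> sets borel"
  unfolding unit_cube_eq_box by simp

lemma prob_space_cube_law: "prob_space (cube_law :: (real ^ 'd) measure)"
  unfolding cube_law_def by (rule prob_space_uniform_measure) (simp_all add: emeasure_unit_cube)

lemma sets_cube_law[simp, measurable_cong]: "sets cube_law = sets borel"
  by (simp add: cube_law_def)

lemma space_cube_law[simp]: "space cube_law = UNIV"
  by (simp add: cube_law_def)

lemma AE_cube_law: "AE y in (cube_law :: (real ^ 'd) measure). y \<in> unit_cube"
  unfolding cube_law_def by (rule AE_uniform_measureI) simp_all

lemma emeasure_cube_law: 
  fixes A :: "(real ^ 'd) set"
  assumes "A \<in> sets borel" shows "emeasure cube_law A = emeasure lborel (unit_cube \<inter> A)"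
  using assms by (simp add: cube_law_def emeasure_unit_cube divide_ennreal_def)

lemma cube_law_singleton: "measure cube_law {p :: real ^ 'd} = 0"
proof -
  have "emeasure lborel (unit_cube \<inter> {p}) \<le> emeasure lborel {p}"
    by (rule emeasure_mono) auto
  then show ?thesis by (simp add: measure_def emeasure_cube_law)
qed

lemma dist_unit_cube_le:
  fixes x y :: "real ^ 'd"
  assumes "x \<in> unit_cube" "y \<in> unit_cube"
  shows "dist x y \<le> real CARD('d)"
proof -
  have "\<bar>(x - y) $ i\<bar> \<le> 1" for i
    using assms by (auto simp: unit_cube_def abs_le_iff dest!: spec[of _ i])
  then have "(\<Sum>i\<in>UNIV. \<bar>(x - y) $ i\<bar>) \<le> (\<Sum>i\<in>(UNIV :: 'd set). 1)" by (intro sum_mono)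
  then show ?thesis using norm_le_l1_cart[of "x - y"] by (simp add: dist_norm)
qed

text \<open>
A box of side \<open>s = r / d\<close> around \<open>y\<close> lies in the ball, as the Euclidean norm is at most the sum of the
moduli of the coordinates. Cut off at the faces of the cube, each side still has length at least \<open>s\<close>,
because \<open>s \<le> 1\<close>: so the bound also holds near the boundary.
\<close>

lemma cube_law_cball_ge:
  fixes y :: "real ^ 'd"
  assumes y: "y \<in> unit_cube" and r: "0 \<le> r" "r \<le> real CARD('d)"
  shows "(r / real CARD('d)) ^ CARD('d) \<le> measure cube_law (cball y r)"
proof -
  interpret prob_space "cube_law :: (real ^ 'd) measure" by (rule prob_space_cube_law)
  define s where "s = r / real CARD('d)"
  have s: "0 \<le> s" "s \<le> 1" using r by (simp_all add: s_def divide_le_eq)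
  define l u :: "real ^ 'd" where "l = (\<chi> i. max 0 (y $ i - s))" and "u = (\<chi> i. min 1 (y $ i + s))"
  have y': "0 < y $ i" "y $ i < 1" for i using y by (auto simp: unit_cube_def)
  have side: "s \<le> u $ i - l $ i" for i
    using y'[of i] s by (auto simp: l_def u_def min_def max_def)
  have "box l u \<subseteq> unit_cube \<inter> cball y r"
  proof
    fix x assume "x \<in> box l u"
    then have x: "0 < x $ i" "x $ i < 1" "\<bar>(y - x) $ i\<bar> \<le> s" for i
      by (auto simp: mem_box_cart l_def u_def abs_le_iff dest: spec[of _ i])
    have "norm (y - x) \<le> (\<Sum>i\<in>UNIV. \<bar>(y - x) $ i\<bar>)" by (rule norm_le_l1_cart)
    also have "\<dots> \<le> (\<Sum>i\<in>(UNIV :: 'd set). s)" by (intro sum_mono x)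
    also have "\<dots> = r" by (simp add: s_def)
    finally show "x \<in> unit_cube \<inter> cball y r" using x by (auto simp: unit_cube_def dist_norm)
  qed
  then have "emeasure lborel (box l u) \<le> emeasure cube_law (cball y r)"
    by (subst emeasure_cube_law) (auto intro!: emeasure_mono)
  moreover have "emeasure lborel (box l u) = ennreal (\<Prod>i\<in>UNIV. u $ i - l $ i)"
    using side s by (intro emeasure_lborel_box_cart) (meson diff_ge_0_iff_ge order_trans)
  moreover have "s ^ CARD('d) \<le> (\<Prod>i\<in>UNIV. u $ i - l $ i)"
    using prod_mono[of UNIV "\<lambda>_. s" "\<lambda>i. u $ i - l $ i"] s side by simp
  ultimately show ?thesis
    using order_trans[OF s(1) side] 
    by (simp add: emeasure_eq_measure s_def[symmetric] prod_nonneg)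
qed

lemma cube_law_cball_le:
  fixes y :: "real ^ 'd"
  assumes r: "0 \<le> r"
  shows "measure cube_law (cball y r) \<le> (2 * r) ^ CARD('d)"
proof -
  interpret prob_space "cube_law :: (real ^ 'd) measure" by (rule prob_space_cube_law)
  define l u :: "real ^ 'd" where "l = (\<chi> i. y $ i - r)" and "u = (\<chi> i. y $ i + r)"
  have "cball y r \<subseteq> cbox l u"
  proof
    fix x assume "x \<in> cball y r"
    then have "\<bar>(y - x) $ i\<bar> \<le> r" for i
      using component_le_norm_cart[of "y - x" i] by (simp add: dist_norm)
    then have "\<bar>y $ i - x $ i\<bar> \<le> r" for i by simp
    then show "x \<in> cbox l u" by (simp add: mem_box_cart l_def u_def abs_le_iff) (smt (verit))
  qed
  then have "emeasure cube_law (cball y r) \<le> emeasure lborel (cbox l u)"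
    by (subst emeasure_cube_law) (auto intro!: emeasure_mono)
  also have "\<dots> = ennreal (\<Prod>i\<in>UNIV. u $ i - l $ i)"
    using r by (intro emeasure_lborel_box_cart) (simp add: l_def u_def)
  also have "\<dots> = ennreal ((2 * r) ^ CARD('d))"
    by (simp add: l_def u_def)
  finally show ?thesis using r by (simp add: emeasure_eq_measure)
qed

text \<open>
The distance from \<open>y\<close> to the points \<open>x 1, ..., x k\<close>, cut off at \<open>d\<close>, which is at least the diameter of
the cube. The cap does not change the distances inside of the cube, but it makes all powers bounded
everywhere, and it settles the case \<open>k = 0\<close>.
\<close>

definition capped_dist :: "(nat \<Rightarrow> real ^ 'd) \<Rightarrow> nat \<Rightarrow> real ^ 'd \<Rightarrow> real"
  where "capped_dist x k y = Min (insert (real CARD('d)) ((\<lambda>i. dist y (x i)) ` {1..k}))"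

lemma capped_dist_0[simp]: "capped_dist x 0 y = real CARD('d)" for x :: "nat \<Rightarrow> real ^ 'd"
  by (simp add: capped_dist_def)

lemma capped_dist_Suc: "capped_dist x (Suc k) y = min (capped_dist x k y) (dist y (x (Suc k)))"
  by (simp add: capped_dist_def atLeastAtMostSuc_conv insert_commute[of "real CARD('a)"] min.commute del: Min_insert)
     (simp add: Min_insert min.commute)

lemma capped_dist_bounds: 
  fixes x :: "nat \<Rightarrow> real ^ 'd"
  shows "0 \<le> capped_dist x k y" "capped_dist x k y \<le> real CARD('d)"
  by (simp_all add: capped_dist_def)

lemma less_capped_dist_iff:
  fixes x :: "nat \<Rightarrow> real ^ 'd"
  shows "r < capped_dist x k y \<longleftrightarrow> r < real CARD('d) \<and> (\<forall>i\<in>{1..k}. r < dist y (x i))"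
  by (simp add: capped_dist_def)

lemma capped_dist_Suc_le: "capped_dist x (Suc k) y \<le> capped_dist x k y"
  by (simp add: capped_dist_Suc)

lemma capped_dist_cong: "(\<And>i. 1 \<le> i \<Longrightarrow> i \<le> k \<Longrightarrow> x i = x' i) \<Longrightarrow> capped_dist x k y = capped_dist x' k y"
  unfolding capped_dist_def by (intro arg_cong[where f=Min] arg_cong[where f="insert _"] image_cong) auto

lemma measurable_capped_dist[measurable (raw)]:
  fixes f :: "'a \<Rightarrow> nat \<Rightarrow> real ^ 'd"
  assumes "\<And>i. 1 \<le> i \<Longrightarrow> i \<le> k \<Longrightarrow> (\<lambda>\<omega>. f \<omega> i) \<in> borel_measurable N" and [measurable]: "g \<in> borel_measurable N"
  shows "(\<lambda>\<omega>. capped_dist (f \<omega>) k (g \<omega>)) \<in> borel_measurable N"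
  using assms(1)
proof (induction k)
  case (Suc k)
  have [measurable]: "(\<lambda>\<omega>. f \<omega> (Suc k)) \<in> borel_measurable N" "(\<lambda>\<omega>. capped_dist (f \<omega>) k (g \<omega>)) \<in> borel_measurable N"
    using Suc by auto
  show ?case unfolding capped_dist_Suc by measurable
qed simp

lemma measurable_capped_dist_point[measurable]: "capped_dist x k \<in> borel_measurable borel"
  by (rule measurable_capped_dist) auto

section \<open>Moments of the distance to the sample\<close>

locale uniform_sample = prob_space M for M :: "'w measure" +
  fixes U :: "nat \<Rightarrow> 'w \<Rightarrow> real ^ 'd"
  assumes indep: "indep_vars (\<lambda>_. borel) U {1..}"
    and law: "\<And>i. i \<ge> 1 \<Longrightarrow> distr M borel (U i) = cube_law"
begin

sublocale cube: prob_space "cube_law :: (real ^ 'd) measure"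
  by (rule prob_space_cube_law)

lemma U_measurable: "i \<ge> 1 \<Longrightarrow> U i \<in> borel_measurable M"
  using indep by (auto simp: indep_vars_def2)

definition nn :: "nat \<Rightarrow> 'w \<Rightarrow> real ^ 'd \<Rightarrow> real"
  where "nn k \<omega> y = capped_dist (\<lambda>i. U i \<omega>) k y"

lemma measurable_nn[measurable (raw)]:
  assumes "f \<in> measurable N M" "g \<in> borel_measurable N"
  shows "(\<lambda>x. nn k (f x) (g x)) \<in> borel_measurable N"
  unfolding nn_def using assms U_measurable by (intro measurable_capped_dist) (auto intro: measurable_compose)

lemma nn_bounds: "0 \<le> nn k \<omega> y" "nn k \<omega> y \<le> real CARD('d)"
  by (simp_all add: nn_def capped_dist_bounds)

lemma nn_powr_le: "p \<ge> 0 \<Longrightarrow> nn k \<omega> y powr p \<le> real CARD('d) powr p"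
  by (intro powr_mono2 nn_bounds)

lemma prob_avoid:
  assumes [measurable]: "A \<in> sets borel"
  shows "prob {\<omega>\<in>space M. \<forall>i\<in>{1..k}. U i \<omega> \<notin> A} = (1 - measure cube_law A) ^ k"
proof (cases "k = 0")
  case False
  have "{\<omega>\<in>space M. \<forall>i\<in>{1..k}. U i \<omega> \<notin> A} = (\<Inter>i\<in>{1..k}. U i -` (- A) \<inter> space M)"
    using False by auto
  also have "prob \<dots> = (\<Prod>i\<in>{1..k}. prob (U i -` (- A) \<inter> space M))"
    using False indep by (intro indep_varsD[where I="{1..}" and M'="\<lambda>_. borel"]) auto
  also have "\<dots> = (\<Prod>i\<in>{1..k}. 1 - measure cube_law A)"
  proof (intro prod.cong refl)
    fix i assume "i \<in> {1..k}"
    then have "prob (U i -` (- A) \<inter> space M) = measure cube_law (- A)"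
      using U_measurable[of i] \<open>i \<in> {1..k}\<close> by (subst law[of i, symmetric]) (auto simp: measure_distr)
    also have "\<dots> = 1 - measure cube_law A"
      using cube.prob_compl[of A] by (simp add: Compl_eq_Diff_UNIV)
    finally show "prob (U i -` (- A) \<inter> space M) = 1 - measure cube_law A" .
  qed
  finally show ?thesis by simp
qed (simp add: prob_space)

text \<open>
The distance from \<open>y\<close> to the sample exceeds \<open>r\<close> iff all points avoid the ball of radius \<open>r\<close> around \<open>y\<close>.
\<close>

lemma prob_less_nn:
  assumes "0 \<le> r" "r < real CARD('d)"
  shows "prob {\<omega>\<in>space M. r < nn k \<omega> y} = (1 - measure cube_law (cball y r)) ^ k"
proof -
  have "{\<omega>\<in>space M. r < nn k \<omega> y} = {\<omega>\<in>space M. \<forall>i\<in>{1..k}. U i \<omega> \<notin> cball y r}"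
    using assms by (auto simp: nn_def less_capped_dist_iff not_le)
  then show ?thesis by (simp only: prob_avoid closed_cball borel_closed)
qed

text \<open>
From \<open>(1 - m) ^ k \<le> exp (- k * m)\<close>, where \<open>m \<ge> (r / d) ^ d\<close> is the probability of a ball.
The factor \<open>exp 1\<close> pays for replacing \<open>k\<close> by \<open>k + 1\<close>, which keeps the estimates meaningful at \<open>k = 0\<close>.
\<close>

lemma nn_tail_le:
  assumes y: "y \<in> unit_cube" and r: "0 \<le> r"
  shows "prob {\<omega>\<in>space M. r < nn k \<omega> y} \<le> exp 1 * exp (- ((1 / real CARD('d)) ^ CARD('d)) * ((real k + 1) * r ^ CARD('d)))"
proof (cases "r < real CARD('d)")
  case True
  define m where "m = measure cube_law (cball y r)"
  have m: "(r / real CARD('d)) ^ CARD('d) \<le> m" "m \<le> 1"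
    using cube_law_cball_ge[OF y r] True by (auto simp: m_def)
  have "prob {\<omega>\<in>space M. r < nn k \<omega> y} = (1 - m) ^ k"
    using prob_less_nn r True by (simp add: m_def)
  also have "\<dots> \<le> exp (- ((r / real CARD('d)) ^ CARD('d))) ^ k"
  proof (rule power_mono)
    show "1 - m \<le> exp (- ((r / real CARD('d)) ^ CARD('d)))"
      using m exp_ge_add_one_self[of "- ((r / real CARD('d)) ^ CARD('d))"] by linarith
  qed (use m in simp)
  also have "\<dots> = exp (- (real k * (r / real CARD('d)) ^ CARD('d)))"
    by (simp add: exp_of_nat_mult[symmetric])
  also have "\<dots> \<le> exp (1 - (real k + 1) * (r / real CARD('d)) ^ CARD('d))"
    using m by (simp add: algebra_simps)
  also have "\<dots> = exp 1 * exp (- ((1 / real CARD('d)) ^ CARD('d)) * ((real k + 1) * r ^ CARD('d)))"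
    by (simp add: exp_add[symmetric] power_divide algebra_simps add_divide_distrib)
  finally show ?thesis .
next
  case False
  then have "\<not> r < nn k \<omega> y" for \<omega> using nn_bounds(2)[of k \<omega> y] by linarith
  then have *: "{\<omega>\<in>space M. r < nn k \<omega> y} = {}" by blast
  show ?thesis unfolding * by simp
qed

text \<open>
By the tail bound the variables \<open>(k + 1) * nn k y ^ d\<close> have exponential tails with constants that do
not depend on \<open>k\<close> and \<open>y\<close>.
\<close>

lemma nn_moment_le:
  assumes p: "p > 0"
  obtains C where "C > 0" "\<And>k y. y \<in> unit_cube \<Longrightarrow> expectation (\<lambda>\<omega>. nn k \<omega> y powr p) \<le> C * (real k + 1) powr (- (p / real CARD('d)))"
proof -
  define q where "q = p / real CARD('d)"
  define c where "c = (1 / real CARD('d)) ^ CARD('d)"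
  define C where "C = exp 1 * (\<Sum>j. (real j + 1) powr q * exp (- c * real j))"
  have q: "q > 0" and c: "c > 0" using p by (simp_all add: q_def c_def)
  have main: "expectation (\<lambda>\<omega>. nn k \<omega> y powr p) \<le> \<bar>C\<bar> * (real k + 1) powr (- q)" if y: "y \<in> unit_cube" for k y
  proof -
    define T where "T \<omega> = (real k + 1) * nn k \<omega> y ^ CARD('d)" for \<omega>
    have T0: "0 \<le> T \<omega>" for \<omega> by (simp add: T_def nn_bounds)
    have [measurable]: "T \<in> borel_measurable M" unfolding T_def by measurable
    have tail: "prob {\<omega>\<in>space M. real j < T \<omega>} \<le> exp 1 * exp (- c * real j)" for j :: nat
    proof -
      \<comment> \<open>the radius at which \<open>(k + 1) * r ^ d\<close> equals \<open>j\<close>\<close>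
      define r where "r = root CARD('d) (real j / (real k + 1))"
      have r0: "r \<ge> 0" by (simp add: r_def)
      have rd: "r ^ CARD('d) = real j / (real k + 1)" by (simp add: r_def)
      have "r < nn k \<omega> y" if "real j < T \<omega>" for \<omega>
      proof -
        have "r ^ CARD('d) < nn k \<omega> y ^ CARD('d)" using that by (simp add: rd T_def divide_less_eq mult.commute)
        then show ?thesis by (rule power_less_imp_less_base) (rule nn_bounds)
      qed
      then have "prob {\<omega>\<in>space M. real j < T \<omega>} \<le> prob {\<omega>\<in>space M. r < nn k \<omega> y}"
        by (intro finite_measure_mono) auto
      also have "\<dots> \<le> exp 1 * exp (- ((1 / real CARD('d)) ^ CARD('d)) * ((real k + 1) * r ^ CARD('d)))"
        by (rule nn_tail_le[OF y r0])
      also have "(real k + 1) * r ^ CARD('d) = real j" by (simp add: rd)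
      finally show ?thesis by (simp add: c_def)
    qed
    have bnd: "T \<omega> powr q \<le> ((real k + 1) * real CARD('d) ^ CARD('d)) powr q" for \<omega>
      using q nn_bounds by (intro powr_mono2) (auto simp: T_def intro!: mult_left_mono power_mono)
    have int: "integrable M (\<lambda>\<omega>. T \<omega> powr q)"
      using bnd by (intro integrable_const_bound[where B="((real k + 1) * real CARD('d) ^ CARD('d)) powr q"]) auto
    have "(\<integral>\<^sup>+\<omega>. ennreal (T \<omega> powr q) \<partial>M) \<le> ennreal C"
      unfolding C_def by (intro moment_le_of_exponential_tail T0 q c tail) auto
    then have "expectation (\<lambda>\<omega>. T \<omega> powr q) \<le> \<bar>C\<bar>"
      using int by (subst (asm) nn_integral_eq_integral) (auto simp: ennreal_le_iff2)
    moreover have "nn k \<omega> y powr p = (real k + 1) powr (- q) * T \<omega> powr q" for \<omega>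
    proof (cases "nn k \<omega> y = 0")
      case False
      then have pos: "nn k \<omega> y > 0" using nn_bounds(1)[of k \<omega> y] by simp
      have "T \<omega> powr q = (real k + 1) powr q * (nn k \<omega> y powr real CARD('d)) powr q"
        using pos by (simp add: T_def powr_mult powr_realpow)
      also have "(nn k \<omega> y powr real CARD('d)) powr q = nn k \<omega> y powr p"
        by (simp add: powr_powr q_def)
      finally show ?thesis by (simp add: powr_minus)
    qed (use q in \<open>simp add: T_def\<close>)
    ultimately show ?thesis
      by (simp add: mult.commute mult_left_mono)
  qed
  show ?thesis
  proof (rule that[of "\<bar>C\<bar> + 1"])
    fix k y assume y: "y \<in> (unit_cube :: (real ^ 'd) set)"
    show "expectation (\<lambda>\<omega>. nn k \<omega> y powr p) \<le> (\<bar>C\<bar> + 1) * (real k + 1) powr (- (p / real CARD('d)))"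
      by (rule order_trans[OF main[OF y]]) (simp add: q_def algebra_simps)
  qed simp
qed

section \<open>Variance of the averaged distance\<close>

text \<open>
Truncated at half the distance from \<open>y\<close> to \<open>z\<close>, the two distances only see disjoint balls. That two
disjoint sets of probabilities \<open>p\<close> and \<open>q\<close> are both avoided by \<open>k\<close> independent points has probability
\<open>(1 - p - q) ^ k\<close>, which is at most the product \<open>(1 - p) ^ k * (1 - q) ^ k\<close>.
\<close>

lemma truncated_nn_negatively_dependent:
  fixes y z :: "real ^ 'd"
  assumes a: "a > 0" and D_def: "D = dist y z / 2"
  shows "expectation (\<lambda>\<omega>. min (nn k \<omega> y) D powr a * min (nn k \<omega> z) D powr a)
    \<le> expectation (\<lambda>\<omega>. min (nn k \<omega> y) D powr a) * expectation (\<lambda>\<omega>. min (nn k \<omega> z) D powr a)"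
proof (rule expectation_mult_le_of_negative_quadrant_dependence)
  have D: "D \<ge> 0" by (simp add: D_def)
  show "min (nn k \<omega> v) D powr a \<le> real CARD('d) powr a" for v \<omega>
    using a D nn_bounds[of k \<omega> v] by (intro powr_mono2) auto
  then show "min (nn k \<omega> v) D powr a \<le> real CARD('d) powr a" for v \<omega> .
  fix r s :: real assume rs: "r \<ge> 0" "s \<ge> 0"
  define r' s' where "r' = r powr (1 / a)" and "s' = s powr (1 / a)"
  have rs': "r' \<ge> 0" "s' \<ge> 0" by (simp_all add: r'_def s'_def)
  have less: "(r < min (nn k \<omega> v) D powr a) \<longleftrightarrow> r' < nn k \<omega> v \<and> r' < D"
    "(s < min (nn k \<omega> v) D powr a) \<longleftrightarrow> s' < nn k \<omega> v \<and> s' < D" for \<omega> v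
    using less_powr_iff[OF rs(1) _ a, of "min (nn k \<omega> v) D"] less_powr_iff[OF rs(2) _ a, of "min (nn k \<omega> v) D"]
      D nn_bounds(1)[of k \<omega> v]
    by (auto simp: r'_def s'_def)
  show "prob {\<omega> \<in> space M. r < min (nn k \<omega> y) D powr a \<and> s < min (nn k \<omega> z) D powr a}
    \<le> prob {\<omega> \<in> space M. r < min (nn k \<omega> y) D powr a} * prob {\<omega> \<in> space M. s < min (nn k \<omega> z) D powr a}"
  proof (cases "r' < D \<and> s' < D \<and> r' < real CARD('d) \<and> s' < real CARD('d)")
    case True
    define A B where "A = cball y r'" and "B = cball z s'"
    have [measurable]: "A \<in> sets borel" "B \<in> sets borel" by (simp_all add: A_def B_def)
    have "A \<inter> B = {}"
    proof (rule ccontr)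
      assume "A \<inter> B \<noteq> {}"
      then obtain v where "dist y v \<le> r'" "dist z v \<le> s'" by (auto simp: A_def B_def)
      then have "dist y z \<le> r' + s'" using dist_triangle3[of y z v] dist_commute[of y v] dist_commute[of z v] by linarith
      with True show False by (simp add: D_def)
    qed
    then have union: "measure cube_law (A \<union> B) = measure cube_law A + measure cube_law B"
      by (intro cube.finite_measure_Union) auto
    have "prob {\<omega> \<in> space M. r < min (nn k \<omega> y) D powr a \<and> s < min (nn k \<omega> z) D powr a}
        = prob {\<omega> \<in> space M. \<forall>i\<in>{1..k}. U i \<omega> \<notin> A \<union> B}"
      using True unfolding less
      by (intro arg_cong[where f=prob]) (auto simp: nn_def less_capped_dist_iff A_def B_def not_le)
    also have "\<dots> = (1 - (measure cube_law A + measure cube_law B)) ^ k"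
      by (subst prob_avoid) (auto simp: union)
    also have "\<dots> \<le> ((1 - measure cube_law A) * (1 - measure cube_law B)) ^ k"
    proof (rule power_mono)
      show "0 \<le> 1 - (measure cube_law A + measure cube_law B)"
        using cube.prob_le_1[of "A \<union> B"] union by simp
    qed (simp add: algebra_simps)
    also have "\<dots> = prob {\<omega> \<in> space M. r' < nn k \<omega> y} * prob {\<omega> \<in> space M. s' < nn k \<omega> z}"
      using True rs' by (simp add: prob_less_nn A_def B_def power_mult_distrib)
    also have "\<dots> = prob {\<omega> \<in> space M. r < min (nn k \<omega> y) D powr a} * prob {\<omega> \<in> space M. s < min (nn k \<omega> z) D powr a}"
      using True unfolding less by simp
    finally show ?thesis .
  next
    case False
    then have "\<not> (r < min (nn k \<omega> y) D powr a \<and> s < min (nn k \<omega> z) D powr a)" for \<omega>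
      unfolding less using nn_bounds(2)[of k \<omega> y] nn_bounds(2)[of k \<omega> z] by auto
    then have *: "{\<omega> \<in> space M. r < min (nn k \<omega> y) D powr a \<and> s < min (nn k \<omega> z) D powr a} = {}" by blast
    show ?thesis unfolding * by simp
  qed
qed (auto simp: D_def)

text \<open>
The error term of the covariance bound. Two empty balls around \<open>y\<close> and \<open>z\<close> that meet, and of which the
one around \<open>y\<close> is the larger, exist only on the event in this definition.
\<close>

definition far_nn_moment :: "real \<Rightarrow> nat \<Rightarrow> real ^ 'd \<Rightarrow> real ^ 'd \<Rightarrow> real"
  where "far_nn_moment a k y z = expectation (\<lambda>\<omega>. if dist y z \<le> 2 * nn k \<omega> y then nn k \<omega> y powr (2 * a) else 0)"

text \<open>
Unless one of the distances exceeds half of \<open>dist y z\<close>, truncation changes nothing and the truncated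
distances are negatively correlated. Otherwise the product is at most the square of the larger factor.
\<close>

lemma nn_product_expectation_le:
  assumes a: "a > 0"
  shows "expectation (\<lambda>\<omega>. nn k \<omega> y powr a * nn k \<omega> z powr a)
    \<le> expectation (\<lambda>\<omega>. nn k \<omega> y powr a) * expectation (\<lambda>\<omega>. nn k \<omega> z powr a)
      + far_nn_moment a k y z + far_nn_moment a k z y"
proof -
  define D where "D = dist y z / 2"
  define X where "X v \<omega> = min (nn k \<omega> v) D powr a" for v \<omega>
  define H where "H v \<omega> = nn k \<omega> v powr a" for v \<omega>
  define R where "R v \<omega> = (if dist y z \<le> 2 * nn k \<omega> v then nn k \<omega> v powr (2 * a) else 0)" for v \<omega>
  have [measurable]: "X v \<in> borel_measurable M" "H v \<in> borel_measurable M" for v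
    unfolding X_def H_def by measurable
  have [measurable]: "R v \<in> borel_measurable M" for v
    unfolding R_def by measurable
  have D: "D \<ge> 0" by (simp add: D_def)
  have XH: "0 \<le> X v \<omega>" "X v \<omega> \<le> H v \<omega>" "0 \<le> H v \<omega>" "H v \<omega> \<le> real CARD('d) powr a" for v \<omega>
    using a D nn_bounds[of k \<omega> v] nn_powr_le[of a k \<omega> v] by (auto simp: X_def H_def intro!: powr_mono2)
  have R: "0 \<le> R v \<omega>" "R v \<omega> \<le> real CARD('d) powr (2 * a)" for v \<omega>
    using a nn_powr_le[of "2 * a" k \<omega> v] by (auto simp: R_def)
  have int: "integrable M (X v)" "integrable M (H v)" "integrable M (R v)" for v
    using XH R order_trans[OF XH(2,4)] by (auto intro!: integrable_bounded[where B="real CARD('d) powr a"]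
        integrable_bounded[of "R v" "real CARD('d) powr (2 * a)"])
  have intXX: "integrable M (\<lambda>\<omega>. X y \<omega> * X z \<omega>)" "integrable M (\<lambda>\<omega>. H y \<omega> * H z \<omega>)"
    using XH order_trans[OF XH(2,4)] by (auto intro!: integrable_bounded[where B="real CARD('d) powr a * real CARD('d) powr a"] mult_mono simp: abs_mult)
  have pointwise: "H y \<omega> * H z \<omega> \<le> X y \<omega> * X z \<omega> + R y \<omega> + R z \<omega>" for \<omega>
  proof -
    have big: "H u \<omega> * H v \<omega> \<le> R u \<omega>" if "nn k \<omega> v \<le> nn k \<omega> u" "D < nn k \<omega> u" for u v
    proof -
      have "H u \<omega> * H v \<omega> \<le> H u \<omega> * H u \<omega>"
        using that a XH nn_bounds(1)[of k \<omega> v] by (intro mult_left_mono) (auto simp: H_def intro!: powr_mono2)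
      also have "\<dots> = R u \<omega>"
        using that by (simp add: H_def R_def D_def powr_add[symmetric])
      finally show ?thesis .
    qed
    have nonneg: "0 \<le> X y \<omega> * X z \<omega>" using XH by simp
    consider "nn k \<omega> y \<le> D" "nn k \<omega> z \<le> D" | "nn k \<omega> z \<le> nn k \<omega> y" "D < nn k \<omega> y" | "nn k \<omega> y \<le> nn k \<omega> z" "D < nn k \<omega> z"
      by linarith
    then show ?thesis
    proof cases
      case 1
      then have "X y \<omega> = H y \<omega>" "X z \<omega> = H z \<omega>" by (simp_all add: X_def H_def)
      then show ?thesis using R(1)[of y \<omega>] R(1)[of z \<omega>] by simp
    next
      case 2
      then show ?thesis using big[of z y] nonneg R(1)[of z \<omega>] by simp
    next
      case 3
      then show ?thesis using big[of y z] nonneg R(1)[of y \<omega>] by (simp add: mult.commute)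
    qed
  qed
  have "expectation (\<lambda>\<omega>. H y \<omega> * H z \<omega>) \<le> expectation (\<lambda>\<omega>. X y \<omega> * X z \<omega> + R y \<omega> + R z \<omega>)"
    by (intro integral_mono pointwise intXX Bochner_Integration.integrable_add int)
  moreover have "expectation (\<lambda>\<omega>. X y \<omega> * X z \<omega> + R y \<omega> + R z \<omega>)
      = expectation (\<lambda>\<omega>. X y \<omega> * X z \<omega>) + expectation (R y) + expectation (R z)"
    using intXX int by simp
  moreover have "expectation (\<lambda>\<omega>. X y \<omega> * X z \<omega>) \<le> expectation (X y) * expectation (X z)"
    unfolding X_def by (rule truncated_nn_negatively_dependent[OF a]) (simp add: D_def)
  moreover have "expectation (X y) * expectation (X z) \<le> expectation (H y) * expectation (H z)"
    using int XH by (intro mult_mono integral_mono integral_nonneg) auto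
  moreover have "expectation (R y) = far_nn_moment a k y z" "expectation (R z) = far_nn_moment a k z y"
    by (simp_all add: R_def[abs_def] far_nn_moment_def dist_commute)
  ultimately show ?thesis
    unfolding H_def by linarith
qed

text \<open>
The power of the distance to the sample, averaged over a uniform point of the cube: the conditional
expectation of the next edge weight given the sample.
\<close>

definition mean_nn_power :: "real \<Rightarrow> nat \<Rightarrow> 'w \<Rightarrow> real"
  where "mean_nn_power a k \<omega> = (\<integral>y. nn k \<omega> y powr a \<partial>cube_law)"

lemma measurable_mean_nn_power[measurable]: "mean_nn_power a k \<in> borel_measurable M"
proof -
  have "(\<lambda>\<omega>. \<integral>y. nn k \<omega> y powr a \<partial>cube_law) \<in> borel_measurable M"
    by (rule cube.borel_measurable_lebesgue_integral) measurable
  then show ?thesis by (simp add: mean_nn_power_def[abs_def])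
qed

lemma mean_nn_power_bounds:
  assumes "a \<ge> 0"
  shows "0 \<le> mean_nn_power a k \<omega>" "mean_nn_power a k \<omega> \<le> real CARD('d) powr a"
proof -
  have 1: "integrable cube_law (\<lambda>y. nn k \<omega> y powr a)" if "\<omega> \<in> space M"
    using that assms nn_powr_le[of a k \<omega>]
    by (intro cube.integrable_const_bound[where B="real CARD('d) powr a"]) auto
  show "0 \<le> mean_nn_power a k \<omega>" by (simp add: mean_nn_power_def integral_nonneg)
  show "mean_nn_power a k \<omega> \<le> real CARD('d) powr a"
  proof (cases "integrable cube_law (\<lambda>y. nn k \<omega> y powr a)")
    case True
    then show ?thesis unfolding mean_nn_power_def
      using assms nn_powr_le[of a k \<omega>] by (intro cube.integral_le_const) auto
  qed (simp add: mean_nn_power_def not_integrable_integral_eq)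
qed

lemma expectation_mean_nn_power_le:
  assumes p: "p > 0"
  obtains C where "C > 0" "\<And>k. expectation (mean_nn_power p k) \<le> C * (real k + 1) powr (- (p / real CARD('d)))"
proof -
  obtain C where C: "C > 0" "\<And>k y. y \<in> unit_cube \<Longrightarrow>
      expectation (\<lambda>\<omega>. nn k \<omega> y powr p) \<le> C * (real k + 1) powr (- (p / real CARD('d)))"
    using nn_moment_le[OF p] by blast
  have "expectation (mean_nn_power p k) \<le> C * (real k + 1) powr (- (p / real CARD('d)))" for k
  proof -
    have "expectation (mean_nn_power p k) = (\<integral>y. expectation (\<lambda>\<omega>. nn k \<omega> y powr p) \<partial>cube_law)"
      unfolding mean_nn_power_def using p nn_powr_le[of p k]
      by (intro Fubini_bounded[where B="real CARD('d) powr p"] prob_space_axioms prob_space_cube_law) auto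
    also have "\<dots> \<le> C * (real k + 1) powr (- (p / real CARD('d)))"
    proof (rule cube.integral_le_const)
      show "integrable cube_law (\<lambda>y. expectation (\<lambda>\<omega>. nn k \<omega> y powr p))"
      proof (rule cube.integrable_const_bound[where B="real CARD('d) powr p"])
        show "AE y in cube_law. norm (expectation (\<lambda>\<omega>. nn k \<omega> y powr p)) \<le> real CARD('d) powr p"
          using p nn_powr_le[of p k]
          by (auto intro!: AE_I2 integral_le_const integrable_bounded[where B="real CARD('d) powr p"] simp: integral_nonneg)
      qed measurable
      show "AE y in cube_law. expectation (\<lambda>\<omega>. nn k \<omega> y powr p) \<le> C * (real k + 1) powr (- (p / real CARD('d)))"
        using AE_cube_law by eventually_elim (rule C)
    qed
    finally show ?thesis .
  qed
  with C(1) show ?thesis by (rule that)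
qed

text \<open>
The variance is the double integral of the covariances, which are bounded by \<open>far_nn_moment\<close>.
Integrating this over \<open>z\<close> gives the factor \<open>measure cube_law (cball y (2 * nn k y))\<close>, of order
\<open>nn k y ^ d\<close>, so that the variance is bounded by a moment of order \<open>2 * a + d\<close>.
\<close>

lemma mean_nn_power_variance_le:
  assumes a: "a > 0"
  obtains C where "C > 0" "\<And>k. expectation (\<lambda>\<omega>. (mean_nn_power a k \<omega> - expectation (mean_nn_power a k))\<^sup>2)
    \<le> C * (real k + 1) powr (- (1 + 2 * a / real CARD('d)))"
proof -
  let ?d = "real CARD('d)"
  define B where "B = ?d powr a"
  define h where "h k y \<omega> = nn k \<omega> y powr a" for k y \<omega>
  define E where "E k y = expectation (h k y)" for k y
  have [measurable]: "(\<lambda>x. h k (g x) (f x)) \<in> borel_measurable N"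
    if "f \<in> measurable N M" "g \<in> borel_measurable N" for f g k and N :: "'x measure"
    using that unfolding h_def by measurable
  obtain C where C: "C > 0" "\<And>k. expectation (mean_nn_power (2 * a + ?d) k) \<le> C * (real k + 1) powr (- ((2 * a + ?d) / ?d))"
    using expectation_mean_nn_power_le[of "2 * a + ?d"] a by auto
  have "expectation (\<lambda>\<omega>. (mean_nn_power a k \<omega> - expectation (mean_nn_power a k))\<^sup>2)
      \<le> 2 * 4 ^ CARD('d) * C * (real k + 1) powr (- (1 + 2 * a / ?d))" for k
  proof -
    have B: "0 \<le> B" "0 \<le> h k y \<omega>" "h k y \<omega> \<le> B" for y \<omega>
      using a by (simp_all add: B_def h_def nn_powr_le)
    have hh: "\<bar>h k y \<omega> * h k z \<omega>\<bar> \<le> B * B" for y z \<omega>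
      using B by (auto simp: abs_mult intro!: mult_mono)
    have E: "0 \<le> E k y" "E k y \<le> B" for y
      using B unfolding E_def by (auto intro!: integral_nonneg integral_le_const integrable_bounded[where B=B])
    have [measurable]: "E k \<in> borel_measurable cube_law"
      unfolding E_def[abs_def] by measurable
    have bnd: "\<bar>integral\<^sup>L N f\<bar> \<le> K" if "prob_space N" "\<And>x. \<bar>f x\<bar> \<le> K" for N :: "'x measure" and f :: "'x \<Rightarrow> real" and K
    proof -
      interpret N: prob_space N by fact
      have "0 \<le> K" by (rule order_trans[OF abs_ge_zero that(2)])
      show ?thesis
      proof (cases "integrable N f")
        case True
        then have "(\<integral>x. \<bar>f x\<bar> \<partial>N) \<le> K" using that by (intro N.integral_le_const) auto
        then show ?thesis using integral_abs_bound[of N f] by linarith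
      qed (use \<open>0 \<le> K\<close> in \<open>simp add: not_integrable_integral_eq\<close>)
    qed
    note prob = prob_space_axioms cube.prob_space_axioms
    have cint: "integrable cube_law f" if "f \<in> borel_measurable cube_law" "\<And>y. \<bar>f y\<bar> \<le> K" for f :: "real ^ 'd \<Rightarrow> real" and K
      using that by (intro cube.integrable_const_bound[where B=K]) auto
    define B2 where "B2 = ?d powr (2 * a)"
    define g where "g \<omega> y z = (if dist y z \<le> 2 * nn k \<omega> y then nn k \<omega> y powr (2 * a) else 0)" for \<omega> y z
    have gB: "\<bar>g \<omega> y z\<bar> \<le> B2" for \<omega> y z
      using a nn_powr_le[of "2 * a" k \<omega> y] by (auto simp: g_def B2_def)
    define R where "R = far_nn_moment a k"
    have Rg: "R y z = expectation (\<lambda>\<omega>. g \<omega> y z)" for y z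
      by (simp add: R_def far_nn_moment_def g_def)
    have RB: "\<bar>R y z\<bar> \<le> B2" for y z
      unfolding Rg by (rule bnd[OF prob(1) gB])
    have [measurable]: "(\<lambda>x. R (f x) (f' x)) \<in> borel_measurable N"
      if "f \<in> borel_measurable N" "f' \<in> borel_measurable N" for f f' and N :: "'x measure"
      using that unfolding Rg g_def by measurable
    have E': "\<bar>E k y\<bar> \<le> B" for y using E by simp
    have tri: "\<bar>E k y * E k z + R y z + R z y\<bar> \<le> B * B + B2 + B2" for y z
    proof -
      have "\<bar>E k y * E k z\<bar> \<le> B * B" using E B by (auto simp: abs_mult intro!: mult_mono)
      then show ?thesis using RB[of y z] RB[of z y] by linarith
    qed
    have nnB: "\<bar>nn k \<omega> y powr (2 * a + ?d)\<bar> \<le> ?d powr (2 * a + ?d)" for \<omega> y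
      using a nn_powr_le[of "2 * a + ?d" k \<omega> y] by simp
    have V: "mean_nn_power a k \<omega> = (\<integral>y. h k y \<omega> \<partial>cube_law)" for \<omega>
      by (simp add: mean_nn_power_def h_def)
    have mean: "expectation (mean_nn_power a k) = (\<integral>y. E k y \<partial>cube_law)"
      unfolding V[abs_def] E_def using B
      by (intro Fubini_bounded[where B=B] prob) auto
    have "expectation (\<lambda>\<omega>. (mean_nn_power a k \<omega>)\<^sup>2)
        = expectation (\<lambda>\<omega>. \<integral>y. (\<integral>z. h k y \<omega> * h k z \<omega> \<partial>cube_law) \<partial>cube_law)"
      by (simp add: V power2_eq_square)
    also have "\<dots> = (\<integral>y. expectation (\<lambda>\<omega>. \<integral>z. h k y \<omega> * h k z \<omega> \<partial>cube_law) \<partial>cube_law)"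
      by (intro Fubini_bounded[where B="B * B"] prob bnd hh) measurable
    also have "\<dots> = (\<integral>y. \<integral>z. expectation (\<lambda>\<omega>. h k y \<omega> * h k z \<omega>) \<partial>cube_law \<partial>cube_law)"
      by (intro Bochner_Integration.integral_cong refl Fubini_bounded[where B="B * B"] prob bnd hh) measurable
    also have "\<dots> \<le> (\<integral>y. \<integral>z. E k y * E k z + R y z + R z y \<partial>cube_law \<partial>cube_law)"
    proof (intro integral_mono)
      show "expectation (\<lambda>\<omega>. h k y \<omega> * h k z \<omega>) \<le> E k y * E k z + R y z + R z y" for y z
        using nn_product_expectation_le[OF a, of k y z] by (simp add: h_def[abs_def] E_def R_def)
      show "integrable cube_law (\<lambda>z. expectation (\<lambda>\<omega>. h k y \<omega> * h k z \<omega>))" for y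
        by (rule cint[OF _ bnd[OF prob(1) hh]]) measurable
      show "integrable cube_law (\<lambda>y. \<integral>z. expectation (\<lambda>\<omega>. h k y \<omega> * h k z \<omega>) \<partial>cube_law)"
        by (rule cint[OF _ bnd[OF prob(2) bnd[OF prob(1) hh]]]) measurable
      show "integrable cube_law (\<lambda>z. E k y * E k z + R y z + R z y)" for y
        by (rule cint[OF _ tri]) measurable
      show "integrable cube_law (\<lambda>y. \<integral>z. E k y * E k z + R y z + R z y \<partial>cube_law)"
        by (rule cint[OF _ bnd[OF prob(2) tri]]) measurable
    qed
    also have "\<dots> = (\<integral>y. E k y * (\<integral>z. E k z \<partial>cube_law) + (\<integral>z. R y z \<partial>cube_law) + (\<integral>z. R z y \<partial>cube_law) \<partial>cube_law)"
      by (simp add: cint[OF _ RB] cint[OF _ E'] integrable_mult_right)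
    also have "\<dots> = (\<integral>y. E k y \<partial>cube_law) * (\<integral>z. E k z \<partial>cube_law) + (\<integral>y. \<integral>z. R y z \<partial>cube_law \<partial>cube_law) + (\<integral>y. \<integral>z. R z y \<partial>cube_law \<partial>cube_law)"
      by (simp add: cint[OF _ bnd[OF cube.prob_space_axioms RB]] cint[OF _ E'])
    also have "(\<integral>y. \<integral>z. R z y \<partial>cube_law \<partial>cube_law) = (\<integral>y. \<integral>z. R y z \<partial>cube_law \<partial>cube_law)"
      by (rule Fubini_bounded[OF prob(2) prob(2) _ RB]) measurable
    finally have "expectation (\<lambda>\<omega>. (mean_nn_power a k \<omega>)\<^sup>2) - (expectation (mean_nn_power a k))\<^sup>2 \<le> 2 * (\<integral>y. \<integral>z. R y z \<partial>cube_law \<partial>cube_law)"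
      by (simp add: mean power2_eq_square)
    also have "(\<integral>y. \<integral>z. R y z \<partial>cube_law \<partial>cube_law) \<le> (\<integral>y. 4 ^ CARD('d) * expectation (\<lambda>\<omega>. nn k \<omega> y powr (2 * a + ?d)) \<partial>cube_law)"
    proof (intro integral_mono)
      fix y
      have "(\<integral>z. R y z \<partial>cube_law) = expectation (\<lambda>\<omega>. \<integral>z. g \<omega> y z \<partial>cube_law)"
        unfolding R_def far_nn_moment_def g_def[symmetric]
        by (rule Fubini_bounded[OF prob(2) prob(1) _ gB]) (simp add: g_def)
      also have "\<dots> \<le> expectation (\<lambda>\<omega>. 4 ^ CARD('d) * nn k \<omega> y powr (2 * a + ?d))"
      proof (rule integral_mono)
        fix \<omega>
        have "(\<integral>z. g \<omega> y z \<partial>cube_law) = (\<integral>z. nn k \<omega> y powr (2 * a) * indicator (cball y (2 * nn k \<omega> y)) z \<partial>cube_law)"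
          by (intro Bochner_Integration.integral_cong) (auto simp: g_def indicator_def)
        also have "\<dots> = nn k \<omega> y powr (2 * a) * measure cube_law (cball y (2 * nn k \<omega> y))"
          by simp
        also have "\<dots> \<le> nn k \<omega> y powr (2 * a) * (2 * (2 * nn k \<omega> y)) ^ CARD('d)"
          by (intro mult_left_mono cube_law_cball_le) (simp_all add: nn_bounds)
        also have "\<dots> = 4 ^ CARD('d) * nn k \<omega> y powr (2 * a + ?d)"
        proof (cases "nn k \<omega> y = 0")
          case False
          then have "nn k \<omega> y > 0" using nn_bounds(1)[of k \<omega> y] by simp
          then show ?thesis by (simp add: powr_add powr_realpow power_mult_distrib power_mult[symmetric])
        qed (use a in simp)
        finally show "(\<integral>z. g \<omega> y z \<partial>cube_law) \<le> 4 ^ CARD('d) * nn k \<omega> y powr (2 * a + ?d)" .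
      next
        show "integrable M (\<lambda>\<omega>. \<integral>z. g \<omega> y z \<partial>cube_law)"
          by (rule integrable_bounded[OF _ bnd[OF prob(2) gB]]) (simp add: g_def)
        show "integrable M (\<lambda>\<omega>. 4 ^ CARD('d) * nn k \<omega> y powr (2 * a + ?d))"
          using a by (intro integrable_mult_right integrable_bounded[OF _ nnB]) auto
      qed
      finally show "(\<integral>z. R y z \<partial>cube_law) \<le> 4 ^ CARD('d) * expectation (\<lambda>\<omega>. nn k \<omega> y powr (2 * a + ?d))"
        by simp
    next
      show "integrable cube_law (\<lambda>y. \<integral>z. R y z \<partial>cube_law)"
        by (rule cint[OF _ bnd[OF prob(2) RB]]) measurable
      show "integrable cube_law (\<lambda>y. 4 ^ CARD('d) * expectation (\<lambda>\<omega>. nn k \<omega> y powr (2 * a + ?d)))"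
        using a by (intro integrable_mult_right cint[OF _ bnd[OF prob(1) nnB]]) auto
    qed
    also have "\<dots> = 4 ^ CARD('d) * expectation (mean_nn_power (2 * a + ?d) k)"
      unfolding mean_nn_power_def using a
      by (subst Fubini_bounded[OF prob(1) prob(2) _ nnB]) auto
    also have "\<dots> \<le> 4 ^ CARD('d) * (C * (real k + 1) powr (- ((2 * a + ?d) / ?d)))"
      by (intro mult_left_mono C) simp
    also have "- ((2 * a + ?d) / ?d) = - (1 + 2 * a / ?d)"
      by (simp add: field_simps)
    finally have "expectation (\<lambda>\<omega>. (mean_nn_power a k \<omega>)\<^sup>2) - (expectation (mean_nn_power a k))\<^sup>2
        \<le> 2 * 4 ^ CARD('d) * C * (real k + 1) powr (- (1 + 2 * a / ?d))"
      by simp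
    moreover have "variance (mean_nn_power a k) = expectation (\<lambda>\<omega>. (mean_nn_power a k \<omega>)\<^sup>2) - (expectation (mean_nn_power a k))\<^sup>2"
    proof (rule variance_eq)
      have "\<bar>mean_nn_power a k \<omega>\<bar> \<le> B" for \<omega>
        using mean_nn_power_bounds[of a k \<omega>] a by (simp add: B_def)
      then show "integrable M (mean_nn_power a k)" "integrable M (\<lambda>\<omega>. (mean_nn_power a k \<omega>)\<^sup>2)"
        using square_integrable_bounded[OF finite_measure_axioms measurable_mean_nn_power[of a k], of B]
        integrable_bounded[OF measurable_mean_nn_power[of a k], of B]
        by (auto simp: square_integrable_def)
    qed
    ultimately show ?thesis by simp
  qed
  then show ?thesis using C(1) by (intro that[of "2 * 4 ^ CARD('d) * C"]) auto
qed

section \<open>Mean-square limit of the centred sums of edge weights\<close>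

definition sample :: "nat \<Rightarrow> 'w \<Rightarrow> nat \<Rightarrow> real ^ 'd"
  where "sample k \<omega> = (\<lambda>i\<in>{1..k}. U i \<omega>)"

abbreviation sample_space :: "nat \<Rightarrow> (nat \<Rightarrow> real ^ 'd) measure"
  where "sample_space k \<equiv> PiM {1..k} (\<lambda>_. borel)"

lemma measurable_sample[measurable]: "sample k \<in> measurable M (sample_space k)"
  unfolding sample_def[abs_def] using U_measurable by (intro measurable_restrict) auto

text \<open>
\<open>indep_var\<close> relates variables with values of the same type; so the next point is first taken as a
family with a single index, and then read off from it.
\<close>

lemma distr_sample_next:
  "distr M (sample_space k \<Otimes>\<^sub>M borel) (\<lambda>\<omega>. (sample k \<omega>, U (Suc k) \<omega>)) = distr M (sample_space k) (sample k) \<Otimes>\<^sub>M cube_law"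
proof -
  let ?Y = "\<lambda>\<omega>. \<lambda>i\<in>{Suc k}. U i \<omega>"
  let ?T = "PiM {Suc k} (\<lambda>_. borel) :: (nat \<Rightarrow> real ^ 'd) measure"
  have U[measurable]: "U (Suc k) \<in> borel_measurable M" by (rule U_measurable) simp
  have Y[measurable]: "?Y \<in> measurable M ?T" by (intro measurable_restrict) auto
  interpret DY: prob_space "distr M ?T ?Y" by (rule prob_space_distr) simp
  interpret DX: prob_space "distr M (sample_space k) (sample k)" by (rule prob_space_distr) (rule measurable_sample)
  have ev[measurable]: "(\<lambda>x. x (Suc k)) \<in> measurable ?T borel" by simp
  have evD: "distr (distr M ?T ?Y) borel (\<lambda>x. x (Suc k)) = cube_law"
    by (subst distr_distr) (auto simp: comp_def law)
  have "indep_var (sample_space k) (sample k) ?T ?Y"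
    unfolding sample_def[abs_def] by (rule indep_var_restrict[OF indep]) auto
  then have joint: "distr M (sample_space k) (sample k) \<Otimes>\<^sub>M distr M ?T ?Y = distr M (sample_space k \<Otimes>\<^sub>M ?T) (\<lambda>\<omega>. (sample k \<omega>, ?Y \<omega>))"
    by (simp only: indep_var_distribution_eq)
  have "distr M (sample_space k) (sample k) \<Otimes>\<^sub>M cube_law
      = distr (distr M (sample_space k) (sample k)) (sample_space k) (\<lambda>x. x) \<Otimes>\<^sub>M distr (distr M ?T ?Y) borel (\<lambda>x. x (Suc k))"
    by (subst evD) (simp add: distr_id2)
  also have "\<dots> = distr (distr M (sample_space k) (sample k) \<Otimes>\<^sub>M distr M ?T ?Y) (sample_space k \<Otimes>\<^sub>M borel) (\<lambda>(x, y). (x, y (Suc k)))"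
    by (rule pair_measure_distr) (auto simp: evD intro: cube.sigma_finite_measure)
  also have "\<dots> = distr M (sample_space k \<Otimes>\<^sub>M borel) (\<lambda>\<omega>. (sample k \<omega>, U (Suc k) \<omega>))"
    unfolding joint by (subst distr_distr, measurable) (simp add: comp_def)
  finally show ?thesis by simp
qed

lemma expectation_sample_next:
  fixes f :: "(nat \<Rightarrow> real ^ 'd) \<Rightarrow> real ^ 'd \<Rightarrow> real"
  assumes f[measurable]: "(\<lambda>p. f (fst p) (snd p)) \<in> borel_measurable (sample_space k \<Otimes>\<^sub>M borel)"
    and B: "\<And>x y. \<bar>f x y\<bar> \<le> B"
  shows "expectation (\<lambda>\<omega>. f (sample k \<omega>) (U (Suc k) \<omega>))
    = expectation (\<lambda>\<omega>. \<integral>y. f (sample k \<omega>) y \<partial>cube_law)"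
proof -
  let ?S = "sample_space k" and ?X = "sample k"
  have [measurable]: "U (Suc k) \<in> borel_measurable M" by (rule U_measurable) simp
  interpret D: prob_space "distr M ?S ?X" by (rule prob_space_distr) (rule measurable_sample)
  interpret P: pair_prob_space "distr M ?S ?X" "cube_law :: (real ^ 'd) measure" ..
  have "expectation (\<lambda>\<omega>. f (?X \<omega>) (U (Suc k) \<omega>)) = (\<integral>p. f (fst p) (snd p) \<partial>distr M (?S \<Otimes>\<^sub>M borel) (\<lambda>\<omega>. (?X \<omega>, U (Suc k) \<omega>)))"
    by (subst integral_distr, measurable)
  also have "\<dots> = (\<integral>p. f (fst p) (snd p) \<partial>(distr M ?S ?X \<Otimes>\<^sub>M cube_law))"
    by (simp only: distr_sample_next)
  also have "\<dots> = (\<integral>x. (\<integral>y. f x y \<partial>cube_law) \<partial>distr M ?S ?X)"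
  proof -
    have "integrable (distr M ?S ?X \<Otimes>\<^sub>M cube_law) (\<lambda>p. f (fst p) (snd p))"
      by (rule P.P.integrable_const_bound[where B=B]) (use B in simp, measurable)
    from P.integral_fst'[OF this] show ?thesis by simp
  qed
  also have "\<dots> = expectation (\<lambda>\<omega>. \<integral>y. f (?X \<omega>) y \<partial>cube_law)"
    by (subst integral_distr, measurable)
  finally show ?thesis .
qed

text \<open>
The weight of the edge from the point with number \<open>k + 1\<close> to its nearest neighbour. For \<open>k = 0\<close> there
is no edge, and the cap makes the value a constant, which centring removes.
\<close>

definition edge :: "real \<Rightarrow> nat \<Rightarrow> 'w \<Rightarrow> real"
  where "edge a k \<omega> = nn k \<omega> (U (Suc k) \<omega>) powr a"

lemma measurable_U_Suc[measurable]: "U (Suc k) \<in> borel_measurable M"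
  by (rule U_measurable) simp

lemma measurable_edge[measurable]: "edge a k \<in> borel_measurable M"
  unfolding edge_def[abs_def] by measurable

lemma edge_bounds: "0 \<le> edge a k \<omega>" "a \<ge> 0 \<Longrightarrow> edge a k \<omega> \<le> real CARD('d) powr a"
  by (simp_all add: edge_def nn_powr_le)

lemma integrable_edge: "a \<ge> 0 \<Longrightarrow> integrable M (edge a k)"
  using edge_bounds by (intro integrable_bounded[where B="real CARD('d) powr a"]) auto

lemma edge_square: "(edge a k \<omega>)\<^sup>2 = edge (2 * a) k \<omega>"
  by (simp add: edge_def power2_eq_square powr_add[symmetric])

lemma nn_eq_capped_dist_sample: "k \<le> l \<Longrightarrow> nn k \<omega> y = capped_dist (sample l \<omega>) k y"
  unfolding nn_def by (rule capped_dist_cong) (auto simp: sample_def)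

lemma measurable_capped_dist_sample_space:
  assumes "k \<le> l"
  shows "(\<lambda>p. capped_dist (fst p) k (snd p)) \<in> borel_measurable (sample_space l \<Otimes>\<^sub>M borel)"
  using assms by (intro measurable_capped_dist) (auto intro!: measurable_compose[OF measurable_fst] measurable_component_singleton)

text \<open>
\<open>mean_nn_power\<close> as a function on sequences of points, to express that it is determined by
the sample.
\<close>

definition mean_capped_dist_power :: "real \<Rightarrow> nat \<Rightarrow> (nat \<Rightarrow> real ^ 'd) \<Rightarrow> real"
  where "mean_capped_dist_power a k x = (\<integral>y. capped_dist x k y powr a \<partial>cube_law)"

lemma mean_nn_power_eq_mean_capped_dist_power: "k \<le> l \<Longrightarrow> mean_nn_power a k \<omega> = mean_capped_dist_power a k (sample l \<omega>)"
  by (simp add: mean_nn_power_def mean_capped_dist_power_def nn_eq_capped_dist_sample)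

lemma measurable_mean_capped_dist_power:
  assumes "k \<le> l"
  shows "mean_capped_dist_power a k \<in> borel_measurable (sample_space l)"
proof -
  note [measurable] = measurable_capped_dist_sample_space[OF assms]
  have "(\<lambda>p. capped_dist (fst p) k (snd p) powr a) \<in> borel_measurable (sample_space l \<Otimes>\<^sub>M cube_law)"
    by measurable
  then have "(\<lambda>x. \<integral>y. capped_dist x k y powr a \<partial>cube_law) \<in> borel_measurable (sample_space l)"
    by (intro cube.borel_measurable_lebesgue_integral) (simp add: case_prod_unfold)
  then show ?thesis by (simp add: mean_capped_dist_power_def[abs_def])
qed

lemma mean_capped_dist_power_bound:
  assumes "a \<ge> 0"
  shows "\<bar>mean_capped_dist_power a k x\<bar> \<le> real CARD('d) powr a"
proof -
  have b: "\<bar>capped_dist x k y powr a\<bar> \<le> real CARD('d) powr a" for y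
    using assms capped_dist_bounds[of x k y] by (auto intro: powr_mono2)
  have "integrable cube_law (\<lambda>y. capped_dist x k y powr a)"
    by (rule cube.integrable_const_bound[where B="real CARD('d) powr a"]) (rule AE_I2, simp only: real_norm_def b, measurable)
  then have "mean_capped_dist_power a k x \<le> real CARD('d) powr a" "0 \<le> mean_capped_dist_power a k x"
    unfolding mean_capped_dist_power_def using b by (auto intro!: cube.integral_le_const integral_nonneg)
  then show ?thesis by simp
qed

text \<open>
Integrating over the new point first, the factor \<open>G\<close> of the previous points is a constant and the
edge weight becomes its average.
\<close>

lemma edge_minus_mean_nn_power_orthogonal:
  fixes G :: "(nat \<Rightarrow> real ^ 'd) \<Rightarrow> real"
  assumes a: "a \<ge> 0" and G[measurable]: "G \<in> borel_measurable (sample_space k)" and B: "\<And>x. \<bar>G x\<bar> \<le> B"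
  shows "expectation (\<lambda>\<omega>. G (sample k \<omega>) * (edge a k \<omega> - mean_nn_power a k \<omega>)) = 0"
proof -
  let ?K = "real CARD('d) powr a"
  note [measurable] = measurable_capped_dist_sample_space[OF order_refl, of k] measurable_mean_capped_dist_power[OF order_refl, of a k]
  define f where "f x y = G x * (capped_dist x k y powr a - mean_capped_dist_power a k x)" for x y
  have c: "\<bar>capped_dist x k y powr a\<bar> \<le> ?K" for x and y :: "real ^ 'd"
    using a capped_dist_bounds[of x k y] by (auto intro: powr_mono2)
  have "expectation (\<lambda>\<omega>. G (sample k \<omega>) * (edge a k \<omega> - mean_nn_power a k \<omega>))
      = expectation (\<lambda>\<omega>. f (sample k \<omega>) (U (Suc k) \<omega>))"
    by (simp add: f_def edge_def nn_eq_capped_dist_sample[of k k] mean_nn_power_eq_mean_capped_dist_power[of k k])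
  also have "\<dots> = expectation (\<lambda>\<omega>. \<integral>y. f (sample k \<omega>) y \<partial>cube_law)"
  proof (rule expectation_sample_next)
    show "(\<lambda>p. f (fst p) (snd p)) \<in> borel_measurable (sample_space k \<Otimes>\<^sub>M borel)"
      unfolding f_def by measurable
    show "\<bar>f x y\<bar> \<le> B * (?K + ?K)" for x y
    proof -
      have "\<bar>capped_dist x k y powr a - mean_capped_dist_power a k x\<bar> \<le> ?K + ?K"
        using c[of x y] mean_capped_dist_power_bound[OF a, of k x] by linarith
      then show ?thesis unfolding f_def abs_mult
        using B[of x] by (intro mult_mono) auto
    qed
  qed
  also have "(\<lambda>\<omega>. \<integral>y. f (sample k \<omega>) y \<partial>cube_law) = (\<lambda>\<omega>. 0)"
  proof
    fix \<omega>
    have "integrable cube_law (\<lambda>y. capped_dist (sample k \<omega>) k y powr a)"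
      by (rule cube.integrable_const_bound[where B="?K"]) (rule AE_I2, simp only: real_norm_def c, measurable)
    then show "(\<integral>y. f (sample k \<omega>) y \<partial>cube_law) = 0"
      using cube.prob_space by (simp add: f_def mean_capped_dist_power_def)
  qed
  finally show ?thesis by simp
qed

lemma expectation_edge: 
  assumes "a \<ge> 0" shows "expectation (edge a k) = expectation (mean_nn_power a k)"
proof -
  have "expectation (\<lambda>\<omega>. edge a k \<omega> - mean_nn_power a k \<omega>) = 0"
    using edge_minus_mean_nn_power_orthogonal[OF assms, where k=k and G="\<lambda>_. 1" and B=1] by simp
  moreover have "integrable M (mean_nn_power a k)"
    using mean_nn_power_bounds[OF assms] by (intro integrable_bounded[where B="real CARD('d) powr a"]) auto
  ultimately show ?thesis using integrable_edge[OF assms] by simp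
qed

lemma expectation_edge_le:
  assumes p: "p > 0"
  obtains C where "C > 0" "\<And>k. expectation (edge p k) \<le> C * (real k + 1) powr (- (p / real CARD('d)))"
  using expectation_mean_nn_power_le[OF p] assms by (auto simp: expectation_edge)

lemma summable_expectation_edge:
  assumes p: "p > real CARD('d)"
  shows "summable (\<lambda>k. expectation (edge p k))"
proof -
  have "p > 0" using p by (rule le_less_trans[rotated]) simp
  then obtain C where C: "C > 0" "\<And>k. expectation (edge p k) \<le> C * (real k + 1) powr (- (p / real CARD('d)))"
    using expectation_edge_le by blast
  show ?thesis
  proof (rule summable_comparison_test')
    show "summable (\<lambda>k. C * (real k + 1) powr (- (p / real CARD('d))))"
      using p by (intro summable_mult summable_Suc_powr) simp
    show "norm (expectation (edge p k)) \<le> C * (real k + 1) powr (- (p / real CARD('d)))" for k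
      using C(2)[of k] edge_bounds(1) by (simp add: integral_nonneg)
  qed
qed

text \<open>
The martingale increments of the sum of the edge weights.
\<close>

abbreviation innovation :: "real \<Rightarrow> nat \<Rightarrow> 'w \<Rightarrow> real"
  where "innovation a k \<omega> \<equiv> edge a k \<omega> - mean_nn_power a k \<omega>"

lemma innovation_bound: "a \<ge> 0 \<Longrightarrow> \<bar>innovation a k \<omega>\<bar> \<le> real CARD('d) powr a"
  using edge_bounds[of a k \<omega>] mean_nn_power_bounds[of a k \<omega>] by auto

lemma innovations_orthogonal:
  assumes a: "a \<ge> 0" and kl: "k < l"
  shows "expectation (\<lambda>\<omega>. innovation a k \<omega> * innovation a l \<omega>) = 0"
proof -
  let ?K = "real CARD('d) powr a"
  define G where "G x = capped_dist x k (x (Suc k)) powr a - mean_capped_dist_power a k x" for x :: "nat \<Rightarrow> real ^ 'd"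
  have le: "Suc k \<le> l" "k \<le> l" using kl by simp_all
  have [measurable]: "(\<lambda>x. x (Suc k)) \<in> measurable (sample_space l) borel"
    using le by (intro measurable_component_singleton) auto
  note [measurable] = measurable_capped_dist_sample_space[OF le(2)] measurable_mean_capped_dist_power[OF le(2), of a]
  have [measurable]: "(\<lambda>x. capped_dist x k (x (Suc k))) \<in> borel_measurable (sample_space l)"
    using le by (intro measurable_capped_dist measurable_component_singleton) auto
  have [measurable]: "G \<in> borel_measurable (sample_space l)"
    unfolding G_def[abs_def] by measurable
  have "\<bar>G x\<bar> \<le> ?K + ?K" for x
  proof -
    have "\<bar>capped_dist x k (x (Suc k)) powr a\<bar> \<le> ?K"
      using a capped_dist_bounds[of x k "x (Suc k)"] by (auto intro: powr_mono2)
    then show ?thesis using mean_capped_dist_power_bound[OF a, of k x] unfolding G_def by linarith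
  qed
  moreover have "innovation a k \<omega> = G (sample l \<omega>)" for \<omega>
    using le by (simp add: G_def edge_def nn_eq_capped_dist_sample[OF le(2)] mean_nn_power_eq_mean_capped_dist_power[OF le(2)])
      (simp add: sample_def)
  ultimately show ?thesis
    using edge_minus_mean_nn_power_orthogonal[OF a \<open>G \<in> borel_measurable (sample_space l)\<close>, of "?K + ?K"] by simp
qed

text \<open>
The edge weight is the orthogonal sum of the innovation and of its average over the new point, so its
second moment dominates that of the innovation.
\<close>

lemma innovation_second_moment_le:
  assumes a: "a \<ge> 0"
  shows "expectation (\<lambda>\<omega>. (innovation a k \<omega>)\<^sup>2) \<le> expectation (edge (2 * a) k)"
proof -
  let ?K = "real CARD('d) powr a"
  have "expectation (\<lambda>\<omega>. mean_nn_power a k \<omega> * innovation a k \<omega>) = 0"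
    using edge_minus_mean_nn_power_orthogonal[OF a measurable_mean_capped_dist_power[OF order_refl] mean_capped_dist_power_bound[OF a], of k]
    by (simp add: mean_nn_power_eq_mean_capped_dist_power[of k k])
  moreover have int: "integrable M (\<lambda>\<omega>. mean_nn_power a k \<omega> * innovation a k \<omega>)"
    using mean_nn_power_bounds[OF a, of k] innovation_bound[OF a, of k]
    by (intro integrable_bounded[where B="?K * ?K"]) (auto simp: abs_mult intro!: mult_mono)
  moreover have "square_integrable M (innovation a k)"
    using innovation_bound[OF a] by (intro square_integrable_bounded finite_measure_axioms) auto
  then have "integrable M (\<lambda>\<omega>. (innovation a k \<omega>)\<^sup>2)"
    by (simp add: square_integrable_def)
  moreover have "expectation (\<lambda>\<omega>. (innovation a k \<omega>)\<^sup>2) \<le> expectation (\<lambda>\<omega>. edge (2 * a) k \<omega> - 2 * (mean_nn_power a k \<omega> * innovation a k \<omega>))"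
  proof (rule integral_mono)
    fix \<omega>
    have "edge (2 * a) k \<omega> - 2 * (mean_nn_power a k \<omega> * innovation a k \<omega>) = (innovation a k \<omega>)\<^sup>2 + (mean_nn_power a k \<omega>)\<^sup>2"
      unfolding edge_square[symmetric] by (simp add: power2_eq_square algebra_simps)
    then show "(innovation a k \<omega>)\<^sup>2 \<le> edge (2 * a) k \<omega> - 2 * (mean_nn_power a k \<omega> * innovation a k \<omega>)" by simp
  qed (use a int integrable_edge[of "2 * a" k] calculation in auto)
  ultimately show ?thesis
    using integrable_edge[of "2 * a" k] a by simp
qed

lemma innovation_sum_second_moment_le:
  assumes a: "a \<ge> 0" and "finite I"
  shows "expectation (\<lambda>\<omega>. (\<Sum>k\<in>I. innovation a k \<omega>)\<^sup>2) \<le> (\<Sum>k\<in>I. expectation (edge (2 * a) k))"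
proof -
  let ?K = "real CARD('d) powr a"
  have int: "integrable M (\<lambda>\<omega>. innovation a k \<omega> * innovation a l \<omega>)" for k l
    using innovation_bound[OF a, of k] innovation_bound[OF a, of l]
    by (intro integrable_bounded[where B="?K * ?K"]) (auto simp: abs_mult intro!: mult_mono)
  have orth: "expectation (\<lambda>\<omega>. innovation a k \<omega> * innovation a l \<omega>) = 0" if "k \<noteq> l" for k l
    using innovations_orthogonal[OF a, of k l] innovations_orthogonal[OF a, of l k] that
    by (cases "k < l") (auto simp: mult.commute)
  have "expectation (\<lambda>\<omega>. (\<Sum>k\<in>I. innovation a k \<omega>)\<^sup>2)
      = (\<Sum>k\<in>I. \<Sum>l\<in>I. expectation (\<lambda>\<omega>. innovation a k \<omega> * innovation a l \<omega>))"
    unfolding power2_eq_square sum_product using int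
    by (subst Bochner_Integration.integral_sum; intro Bochner_Integration.integrable_sum sum.cong refl Bochner_Integration.integral_sum | simp)+
  also have "\<dots> = (\<Sum>k\<in>I. expectation (\<lambda>\<omega>. (innovation a k \<omega>)\<^sup>2))"
  proof (rule sum.cong[OF refl])
    fix k assume "k \<in> I"
    have "(\<Sum>l\<in>I. expectation (\<lambda>\<omega>. innovation a k \<omega> * innovation a l \<omega>))
        = (\<Sum>l\<in>I. if l = k then expectation (\<lambda>\<omega>. (innovation a k \<omega>)\<^sup>2) else 0)"
      by (intro sum.cong refl) (auto simp: orth power2_eq_square)
    then show "(\<Sum>l\<in>I. expectation (\<lambda>\<omega>. innovation a k \<omega> * innovation a l \<omega>)) = expectation (\<lambda>\<omega>. (innovation a k \<omega>)\<^sup>2)"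
      using \<open>k \<in> I\<close> \<open>finite I\<close> by simp
  qed
  also have "\<dots> \<le> (\<Sum>k\<in>I. expectation (edge (2 * a) k))"
    by (intro sum_mono innovation_second_moment_le a)
  finally show ?thesis .
qed

definition centred_sum :: "real \<Rightarrow> nat \<Rightarrow> 'w \<Rightarrow> real"
  where "centred_sum a n \<omega> = (\<Sum>k<n. edge a k \<omega> - expectation (edge a k))"

lemma measurable_centred_sum[measurable]: "centred_sum a n \<in> borel_measurable M"
  unfolding centred_sum_def[abs_def] by measurable

lemma square_integrable_edge: "a \<ge> 0 \<Longrightarrow> square_integrable M (edge a k)"
  using edge_bounds by (intro square_integrable_bounded finite_measure_axioms measurable_edge) auto

lemma square_integrable_mean_nn_power: "a \<ge> 0 \<Longrightarrow> square_integrable M (mean_nn_power a k)"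
  using mean_nn_power_bounds by (intro square_integrable_bounded finite_measure_axioms measurable_mean_nn_power) auto

lemma square_integrable_centred_sum: "a \<ge> 0 \<Longrightarrow> square_integrable M (centred_sum a n)"
  unfolding centred_sum_def[abs_def]
  by (intro square_integrable_sum square_integrable_diff square_integrable_const square_integrable_edge)

lemma expectation_centred_sum: "a \<ge> 0 \<Longrightarrow> expectation (centred_sum a n) = 0"
  unfolding centred_sum_def[abs_def] using integrable_edge by (simp add: Bochner_Integration.integral_sum prob_space)

text \<open>
The increment is split into the martingale part, for which second moments add up, and the averaged
part, for which standard deviations add up.
\<close>

lemma centred_sum_increment_second_moment_le:
  assumes a: "a > 0"
  obtains C where "\<And>m n. m \<le> n \<Longrightarrow> expectation (\<lambda>\<omega>. (centred_sum a n \<omega> - centred_sum a m \<omega>)\<^sup>2)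
    \<le> 2 * (\<Sum>k=m..<n. expectation (edge (2 * a) k)) + 2 * (\<Sum>k=m..<n. C * (real k + 1) powr (- (1 / 2 + a / real CARD('d))))\<^sup>2"
proof -
  obtain C where C: "C > 0" "\<And>k. expectation (\<lambda>\<omega>. (mean_nn_power a k \<omega> - expectation (mean_nn_power a k))\<^sup>2)
    \<le> C * (real k + 1) powr (- (1 + 2 * a / real CARD('d)))"
    using mean_nn_power_variance_le[OF a] by blast
  show ?thesis
  proof (rule that)
    fix m n :: nat assume mn: "m \<le> n"
    define s where "s k = sqrt C * (real k + 1) powr (- (1 / 2 + a / real CARD('d)))" for k :: nat
    define A where "A \<omega> = (\<Sum>k=m..<n. innovation a k \<omega>)" for \<omega>
    define B where "B \<omega> = (\<Sum>k=m..<n. mean_nn_power a k \<omega> - expectation (mean_nn_power a k))" for \<omega>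
    have s: "s k > 0" for k using C(1) by (simp add: s_def)
    have s2: "(s k)\<^sup>2 = C * (real k + 1) powr (- (1 + 2 * a / real CARD('d)))" for k
    proof -
      have "(s k)\<^sup>2 = (sqrt C)\<^sup>2 * ((real k + 1) powr (- (1 / 2 + a / real CARD('d))))\<^sup>2"
        by (simp add: s_def power_mult_distrib)
      also have "((real k + 1) powr (- (1 / 2 + a / real CARD('d))))\<^sup>2 = (real k + 1) powr (- (1 + 2 * a / real CARD('d)))"
        unfolding power2_eq_square powr_add[symmetric] by (rule arg_cong) simp
      finally show ?thesis using C(1) by simp
    qed
    have decomp: "centred_sum a n \<omega> - centred_sum a m \<omega> = A \<omega> + B \<omega>" for \<omega>
    proof -
      have "centred_sum a n \<omega> - centred_sum a m \<omega> = (\<Sum>k=m..<n. edge a k \<omega> - expectation (edge a k))"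
        unfolding centred_sum_def using mn by (simp add: lessThan_atLeast0 sum_diff_nat_ivl)
      also have "\<dots> = A \<omega> + B \<omega>"
        using a by (simp add: A_def B_def sum.distrib[symmetric] expectation_edge)
      finally show ?thesis .
    qed
    have A: "square_integrable M A" unfolding A_def using a
      by (intro square_integrable_sum square_integrable_diff square_integrable_edge square_integrable_mean_nn_power) auto
    have B': "square_integrable M (\<lambda>\<omega>. mean_nn_power a k \<omega> - expectation (mean_nn_power a k))" for k
      using a by (intro square_integrable_diff square_integrable_const square_integrable_mean_nn_power) auto
    have B: "square_integrable M B" unfolding B_def
      by (intro square_integrable_sum B')
    have "expectation (\<lambda>\<omega>. (centred_sum a n \<omega> - centred_sum a m \<omega>)\<^sup>2) \<le> expectation (\<lambda>\<omega>. 2 * (A \<omega>)\<^sup>2 + 2 * (B \<omega>)\<^sup>2)"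
      unfolding decomp using A B square_integrable_add[OF A B] square_sum_le
      by (intro integral_mono) (auto simp: square_integrable_def)
    also have "\<dots> = 2 * expectation (\<lambda>\<omega>. (A \<omega>)\<^sup>2) + 2 * expectation (\<lambda>\<omega>. (B \<omega>)\<^sup>2)"
      using A B by (simp add: square_integrable_def)
    also have "\<dots> \<le> 2 * (\<Sum>k=m..<n. expectation (edge (2 * a) k)) + 2 * (\<Sum>k=m..<n. s k)\<^sup>2"
    proof (intro add_mono mult_left_mono)
      show "expectation (\<lambda>\<omega>. (A \<omega>)\<^sup>2) \<le> (\<Sum>k=m..<n. expectation (edge (2 * a) k))"
        unfolding A_def using a by (intro innovation_sum_second_moment_le) auto
      show "expectation (\<lambda>\<omega>. (B \<omega>)\<^sup>2) \<le> (\<Sum>k=m..<n. s k)\<^sup>2"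
        unfolding B_def using C(2) by (intro second_moment_sum_le B' s) (auto simp: s2)
    qed auto
    finally show "expectation (\<lambda>\<omega>. (centred_sum a n \<omega> - centred_sum a m \<omega>)\<^sup>2)
      \<le> 2 * (\<Sum>k=m..<n. expectation (edge (2 * a) k)) + 2 * (\<Sum>k=m..<n. sqrt C * (real k + 1) powr (- (1 / 2 + a / real CARD('d))))\<^sup>2"
      by (simp add: s_def)
  qed
qed

lemma centred_sum_L2_limit:
  assumes a: "a > real CARD('d) / 2"
  obtains Q where "square_integrable M Q" "tendsto_L2 M (centred_sum a) Q"
proof (rule L2_complete)
  have a0: "a > 0" using a by (rule le_less_trans[rotated]) simp
  show "square_integrable M (centred_sum a n)" for n
    using a0 by (intro square_integrable_centred_sum) simp
  obtain C where C: "\<And>m n. m \<le> n \<Longrightarrow> expectation (\<lambda>\<omega>. (centred_sum a n \<omega> - centred_sum a m \<omega>)\<^sup>2)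
    \<le> 2 * (\<Sum>k=m..<n. expectation (edge (2 * a) k)) + 2 * (\<Sum>k=m..<n. C * (real k + 1) powr (- (1 / 2 + a / real CARD('d))))\<^sup>2"
    using centred_sum_increment_second_moment_le[OF a0] by blast
  fix e :: real assume e: "e > 0"
  have "summable (\<lambda>k. expectation (edge (2 * a) k))"
    using a by (intro summable_expectation_edge) simp
  then obtain K1 where K1: "\<And>m n. m \<ge> K1 \<Longrightarrow> norm (\<Sum>k=m..<n. expectation (edge (2 * a) k)) < e / 4"
    using e unfolding summable_Cauchy by (meson divide_pos_pos zero_less_numeral)
  have "summable (\<lambda>k. C * (real k + 1) powr (- (1 / 2 + a / real CARD('d))))"
    using a by (intro summable_mult summable_Suc_powr) (simp add: field_simps)
  moreover have "sqrt e / 2 > 0" using e by simp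
  ultimately obtain K2 where K2: "\<And>m n. m \<ge> K2 \<Longrightarrow> norm (\<Sum>k=m..<n. C * (real k + 1) powr (- (1 / 2 + a / real CARD('d)))) < sqrt e / 2"
    unfolding summable_Cauchy by meson
  have main: "expectation (\<lambda>\<omega>. (centred_sum a n \<omega> - centred_sum a m \<omega>)\<^sup>2) \<le> e" if "max K1 K2 \<le> m" "m \<le> n" for m n
  proof -
    have "(\<Sum>k=m..<n. C * (real k + 1) powr (- (1 / 2 + a / real CARD('d))))\<^sup>2 \<le> (sqrt e / 2)\<^sup>2"
      using K2[of m n] that e by (intro abs_le_square_iff[THEN iffD1]) simp
    also have "\<dots> = e / 4" using e by (simp add: power_divide)
    finally show ?thesis
      using C[OF that(2)] K1[of m n] that by auto
  qed
  show "\<exists>K. \<forall>m\<ge>K. \<forall>n\<ge>K. expectation (\<lambda>\<omega>. (centred_sum a m \<omega> - centred_sum a n \<omega>)\<^sup>2) \<le> e"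
  proof (intro exI[of _ "max K1 K2"] allI impI)
    fix m n assume "max K1 K2 \<le> m" "max K1 K2 \<le> n"
    then show "expectation (\<lambda>\<omega>. (centred_sum a m \<omega> - centred_sum a n \<omega>)\<^sup>2) \<le> e"
      using main[of m n] main[of n m] by (cases "m \<le> n") (auto simp: power2_commute)
  qed
qed (rule that)

section \<open>The limit is not normal\<close>

abbreviation cube_sample :: "nat \<Rightarrow> (nat \<Rightarrow> real ^ 'd) measure"
  where "cube_sample n \<equiv> PiM {1..n} (\<lambda>_. cube_law)"

text \<open>
An expectation over the sample depends only on the common law of the points. It will be
used to compare the sample with a rearrangement of it.
\<close>

lemma expectation_sample:
  fixes f :: "(nat \<Rightarrow> real ^ 'd) \<Rightarrow> real"
  assumes n: "n \<ge> 1" and [measurable]: "f \<in> borel_measurable (sample_space n)"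
  shows "expectation (\<lambda>\<omega>. f (sample n \<omega>)) = (\<integral>x. f x \<partial>cube_sample n)"
proof -
  have "distr M (sample_space n) (sample n) = PiM {1..n} (\<lambda>i. distr M borel (U i))"
    unfolding sample_def[abs_def] using n U_measurable indep_vars_subset[OF indep, of "{1..n}"]
    by (subst indep_vars_iff_distr_eq_PiM'[symmetric]) auto
  also have "\<dots> = cube_sample n"
    by (rule PiM_cong) (simp_all add: law)
  finally have "(\<integral>x. f x \<partial>cube_sample n) = (\<integral>x. f x \<partial>distr M (sample_space n) (sample n))"
    by simp
  also have "\<dots> = expectation (\<lambda>\<omega>. f (sample n \<omega>))"
    by (subst integral_distr, measurable)
  finally show ?thesis by simp
qed

lemma measurable_nth_capped_dist:
  assumes "k < l"
  shows "(\<lambda>x. capped_dist x k (x (Suc k))) \<in> borel_measurable (sample_space l)"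
  using assms by (intro measurable_capped_dist measurable_component_singleton) auto

lemma edge_eq_sample: "k < l \<Longrightarrow> edge a k \<omega> = capped_dist (sample l \<omega>) k (sample l \<omega> (Suc k)) powr a"
  by (simp add: edge_def nn_eq_capped_dist_sample[of k l]) (simp add: sample_def)

lemma expectation_edge_product_space:
  "expectation (edge a k) = (\<integral>x. capped_dist x k (x (Suc k)) powr a \<partial>cube_sample (Suc k))"
proof -
  note [measurable] = measurable_nth_capped_dist[of k "Suc k", OF lessI]
  have "(\<lambda>x. capped_dist x k (x (Suc k)) powr a) \<in> borel_measurable (sample_space (Suc k))" by measurable
  from expectation_sample[OF _ this] show ?thesis
    unfolding edge_eq_sample[OF lessI, abs_def] by simp
qed

lemma centred_sum_second_moment_product_space:
  assumes "n \<ge> 1"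
  shows "expectation (\<lambda>\<omega>. (centred_sum a n \<omega>)\<^sup>2) = (\<integral>x. (\<Sum>k<n. capped_dist x k (x (Suc k)) powr a
    - (\<integral>x. capped_dist x k (x (Suc k)) powr a \<partial>cube_sample (Suc k)))\<^sup>2 \<partial>cube_sample n)"
proof -
  define F where "F x = (\<Sum>k<n. capped_dist x k (x (Suc k)) powr a
    - (\<integral>x. capped_dist x k (x (Suc k)) powr a \<partial>cube_sample (Suc k)))\<^sup>2" for x :: "nat \<Rightarrow> real ^ 'd"
  have "(\<lambda>x. capped_dist x k (x (Suc k)) powr a) \<in> borel_measurable (sample_space n)" if "k < n" for k
  proof -
    note [measurable] = measurable_nth_capped_dist[OF that]
    show ?thesis by measurable
  qed
  then have "F \<in> borel_measurable (sample_space n)"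
    unfolding F_def by (intro borel_measurable_power borel_measurable_sum borel_measurable_diff) auto
  then have "expectation (\<lambda>\<omega>. F (sample n \<omega>)) = (\<integral>x. F x \<partial>cube_sample n)"
    by (rule expectation_sample[OF assms])
  moreover have "(centred_sum a n \<omega>)\<^sup>2 = F (sample n \<omega>)" for \<omega>
    unfolding centred_sum_def F_def expectation_edge_product_space
    by (intro arg_cong[where f="\<lambda>x. x\<^sup>2"] sum.cong refl) (simp add: edge_eq_sample[of _ n])
  ultimately show ?thesis by (simp add: F_def)
qed

lemma prob_cballs_pos:
  assumes "finite J" "J \<noteq> {}" "J \<subseteq> {1..}" and p: "\<And>j. j \<in> J \<Longrightarrow> p j \<in> unit_cube" and r: "r > 0"
  shows "prob {\<omega>\<in>space M. \<forall>j\<in>J. U j \<omega> \<in> cball (p j) r} > 0"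
proof -
  have "{\<omega>\<in>space M. \<forall>j\<in>J. U j \<omega> \<in> cball (p j) r} = (\<Inter>j\<in>J. U j -` cball (p j) r \<inter> space M)"
    using assms(2) by auto
  also have "prob \<dots> = (\<Prod>j\<in>J. prob (U j -` cball (p j) r \<inter> space M))"
    using assms by (intro indep_varsD[OF indep]) auto
  also have "\<dots> > 0"
  proof (rule prod_pos)
    fix j assume j: "j \<in> J"
    define r' where "r' = min r (real CARD('d))"
    have r': "0 < r'" "r' \<le> real CARD('d)" "r' \<le> r" using r by (simp_all add: r'_def)
    have "0 < (r' / real CARD('d)) ^ CARD('d)" using r' by simp
    also have "\<dots> \<le> measure cube_law (cball (p j) r')"
      using r' p[OF j] by (intro cube_law_cball_ge) auto
    also have "\<dots> \<le> measure cube_law (cball (p j) r)"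
      using r' by (intro cube.finite_measure_mono) auto
    also have "\<dots> = prob (U j -` cball (p j) r \<inter> space M)"
      using j assms(3) U_measurable[of j] by (subst law[of j, symmetric]) (auto simp: measure_distr)
    finally show "0 < prob (U j -` cball (p j) r \<inter> space M)" .
  qed
  finally show ?thesis .
qed

end

text \<open>
The rearranged sample \<open>V\<close>, with the points 2 and 3 exchanged, has the same law as \<open>U\<close>, and its edge
weights differ from those of \<open>U\<close> only for the second and the third point. So the difference \<open>f\<close> of
the two centred sums does not depend on \<open>n\<close>, and its second moment is at most four times that of a
centred sum. With the sides \<open>A\<close>, \<open>B\<close>, \<open>C\<close> of the triangle of the first three points, where
\<open>C\<close> is strictly the longest and joins the first to the third, \<open>f\<close> is the \<open>a\<close>-th power of the larger
of \<open>A\<close> and \<open>B\<close> minus that of \<open>C\<close> (up to the cap), and hence negative. Three almost equally spaced points on a line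
show that this has positive probability.
\<close>

lemma centred_sum_second_moment_not_tendsto_0:
  fixes U :: "nat \<Rightarrow> 'w \<Rightarrow> real ^ 'd"
  assumes U: "uniform_sample M U" and a: "a > 0"
  shows "\<not> (\<lambda>n. \<integral>\<omega>. (uniform_sample.centred_sum M U a n \<omega>)\<^sup>2 \<partial>M) \<longlonglongrightarrow> 0"
proof
  interpret U: uniform_sample M U by fact
  assume to0: "(\<lambda>n. U.expectation (\<lambda>\<omega>. (U.centred_sum a n \<omega>)\<^sup>2)) \<longlonglongrightarrow> 0"
  define \<tau> :: "nat \<Rightarrow> nat" where "\<tau> i = (if i = 2 then 3 else if i = 3 then 2 else i)" for i
  have inv: "\<tau> (\<tau> i) = i" for i by (simp add: \<tau>_def)
  have ge1: "\<tau> i \<ge> 1 \<longleftrightarrow> i \<ge> 1" for i by (auto simp: \<tau>_def)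
  have inj: "inj_on \<tau> A" for A by (rule inj_on_inverseI[of _ \<tau>]) (rule inv)
  have img: "\<tau> ` {1..} = {1..}"
  proof
    show "\<tau> ` {1..} \<subseteq> {1..}" using ge1 by auto
    show "{1..} \<subseteq> \<tau> ` {1..}"
    proof
      fix i :: nat assume "i \<in> {1..}"
      then show "i \<in> \<tau> ` {1..}" using ge1 by (intro image_eqI[of _ _ "\<tau> i"]) (simp_all add: inv)
    qed
  qed
  define V where "V i = U (\<tau> i)" for i
  have "uniform_sample M V"
  proof (rule uniform_sample.intro[OF U.prob_space_axioms uniform_sample_axioms.intro])
    show "U.indep_vars (\<lambda>_. borel) V {1..}"
      using U.indep_vars_reindex[of borel U \<tau> "{1..}"] U.indep inj by (simp only: img V_def[abs_def])
    show "distr M borel (V i) = cube_law" if "i \<ge> 1" for i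
      using U.law[of "\<tau> i"] that ge1[of i] by (simp only: V_def)
  qed
  then interpret V: uniform_sample M V .
  define f where "f \<omega> = (U.edge a 1 \<omega> - V.edge a 1 \<omega>) + (U.edge a 2 \<omega> - V.edge a 2 \<omega>)" for \<omega>
  have [measurable]: "f \<in> borel_measurable M" unfolding f_def[abs_def] by measurable
  have mean: "U.expectation (V.edge a k) = U.expectation (U.edge a k)" for k
    by (simp only: V.expectation_edge_product_space U.expectation_edge_product_space)
  have late: "V.edge a k \<omega> = U.edge a k \<omega>" if k: "k \<ge> 3" for k \<omega>
  proof -
    have mem: "\<tau> i \<in> {1..k}" if "i \<in> {1..k}" for i
      using that k by (auto simp: \<tau>_def)
    have perm: "\<tau> ` {1..k} = {1..k}"
    proof
      show "\<tau> ` {1..k} \<subseteq> {1..k}" using mem by blast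
      show "{1..k} \<subseteq> \<tau> ` {1..k}"
      proof
        fix i assume "i \<in> {1..k}"
        then show "i \<in> \<tau> ` {1..k}" by (intro image_eqI[of _ _ "\<tau> i"] mem) (simp add: inv)
      qed
    qed
    have "(\<lambda>i. dist y (V i \<omega>)) ` {1..k} = (\<lambda>i. dist y (U i \<omega>)) ` (\<tau> ` {1..k})" for y
      by (simp only: V_def image_image)
    then have "V.nn k \<omega> y = U.nn k \<omega> y" for y
      by (simp only: V.nn_def U.nn_def capped_dist_def perm)
    moreover have "V (Suc k) = U (Suc k)"
      using k by (simp add: V_def \<tau>_def)
    ultimately show ?thesis
      by (simp only: V.edge_def U.edge_def)
  qed
  have diff: "U.centred_sum a n \<omega> - V.centred_sum a n \<omega> = f \<omega>" if n: "n \<ge> 3" for n \<omega>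
  proof -
    have "U.centred_sum a n \<omega> - V.centred_sum a n \<omega> = (\<Sum>k<n. U.edge a k \<omega> - V.edge a k \<omega>)"
      by (simp add: U.centred_sum_def V.centred_sum_def mean sum_subtractf[symmetric])
    also have "\<dots> = (\<Sum>k<3. U.edge a k \<omega> - V.edge a k \<omega>)"
      using n by (intro sum.mono_neutral_right) (auto simp: late)
    also have "\<dots> = f \<omega>"
      by (simp add: f_def numeral_3_eq_3 numeral_2_eq_2 U.edge_def V.edge_def U.nn_def V.nn_def V_def)
    finally show ?thesis .
  qed
  have sq: "square_integrable M (U.centred_sum a n)" "square_integrable M (V.centred_sum a n)" for n
    using a by (auto intro!: U.square_integrable_centred_sum V.square_integrable_centred_sum)
  have f2: "integrable M (\<lambda>\<omega>. (f \<omega>)\<^sup>2)"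
    using square_integrable_diff[OF sq(1)[of 3] sq(2)[of 3]] diff[of 3] by (simp add: square_integrable_def)
  have le: "U.expectation (\<lambda>\<omega>. (f \<omega>)\<^sup>2) \<le> 4 * U.expectation (\<lambda>\<omega>. (U.centred_sum a n \<omega>)\<^sup>2)" if n: "n \<ge> 3" for n
  proof -
    have "U.expectation (\<lambda>\<omega>. (f \<omega>)\<^sup>2) \<le> U.expectation (\<lambda>\<omega>. 2 * (U.centred_sum a n \<omega>)\<^sup>2 + 2 * (V.centred_sum a n \<omega>)\<^sup>2)"
    proof (intro integral_mono f2)
      show "(f \<omega>)\<^sup>2 \<le> 2 * (U.centred_sum a n \<omega>)\<^sup>2 + 2 * (V.centred_sum a n \<omega>)\<^sup>2" for \<omega>
        using square_sum_le[of "U.centred_sum a n \<omega>" "- V.centred_sum a n \<omega>"] diff[OF n, of \<omega>] by simp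
    qed (use sq in \<open>auto simp: square_integrable_def\<close>)
    also have "\<dots> = 2 * U.expectation (\<lambda>\<omega>. (U.centred_sum a n \<omega>)\<^sup>2) + 2 * U.expectation (\<lambda>\<omega>. (V.centred_sum a n \<omega>)\<^sup>2)"
      using sq by (simp add: square_integrable_def)
    also have "U.expectation (\<lambda>\<omega>. (V.centred_sum a n \<omega>)\<^sup>2) = U.expectation (\<lambda>\<omega>. (U.centred_sum a n \<omega>)\<^sup>2)"
      using n by (simp only: V.centred_sum_second_moment_product_space U.centred_sum_second_moment_product_space)
    finally show ?thesis by simp
  qed
  have "U.expectation (\<lambda>\<omega>. (f \<omega>)\<^sup>2) \<le> 4 * 0"
    using le by (intro LIMSEQ_le_const[OF tendsto_mult[OF tendsto_const to0]]) auto
  then have "U.expectation (\<lambda>\<omega>. (f \<omega>)\<^sup>2) = 0"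
    by (simp add: order_antisym)
  then have f0: "AE \<omega> in M. f \<omega> = 0"
    using f2 by (subst (asm) integral_nonneg_eq_0_iff_AE) auto
  \<comment> \<open>three points at mutual distances \<open>t\<close>, \<open>t\<close> and \<open>2 * t\<close> on the diagonal of the cube\<close>
  define v :: "real ^ 'd" where "v = (\<chi> i. 1 / 4)"
  define p where "p j = real j *\<^sub>R v" for j
  define t where "t = norm v"
  have "v \<noteq> 0" by (simp add: v_def vec_eq_iff)
  then have t: "t > 0" by (simp add: t_def)
  have "t \<le> (\<Sum>i\<in>UNIV. \<bar>v $ i\<bar>)" unfolding t_def by (rule norm_le_l1_cart)
  then have td: "4 * t \<le> real CARD('d)" by (simp add: v_def)
  have pp: "dist (p i) (p j) = \<bar>real i - real j\<bar> * t" for i j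
    by (simp add: p_def dist_norm t_def scaleR_diff_left[symmetric])
  let ?E = "{\<omega>\<in>space M. \<forall>j\<in>{1, 2, 3}. U j \<omega> \<in> cball (p j) (t / 8)}"
  have "U.prob ?E > 0"
    using t by (intro U.prob_cballs_pos) (auto simp: p_def v_def unit_cube_def)
  moreover have "f \<omega> < 0" if "\<omega> \<in> ?E" for \<omega>
  proof -
    define A B C where "A = dist (U 1 \<omega>) (U 2 \<omega>)" and "B = dist (U 2 \<omega>) (U 3 \<omega>)" and "C = dist (U 1 \<omega>) (U 3 \<omega>)"
    let ?d = "real CARD('d)"
    have near: "dist (p j) (U j \<omega>) \<le> t / 8" if "j \<in> {1, 2, 3}" for j
      using \<open>\<omega> \<in> ?E\<close> that by auto
    have tri: "\<bar>dist (U i \<omega>) (U j \<omega>) - dist (p i) (p j)\<bar> \<le> t / 4" if "i \<in> {1, 2, 3}" "j \<in> {1, 2, 3}" for i j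
      using near[OF that(1)] near[OF that(2)] by metric
    have p12: "dist (p 1) (p 2) = t" "dist (p 2) (p 3) = t" "dist (p 1) (p 3) = 2 * t"
      by (simp_all add: pp)
    have "\<bar>A - t\<bar> \<le> t / 4" "\<bar>B - t\<bar> \<le> t / 4" "\<bar>C - 2 * t\<bar> \<le> t / 4"
      using tri[of 1 2] tri[of 2 3] tri[of 1 3] unfolding p12 A_def B_def C_def by blast+
    then have A: "A \<le> 5 / 4 * t" and B: "B \<le> 5 / 4 * t" and C: "C \<ge> 7 / 4 * t"
      by linarith+
    have lt: "A < ?d" "B < ?d" "A < C" "B < C" using A B C td t by linarith+
    have ABC: "0 \<le> A" "0 \<le> B" "0 \<le> C" by (simp_all add: A_def B_def C_def)
    have e: "U.edge a 1 \<omega> = A powr a" "U.edge a 2 \<omega> = B powr a"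
      "V.edge a 1 \<omega> = min ?d C powr a" "V.edge a 2 \<omega> = min A B powr a"
      using lt by (simp_all add: U.edge_def V.edge_def U.nn_def V.nn_def numeral_2_eq_2 capped_dist_Suc)
        (simp_all add: V_def \<tau>_def numeral_2_eq_2 numeral_3_eq_3 A_def B_def C_def dist_commute min_def)
    have "A powr a + B powr a = max A B powr a + min A B powr a"
      by (auto simp: min_def max_def)
    moreover have "max A B powr a < min ?d C powr a"
      using lt ABC a by (intro powr_less_mono2) auto
    ultimately show ?thesis unfolding f_def e by linarith
  qed
  have "AE \<omega> in M. \<omega> \<notin> ?E"
    using f0
  proof eventually_elim
    case (elim \<omega>)
    with \<open>\<And>\<omega>. \<omega> \<in> ?E \<Longrightarrow> f \<omega> < 0\<close>[of \<omega>] show ?case by auto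
  qed
  then have "U.prob ?E = 0"
    using U.measurable_U_Suc[of 0] U.measurable_U_Suc[of 1] U.measurable_U_Suc[of 2]
    by (intro U.prob_eq_0_AE) auto
  ultimately show False by simp
qed

context uniform_sample
begin

lemma non_gaussian_limit:
  assumes a: "a > real CARD('d)" and Q: "tendsto_L2 M (centred_sum a) Q"
  shows "\<not> has_centred_normal_law M Q"
proof
  assume normal: "has_centred_normal_law M Q"
  have a0: "a > 0" using a by (rule le_less_trans[rotated]) simp
  have [measurable]: "Q \<in> borel_measurable M"
    using Q by (auto simp: tendsto_L2_def square_integrable_def)
  define A where "A = (\<Sum>k. expectation (edge a k))"
  have "- A \<le> centred_sum a n \<omega>" for n \<omega>
  proof -
    have "(\<Sum>k<n. expectation (edge a k)) \<le> A"
      unfolding A_def using edge_bounds(1)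
      by (intro sum_le_suminf summable_expectation_edge a) (auto intro: integral_nonneg)
    moreover have "0 \<le> (\<Sum>k<n. edge a k \<omega>)" by (intro sum_nonneg edge_bounds)
    ultimately show ?thesis by (simp add: centred_sum_def sum_subtractf)
  qed
  then have "AE \<omega> in M. - A \<le> Q \<omega>" by (rule L2_limit_bounded_below[OF Q])
  then have Q0: "AE \<omega> in M. Q \<omega> = 0"
    using normal by (intro bounded_below_centred_normal_imp_zero) auto
  have "expectation (\<lambda>\<omega>. (centred_sum a n \<omega> - Q \<omega>)\<^sup>2) = expectation (\<lambda>\<omega>. (centred_sum a n \<omega>)\<^sup>2)" for n
    using Q0 by (intro integral_cong_AE) (auto elim: eventually_mono)
  then show False
    using Q centred_sum_second_moment_not_tendsto_0[OF uniform_sample_axioms a0] by (simp add: tendsto_L2_def)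
qed

end

section \<open>The weight of the graph as a sum of edge weights\<close>

text \<open>
For measurability the nearest-neighbour distance is needed as a minimum over a fixed index set. An
index whose point coincides with \<open>x\<close> must not count; it is given the sum of all distances, which is
at least every other entry, and which is 0 exactly when all points coincide with \<open>x\<close>.
\<close>

lemma nn_dist_finite_image:
  assumes I: "finite I" "I \<noteq> {}"
  shows "nn_dist x (f ` I) = Min ((\<lambda>j. if dist x (f j) = 0 then \<Sum>i\<in>I. dist x (f i) else dist x (f j)) ` I)"
    (is "_ = Min (?g ` I)")
proof (cases "\<forall>j\<in>I. f j = x")
  case True
  then have "?g ` I = {0}" using I by auto
  moreover have "f ` I - {x} = {}" using True by auto
  ultimately show ?thesis by (simp add: nn_dist_def infdist_def)
next
  case False
  then obtain j0 where j0: "j0 \<in> I" "f j0 \<noteq> x" by auto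
  define X where "X = f ` I - {x}"
  have X: "finite X" "X \<noteq> {}" using I j0 by (auto simp: X_def)
  have "nn_dist x (f ` I) = Min (dist x ` X)"
    using X by (simp add: nn_dist_def infdist_notempty cInf_eq_Min X_def[symmetric])
  also have "\<dots> = Min (?g ` I)"
  proof (rule antisym)
    show "Min (dist x ` X) \<le> Min (?g ` I)"
    proof (subst Min_ge_iff)
      show "\<forall>b\<in>?g ` I. Min (dist x ` X) \<le> b"
      proof
        fix b assume "b \<in> ?g ` I"
        then obtain j where j: "j \<in> I" "b = ?g j" by auto
        show "Min (dist x ` X) \<le> b"
        proof (cases "f j = x")
          case True
          have "Min (dist x ` X) \<le> dist x (f j0)" using X j0 by (intro Min_le) (auto simp: X_def)
          also have "\<dots> \<le> (\<Sum>i\<in>I. dist x (f i))" using I j0 by (intro member_le_sum) auto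
          finally show ?thesis using True j by simp
        next
          case False
          then show ?thesis using X j by (auto intro!: Min_le simp: X_def)
        qed
      qed
    qed (use I in auto)
    show "Min (?g ` I) \<le> Min (dist x ` X)"
      using X I by (intro Min.boundedI) (auto simp: X_def intro!: Min_le image_eqI)
  qed
  finally show ?thesis .
qed

lemma measurable_nn_dist:
  fixes f :: "'i \<Rightarrow> 'a \<Rightarrow> 'b :: {second_countable_topology, metric_space}"
  assumes I: "finite I" and f: "\<And>i. i \<in> I \<Longrightarrow> f i \<in> borel_measurable M" and g: "g \<in> borel_measurable M"
  shows "(\<lambda>\<omega>. nn_dist (g \<omega>) ((\<lambda>i. f i \<omega>) ` I)) \<in> borel_measurable M"
proof (cases "I = {}")
  case True
  then show ?thesis by (simp add: nn_dist_def infdist_def)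
next
  case False
  have [measurable]: "(\<lambda>\<omega>. dist (g \<omega>) (f i \<omega>)) \<in> borel_measurable M" if "i \<in> I" for i
    using f[OF that] g by (rule borel_measurable_dist[rotated])
  have "(\<lambda>\<omega>. Min ((\<lambda>j. if dist (g \<omega>) (f j \<omega>) = 0 then \<Sum>i\<in>I. dist (g \<omega>) (f i \<omega>) else dist (g \<omega>) (f j \<omega>)) ` I)) \<in> borel_measurable M"
    using I by (intro borel_measurable_Min) measurable
  then show ?thesis
    by (simp only: nn_dist_finite_image[OF I False])
qed

lemma measurable_onng_weight:
  assumes "\<And>i. i \<ge> 1 \<Longrightarrow> U i \<in> borel_measurable M"
  shows "(\<lambda>\<omega>. onng_weight a (\<lambda>i. U i \<omega> :: 'b :: {second_countable_topology, metric_space}) n) \<in> borel_measurable M"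
proof -
  have [measurable]: "(\<lambda>\<omega>. nn_dist (U i \<omega>) ((\<lambda>i. U i \<omega>) ` {1..<i})) \<in> borel_measurable M" if "i \<in> {2..n}" for i
    using that assms by (intro measurable_nn_dist) auto
  show ?thesis unfolding onng_weight_def by measurable
qed

context uniform_sample
begin

text \<open>
Given the earlier points, the new one avoids any of them almost surely, as \<open>cube_law\<close> has no atoms.
\<close>

lemma AE_points_distinct:
  assumes "1 \<le> j" "j \<le> k"
  shows "AE \<omega> in M. U (Suc k) \<omega> \<noteq> U j \<omega>"
proof -
  define f where "f x y = (if dist y (x j) = 0 then 1 else 0 :: real)" for x :: "nat \<Rightarrow> real ^ 'd" and y
  have [measurable]: "(\<lambda>x. x j) \<in> measurable (sample_space k) borel"
    using assms by (intro measurable_component_singleton) auto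
  have "expectation (\<lambda>\<omega>. f (sample k \<omega>) (U (Suc k) \<omega>)) = expectation (\<lambda>\<omega>. \<integral>y. f (sample k \<omega>) y \<partial>cube_law)"
  proof (rule expectation_sample_next[where B=1])
    show "(\<lambda>p. f (fst p) (snd p)) \<in> borel_measurable (sample_space k \<Otimes>\<^sub>M borel)"
      unfolding f_def by measurable
  qed (simp add: f_def)
  also have "(\<lambda>\<omega>. \<integral>y. f (sample k \<omega>) y \<partial>cube_law) = (\<lambda>\<omega>. 0)"
  proof
    fix \<omega>
    have "(\<integral>y. f (sample k \<omega>) y \<partial>cube_law) = (\<integral>y. indicator {sample k \<omega> j} y \<partial>cube_law)"
      by (intro Bochner_Integration.integral_cong) (auto simp: f_def indicator_def)
    then show "(\<integral>y. f (sample k \<omega>) y \<partial>cube_law) = 0" by (simp add: cube_law_singleton)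
  qed
  finally have "expectation (\<lambda>\<omega>. f (sample k \<omega>) (U (Suc k) \<omega>)) = 0" by simp
  moreover have "f (sample k \<omega>) (U (Suc k) \<omega>) = (if dist (U (Suc k) \<omega>) (U j \<omega>) = 0 then 1 else 0)" for \<omega>
    using assms by (simp add: f_def sample_def)
  ultimately have zero: "expectation (\<lambda>\<omega>. if dist (U (Suc k) \<omega>) (U j \<omega>) = 0 then 1 else 0 :: real) = 0" by simp
  have [measurable]: "U j \<in> borel_measurable M" using assms by (intro U_measurable) simp
  have "integrable M (\<lambda>\<omega>. if dist (U (Suc k) \<omega>) (U j \<omega>) = 0 then 1 else 0 :: real)"
    by (rule integrable_bounded[where B=1]) auto
  with zero have "AE \<omega> in M. (if dist (U (Suc k) \<omega>) (U j \<omega>) = 0 then 1 else 0 :: real) = 0"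
    by (subst (asm) integral_nonneg_eq_0_iff_AE) auto
  then show ?thesis by eventually_elim (auto split: if_splits)
qed

lemma AE_in_cube:
  assumes "i \<ge> 1" shows "AE \<omega> in M. U i \<omega> \<in> unit_cube"
proof -
  have [measurable]: "U i \<in> borel_measurable M" using assms by (rule U_measurable)
  have "AE y in distr M borel (U i). y \<in> unit_cube"
    using AE_cube_law by (simp only: law[OF assms])
  then show ?thesis by (subst (asm) AE_distr_iff) auto
qed

definition total_length :: "real \<Rightarrow> nat \<Rightarrow> 'w \<Rightarrow> real"
  where "total_length a n \<omega> = (\<Sum>k\<in>{1..<n}. edge a k \<omega>)"

lemma measurable_total_length[measurable]: "total_length a n \<in> borel_measurable M"
  unfolding total_length_def[abs_def] by measurable

text \<open>
Almost surely all points are distinct and lie in the cube; then neither the removal of the point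
itself nor the cap makes a difference.
\<close>

lemma AE_onng_weight_eq: "AE \<omega> in M. \<forall>n. onng_weight a (\<lambda>i. U i \<omega>) n = total_length a n \<omega>"
proof -
  have "AE \<omega> in M. \<forall>k. \<forall>j\<in>{1..k}. U (Suc k) \<omega> \<noteq> U j \<omega>"
    by (intro AE_all_countable[THEN iffD2] allI AE_finite_allI) (auto intro: AE_points_distinct)
  moreover have "AE \<omega> in M. \<forall>i. U (Suc i) \<omega> \<in> unit_cube"
    by (intro AE_all_countable[THEN iffD2] allI AE_in_cube) simp
  ultimately show ?thesis
  proof eventually_elim
    case (elim \<omega>)
    have nn: "nn_dist (U (Suc k) \<omega>) ((\<lambda>i. U i \<omega>) ` {1..<Suc k}) = nn k \<omega> (U (Suc k) \<omega>)" if k: "k \<ge> 1" for k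
    proof -
      define X where "X = (\<lambda>i. U i \<omega>) ` {1..k}"
      let ?x = "U (Suc k) \<omega>"
      have X: "finite X" "X \<noteq> {}" using k by (auto simp: X_def)
      have "?x \<notin> X" using elim(1) by (auto simp: X_def)
      then have "nn_dist ?x X = Min (dist ?x ` X)"
        using X by (simp add: nn_dist_def infdist_notempty cInf_eq_Min)
      also have "\<dots> = Min (insert (real CARD('d)) (dist ?x ` X))"
      proof -
        have "dist ?x (U 1 \<omega>) \<le> real CARD('d)"
          using elim(2)[rule_format, of k] elim(2)[rule_format, of 0] by (intro dist_unit_cube_le) auto
        moreover have "Min (dist ?x ` X) \<le> dist ?x (U 1 \<omega>)"
          using X k by (intro Min_le) (auto simp: X_def)
        ultimately have "Min (dist ?x ` X) \<le> real CARD('d)" by linarith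
        then show ?thesis using X by (metis Min_insert finite_imageI image_is_empty min_absorb2)
      qed
      also have "\<dots> = nn k \<omega> ?x"
        by (simp add: nn_def capped_dist_def X_def image_image)
      finally show ?thesis by (simp add: X_def atLeastLessThanSuc_atLeastAtMost)
    qed
    show ?case
    proof
      fix n
      have "onng_weight a (\<lambda>i. U i \<omega>) n = (\<Sum>i\<in>Suc ` {1..<n}. nn_dist (U i \<omega>) ((\<lambda>i. U i \<omega>) ` {1..<i}) powr a)"
        by (simp add: onng_weight_def image_Suc_atLeastLessThan atLeastLessThanSuc_atLeastAtMost numeral_2_eq_2)
      also have "\<dots> = total_length a n \<omega>"
        by (subst sum.reindex) (auto simp: total_length_def edge_def nn[unfolded One_nat_def] intro!: sum.cong)
      finally show "onng_weight a (\<lambda>i. U i \<omega>) n = total_length a n \<omega>" .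
    qed
  qed
qed

lemma edge_0: "edge a 0 \<omega> = real CARD('d) powr a"
  by (simp add: edge_def nn_def)

lemma expectation_edge_0: "expectation (edge a 0) = real CARD('d) powr a"
  by (simp add: edge_0[abs_def] prob_space)

lemma centred_sum_eq_total_length:
  "centred_sum a n \<omega> = total_length a n \<omega> - (\<Sum>k\<in>{1..<n}. expectation (edge a k))"
proof (cases n)
  case (Suc m)
  have "centred_sum a n \<omega> = (\<Sum>k\<in>insert 0 {1..<n}. edge a k \<omega> - expectation (edge a k))"
    unfolding centred_sum_def Suc by (rule sum.cong) auto
  also have "\<dots> = (\<Sum>k\<in>{1..<n}. edge a k \<omega> - expectation (edge a k))"
    by (subst sum.insert) (auto simp: edge_0 expectation_edge_0)
  finally show ?thesis by (simp add: total_length_def sum_subtractf)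
qed (simp add: centred_sum_def total_length_def)

lemma expectation_total_length:
  "a \<ge> 0 \<Longrightarrow> expectation (total_length a n) = (\<Sum>k\<in>{1..<n}. expectation (edge a k))"
  unfolding total_length_def[abs_def] using integrable_edge by (simp add: Bochner_Integration.integral_sum)

lemma centred_onng_weight_tendsto_L2:
  assumes a: "a \<ge> 0" and Q: "tendsto_L2 M (centred_sum a) Q"
  shows "tendsto_L2 M (\<lambda>n. centred M (\<lambda>\<omega>. onng_weight a (\<lambda>i. U i \<omega>) n)) Q"
proof (rule tendsto_L2_cong_AE[OF Q])
  fix n
  have [measurable]: "(\<lambda>\<omega>. onng_weight a (\<lambda>i. U i \<omega>) n) \<in> borel_measurable M"
    using U_measurable by (rule measurable_onng_weight)
  have ae: "AE \<omega> in M. onng_weight a (\<lambda>i. U i \<omega>) n = total_length a n \<omega>"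
    using AE_onng_weight_eq[of a] by eventually_elim simp
  have "expectation (\<lambda>\<omega>. onng_weight a (\<lambda>i. U i \<omega>) n) = expectation (total_length a n)"
    using ae by (intro integral_cong_AE) auto
  then have m: "expectation (\<lambda>\<omega>. onng_weight a (\<lambda>i. U i \<omega>) n) = (\<Sum>k\<in>{1..<n}. expectation (edge a k))"
    using a by (simp add: expectation_total_length)
  show "AE \<omega> in M. centred_sum a n \<omega> = centred M (\<lambda>\<omega>. onng_weight a (\<lambda>i. U i \<omega>) n) \<omega>"
    using ae by eventually_elim (simp add: centred_def m centred_sum_eq_total_length)
  show "centred M (\<lambda>\<omega>. onng_weight a (\<lambda>i. U i \<omega>) n) \<in> borel_measurable M"
    unfolding centred_def[abs_def] by measurable
qed

lemma expectation_edge_Suc_le: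
  assumes a: "a \<ge> 0" shows "expectation (edge a (Suc k)) \<le> expectation (edge a k)"
proof -
  let ?K = "real CARD('d) powr a"
  have le: "nn (Suc k) \<omega> y powr a \<le> nn k \<omega> y powr a" for \<omega> y
    using a nn_bounds(1)[of "Suc k" \<omega> y] by (intro powr_mono2) (auto simp: nn_def capped_dist_Suc_le)
  have "mean_nn_power a (Suc k) \<omega> \<le> mean_nn_power a k \<omega>" if "\<omega> \<in> space M" for \<omega>
    unfolding mean_nn_power_def using that a nn_powr_le[of a _ \<omega>]
    by (intro integral_mono le cube.integrable_const_bound[where B="?K"]) auto
  moreover have "integrable M (mean_nn_power a j)" for j
    using mean_nn_power_bounds[OF a] by (intro integrable_bounded[where B="?K"]) auto
  ultimately show ?thesis
    unfolding expectation_edge[OF a] by (intro integral_mono)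
qed

text \<open>
The squared expectation of an edge weight is at most its second moment, and these are summable.
\<close>

lemma expected_length_square_over_n:
  assumes a: "a > real CARD('d) / 2"
  shows "(\<lambda>n. (\<Sum>k<n. expectation (edge a k))\<^sup>2 / real n) \<longlonglongrightarrow> 0"
proof (rule square_of_sum_over_n_tendsto_0)
  have a0: "a \<ge> 0" using a by (rule order_trans[rotated, OF less_imp_le]) simp
  show "summable (\<lambda>j. (expectation (edge a j))\<^sup>2)"
  proof (rule summable_comparison_test')
    show "summable (\<lambda>k. expectation (edge (2 * a) k))"
      using a by (intro summable_expectation_edge) simp
    show "norm ((expectation (edge a k))\<^sup>2) \<le> expectation (edge (2 * a) k)" for k
      using square_of_expectation_le[OF square_integrable_edge[OF a0, of k]] by (simp add: edge_square)
  qed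
qed

text \<open>
The expected edge weights decrease. The term for \<open>k = 0\<close> is added only to the chord on the right, where the
partial sums have to start with the largest term; it does not decrease increments.
\<close>

lemma mean_total_length_increment_le:
  assumes a: "a \<ge> 0" and n: "n \<ge> 1"
  shows "\<bar>(\<Sum>j\<in>{1..<k}. expectation (edge a j)) - (\<Sum>j\<in>{1..<n}. expectation (edge a j))\<bar>
    \<le> \<bar>real k - real n\<bar> * ((\<Sum>j<n. expectation (edge a j)) / real n)"
proof -
  define \<mu> where "\<mu> j = expectation (edge a j)" for j
  have \<mu>0: "0 \<le> \<mu> j" for j unfolding \<mu>_def by (intro Bochner_Integration.integral_nonneg edge_bounds)
  have *: "(\<Sum>j<k. \<mu> j) = (if k = 0 then 0 else \<mu> 0) + (\<Sum>j\<in>{1..<k}. \<mu> j)" for k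
    by (cases k) (simp_all add: lessThan_atLeast0 sum.atLeast_Suc_lessThan)
  have "\<bar>(\<Sum>j\<in>{1..<k}. \<mu> j) - (\<Sum>j\<in>{1..<n}. \<mu> j)\<bar> \<le> \<bar>(\<Sum>j<k. \<mu> j) - (\<Sum>j<n. \<mu> j)\<bar>"
  proof (cases "k = 0")
    case True
    have "0 \<le> (\<Sum>j\<in>{1..<n}. \<mu> j)" by (intro sum_nonneg \<mu>0)
    then show ?thesis using True n \<mu>0[of 0] unfolding * by simp
  next
    case False
    then show ?thesis using n unfolding * by simp
  qed
  also have "\<dots> \<le> \<bar>real k - real n\<bar> * ((\<Sum>j<n. \<mu> j) / real n)"
    using \<mu>0 n expectation_edge_Suc_le[OF a] by (intro decreasing_sum_increment_le) (auto simp: \<mu>_def)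
  finally show ?thesis by (simp add: \<mu>_def)
qed

end

section \<open>Poissonization\<close>

locale poissonized_sample = uniform_sample M U for M :: "'w measure" and U :: "nat \<Rightarrow> 'w \<Rightarrow> real ^ 'd" +
  fixes N :: "real \<Rightarrow> 'w \<Rightarrow> nat"
  assumes poisson: "unit_rate_poisson_process M N"
    and independent: "indep_set (process_events M (count_space UNIV) {0..} N) (process_events M borel {1..} U)"
begin

lemma measurable_N: "t \<ge> 0 \<Longrightarrow> N t \<in> measurable M (count_space UNIV)"
  using poisson by (simp add: unit_rate_poisson_process_def)

lemma AE_N_0: "AE \<omega> in M. N 0 \<omega> = 0"
  using poisson by (auto simp: unit_rate_poisson_process_def elim: eventually_mono)

lemma distr_N:
  assumes t: "t > 0"
  shows "distr M (count_space UNIV) (N t) = measure_pmf (poisson_pmf t)"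
proof -
  have [measurable]: "N t \<in> measurable M (count_space UNIV)" "N 0 \<in> measurable M (count_space UNIV)"
    using t by (auto intro: measurable_N)
  have "distr M (count_space UNIV) (N t) = distr M (count_space UNIV) (\<lambda>\<omega>. N t \<omega> - N 0 \<omega>)"
    using AE_N_0 by (intro distr_cong_AE) (auto elim: eventually_mono)
  also have "\<dots> = measure_pmf (poisson_pmf (t - 0))"
    using poisson t unfolding unit_rate_poisson_process_def by blast
  finally show ?thesis by simp
qed

lemma nn_integral_N:
  assumes t: "t > 0"
  shows "(\<integral>\<^sup>+\<omega>. f (N t \<omega>) \<partial>M) = (\<integral>\<^sup>+k. f k \<partial>measure_pmf (poisson_pmf t))"
proof -
  have "(\<integral>\<^sup>+k. f k \<partial>measure_pmf (poisson_pmf t)) = (\<integral>\<^sup>+k. f k \<partial>distr M (count_space UNIV) (N t))"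
    by (simp only: distr_N[OF t])
  also have "\<dots> = (\<integral>\<^sup>+\<omega>. f (N t \<omega>) \<partial>M)"
    using t by (intro nn_integral_distr measurable_N) auto
  finally show ?thesis by simp
qed

text \<open>
The event is determined by the process \<open>N\<close> and the function \<open>G (sample n)\<close> by the points; the
generated sigma-algebras are independent. The indicator of the event is taken as a real variable, so that both have
values of the same type.
\<close>

lemma expectation_on_N_eq:
  fixes G :: "(nat \<Rightarrow> real ^ 'd) \<Rightarrow> real"
  assumes t: "t > 0" and G: "G \<in> borel_measurable (sample_space n)" and B: "\<And>x. \<bar>G x\<bar> \<le> B"
  shows "expectation (\<lambda>\<omega>. indicator {\<omega>. N t \<omega> = k} \<omega> * G (sample n \<omega>)) = pmf (poisson_pmf t) k * expectation (\<lambda>\<omega>. G (sample n \<omega>))"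
proof -
  define X where "X \<omega> = G (sample n \<omega>)" for \<omega>
  define Y :: "'w \<Rightarrow> real" where "Y \<omega> = (if N t \<omega> = k then 1 else 0)" for \<omega>
  have [measurable]: "N t \<in> measurable M (count_space UNIV)" using t by (intro measurable_N) simp
  have [measurable]: "Y \<in> borel_measurable M" unfolding Y_def by measurable
  have X[measurable]: "X \<in> borel_measurable M"
    unfolding X_def by (rule measurable_compose[OF measurable_sample G])
  let ?u = "\<lambda>\<omega>. \<lambda>i\<in>{1..}. U i \<omega>" and ?S = "PiM {1..} (\<lambda>_. borel) :: (nat \<Rightarrow> real ^ 'd) measure"
  let ?n = "\<lambda>\<omega>. \<lambda>s\<in>{0..}. N s \<omega>" and ?T = "PiM {0..} (\<lambda>_. count_space UNIV) :: (real \<Rightarrow> nat) measure"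
  define FU where "FU = vimage_algebra (space M) ?u ?S"
  define FN where "FN = vimage_algebra (space M) ?n ?T"
  have indep': "indep_set (sets FN) (sets FU)"
    using independent by (simp add: process_events_def FU_def FN_def)
  have XU: "X \<in> borel_measurable FU"
  proof -
    have "?u \<in> measurable FU ?S"
      unfolding FU_def by (rule measurable_vimage_algebra1) (auto simp: space_PiM)
    moreover have "(\<lambda>x. restrict x {1..n}) \<in> measurable ?S (sample_space n)"
      by (rule measurable_restrict_subset) auto
    ultimately have "(\<lambda>\<omega>. restrict (?u \<omega>) {1..n}) \<in> measurable FU (sample_space n)"
      by (rule measurable_compose)
    also have "(\<lambda>\<omega>. restrict (?u \<omega>) {1..n}) = sample n"
      by (auto simp: fun_eq_iff sample_def restrict_def)
    finally show ?thesis unfolding X_def using G by (rule measurable_compose)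
  qed
  have YN: "Y \<in> borel_measurable FN"
  proof -
    have "?n \<in> measurable FN ?T"
      unfolding FN_def by (rule measurable_vimage_algebra1) (auto simp: space_PiM)
    moreover have "(\<lambda>x. x t) \<in> measurable ?T (count_space UNIV)"
      using t by (intro measurable_component_singleton) simp
    ultimately have "(\<lambda>\<omega>. ?n \<omega> t) \<in> measurable FN (count_space UNIV)"
      by (rule measurable_compose)
    then have [measurable]: "N t \<in> measurable FN (count_space UNIV)" using t by simp
    show ?thesis unfolding Y_def by measurable
  qed
  have spc: "space FU = space M" "space FN = space M" by (simp_all add: FU_def FN_def)
  have sub: "sigma_sets (space M) {Z -` A \<inter> space M | A. A \<in> sets borel} \<subseteq> sets F"
    if "Z \<in> borel_measurable F" "space F = space M" for Z :: "'w \<Rightarrow> real" and F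
  proof -
    have "{Z -` A \<inter> space M | A. A \<in> sets borel} \<subseteq> sets F"
      using that by (auto simp: that(2)[symmetric] intro: measurable_sets)
    then show ?thesis using sets.sigma_sets_subset[of _ F] that(2) by simp
  qed
  have "indep_var borel Y borel X"
    unfolding indep_var_eq
  proof (intro conjI)
    show "indep_set (sigma_sets (space M) {Y -` A \<inter> space M | A. A \<in> sets borel})
        (sigma_sets (space M) {X -` A \<inter> space M | A. A \<in> sets borel})"
      using indep' sub[OF YN spc(2)] sub[OF XU spc(1)]
      unfolding indep_set_def by (elim indep_sets_mono_sets) (auto split: bool.split)
  qed simp_all
  moreover have intX: "integrable M X"
    by (rule integrable_bounded[OF X, of B]) (simp add: X_def B)
  moreover have intY: "integrable M Y"
    by (rule integrable_bounded[where B=1]) (auto simp: Y_def)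
  ultimately have "expectation (\<lambda>\<omega>. Y \<omega> * X \<omega>) = expectation Y * expectation X"
    by (intro indep_var_lebesgue_integral)
  moreover have "expectation Y = pmf (poisson_pmf t) k"
  proof -
    have "expectation Y = expectation (indicator {\<omega>\<in>space M. N t \<omega> = k})"
      by (intro Bochner_Integration.integral_cong) (auto simp: Y_def indicator_def)
    also have "\<dots> = prob (N t -` {k} \<inter> space M)"
      by (simp add: vimage_def Int_def conj_commute)
    also have "\<dots> = measure (distr M (count_space UNIV) (N t)) {k}"
      by (simp add: measure_distr)
    finally show ?thesis by (simp add: distr_N[OF t] pmf.rep_eq)
  qed
  moreover have "(\<lambda>\<omega>. Y \<omega> * X \<omega>) = (\<lambda>\<omega>. indicator {\<omega>. N t \<omega> = k} \<omega> * G (sample n \<omega>))"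
    by (auto simp: Y_def X_def indicator_def)
  ultimately show ?thesis by (simp add: X_def[abs_def])
qed

text \<open>
Conditioning on the value of \<open>N\<close>: the points are independent of it, so a functional of the first
\<open>m (N t)\<close> points is averaged as for a fixed number of points, and then over the Poisson law.
\<close>

lemma nn_integral_at_N:
  fixes G :: "nat \<Rightarrow> (nat \<Rightarrow> real ^ 'd) \<Rightarrow> real"
  assumes t: "t > 0" and G[measurable]: "\<And>k. G k \<in> borel_measurable (sample_space (m k))"
    and B: "\<And>k x. \<bar>G k x\<bar> \<le> B k" and nonneg: "\<And>k x. 0 \<le> G k x"
  shows "(\<integral>\<^sup>+\<omega>. ennreal (G (N t \<omega>) (sample (m (N t \<omega>)) \<omega>)) \<partial>M)
    = (\<integral>\<^sup>+k. ennreal (expectation (\<lambda>\<omega>. G k (sample (m k) \<omega>))) \<partial>measure_pmf (poisson_pmf t))"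
proof -
  have [measurable]: "N t \<in> measurable M (count_space UNIV)" using t by (intro measurable_N) simp
  have [measurable]: "(\<lambda>\<omega>. G k (sample (m k) \<omega>)) \<in> borel_measurable M" for k
    by (rule measurable_compose[OF measurable_sample G])
  let ?f = "\<lambda>k \<omega>. indicator {\<omega>. N t \<omega> = k} \<omega> * G k (sample (m k) \<omega>)"
  have [measurable]: "?f k \<in> borel_measurable M" for k
  proof -
    have "?f k = (\<lambda>\<omega>. if N t \<omega> = k then G k (sample (m k) \<omega>) else 0)" by (auto simp: indicator_def)
    also have "\<dots> \<in> borel_measurable M" by measurable
    finally show ?thesis .
  qed
  have int: "integrable M (?f k)" for k
    using B[of k] order_trans[OF abs_ge_zero B[of k]]
    by (intro integrable_bounded[where B="B k"]) (auto simp: indicator_def)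
  have "(\<Sum>k. ennreal (?f k \<omega>)) = ennreal (G (N t \<omega>) (sample (m (N t \<omega>)) \<omega>))" for \<omega>
  proof -
    have "(\<Sum>k. ennreal (?f k \<omega>)) = (\<Sum>k\<in>{N t \<omega>}. ennreal (?f k \<omega>))"
      by (rule suminf_finite) auto
    then show ?thesis by simp
  qed
  then have "(\<integral>\<^sup>+\<omega>. ennreal (G (N t \<omega>) (sample (m (N t \<omega>)) \<omega>)) \<partial>M) = (\<integral>\<^sup>+\<omega>. (\<Sum>k. ennreal (?f k \<omega>)) \<partial>M)"
    by simp
  also have "\<dots> = (\<Sum>k. \<integral>\<^sup>+\<omega>. ennreal (?f k \<omega>) \<partial>M)"
    by (rule nn_integral_suminf) simp
  also have "\<dots> = (\<Sum>k. ennreal (pmf (poisson_pmf t) k) * ennreal (expectation (\<lambda>\<omega>. G k (sample (m k) \<omega>))))"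
  proof (rule suminf_cong)
    fix k
    have "(\<integral>\<^sup>+\<omega>. ennreal (?f k \<omega>) \<partial>M) = ennreal (expectation (?f k))"
      using int nonneg by (intro nn_integral_eq_integral) auto
    also have "expectation (?f k) = pmf (poisson_pmf t) k * expectation (\<lambda>\<omega>. G k (sample (m k) \<omega>))"
      by (rule expectation_on_N_eq[OF t G B])
    finally show "(\<integral>\<^sup>+\<omega>. ennreal (?f k \<omega>) \<partial>M) = ennreal (pmf (poisson_pmf t) k) * ennreal (expectation (\<lambda>\<omega>. G k (sample (m k) \<omega>)))"
      using nonneg by (simp add: ennreal_mult Bochner_Integration.integral_nonneg)
  qed
  also have "\<dots> = (\<integral>\<^sup>+k. ennreal (expectation (\<lambda>\<omega>. G k (sample (m k) \<omega>))) \<partial>measure_pmf (poisson_pmf t))"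
    by (simp add: nn_integral_measure_pmf nn_integral_count_space_nat)
  finally show ?thesis .
qed

lemma centred_sum_at_N_distance:
  assumes t: "t > 0" and a: "a \<ge> 0"
  shows "(\<integral>\<^sup>+\<omega>. ennreal ((centred_sum a (N t \<omega>) \<omega> - centred_sum a n \<omega>)\<^sup>2) \<partial>M)
    = (\<integral>\<^sup>+k. ennreal (expectation (\<lambda>\<omega>. (centred_sum a k \<omega> - centred_sum a n \<omega>)\<^sup>2)) \<partial>measure_pmf (poisson_pmf t))"
proof -
  let ?K = "real CARD('d) powr a"
  define S where "S k x = (\<Sum>j<k. capped_dist x j (x (Suc j)) powr a - expectation (edge a j))" for k and x :: "nat \<Rightarrow> real ^ 'd"
  have S: "centred_sum a k \<omega> = S k (sample l \<omega>)" if "k \<le> l" for k l \<omega>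
    unfolding centred_sum_def S_def using that by (intro sum.cong refl) (simp add: edge_eq_sample[of _ l])
  have Sm: "S k \<in> borel_measurable (sample_space l)" if "k \<le> l" for k l
  proof -
    have "(\<lambda>x. capped_dist x j (x (Suc j)) powr a) \<in> borel_measurable (sample_space l)" if "j < k" for j
    proof -
      have "j < l" using that \<open>k \<le> l\<close> by simp
      note [measurable] = measurable_nth_capped_dist[OF this]
      show ?thesis by measurable
    qed
    then show ?thesis unfolding S_def[abs_def]
      by (intro borel_measurable_sum borel_measurable_diff) auto
  qed
  have SB: "\<bar>S k x\<bar> \<le> real k * (?K + ?K)" for k x
  proof -
    have "\<bar>S k x\<bar> \<le> (\<Sum>j<k. \<bar>capped_dist x j (x (Suc j)) powr a - expectation (edge a j)\<bar>)"
      unfolding S_def by (rule sum_abs)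
    also have "\<dots> \<le> (\<Sum>j<k. ?K + ?K)"
    proof (rule sum_mono)
      fix j
      have "0 \<le> expectation (edge a j)" "expectation (edge a j) \<le> ?K"
        using edge_bounds[of a j] a integrable_edge[OF a, of j]
        by (auto intro!: Bochner_Integration.integral_nonneg integral_le_const)
      moreover have "0 \<le> capped_dist x j (x (Suc j)) powr a" "capped_dist x j (x (Suc j)) powr a \<le> ?K"
        using a capped_dist_bounds[of x j] by (auto intro: powr_mono2)
      ultimately show "\<bar>capped_dist x j (x (Suc j)) powr a - expectation (edge a j)\<bar> \<le> ?K + ?K" by linarith
    qed
    finally show ?thesis by simp
  qed
  define G where "G k x = (S k x - S n x)\<^sup>2" for k x
  define m where "m k = max k n" for k
  have Gm: "G k \<in> borel_measurable (sample_space (m k))" for k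
    unfolding G_def[abs_def] m_def by (intro borel_measurable_power borel_measurable_diff Sm) auto
  have GB: "\<bar>G k x\<bar> \<le> (real k * (?K + ?K) + real n * (?K + ?K))\<^sup>2" for k x
  proof -
    have "\<bar>S k x - S n x\<bar> \<le> real k * (?K + ?K) + real n * (?K + ?K)"
      using SB[of k x] SB[of n x] by linarith
    then have "\<bar>S k x - S n x\<bar>\<^sup>2 \<le> (real k * (?K + ?K) + real n * (?K + ?K))\<^sup>2"
      by (rule power_mono) simp
    then show ?thesis by (simp only: G_def power2_abs abs_power2)
  qed
  have eq: "(centred_sum a k \<omega> - centred_sum a n \<omega>)\<^sup>2 = G k (sample (m k) \<omega>)" for k \<omega>
    by (simp add: G_def m_def S[of k "max k n"] S[of n "max k n"])
  show ?thesis unfolding eq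
    by (rule nn_integral_at_N[OF t Gm GB]) (simp add: G_def)
qed

lemma square_integrable_N: "square_integrable M (\<lambda>\<omega>. real (N (real n) \<omega>))"
proof (cases "n = 0")
  case True
  have [measurable]: "N 0 \<in> measurable M (count_space UNIV)" by (intro measurable_N) simp
  have "integrable M (\<lambda>\<omega>. (real (N 0 \<omega>))\<^sup>2) \<longleftrightarrow> integrable M (\<lambda>\<omega>. 0 :: real)"
    using AE_N_0 by (intro integrable_cong_AE) (auto elim: eventually_mono)
  then show ?thesis using True by (simp add: square_integrable_def)
next
  case False
  have [measurable]: "N (real n) \<in> measurable M (count_space UNIV)" by (intro measurable_N) simp
  have "(\<integral>\<^sup>+\<omega>. ennreal ((real (N (real n) \<omega>) - real n)\<^sup>2) \<partial>M) = ennreal (real n)"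
    using False by (subst nn_integral_N[where f="\<lambda>k. ennreal ((real k - real n)\<^sup>2)"])
      (simp_all add: poisson_second_central_moment)
  then have "integrable M (\<lambda>\<omega>. (real (N (real n) \<omega>) - real n)\<^sup>2)"
    by (intro integrableI_nonneg) auto
  then have "square_integrable M (\<lambda>\<omega>. real (N (real n) \<omega>) - real n)"
    by (simp add: square_integrable_def)
  from square_integrable_add[OF this square_integrable_const[of "real n"]] show ?thesis by simp
qed

lemma total_length_at_N_square_integrable:
  assumes a: "a \<ge> 0"
  shows "square_integrable M (\<lambda>\<omega>. total_length a (N (real n) \<omega>) \<omega>)"
  unfolding square_integrable_def
proof
  let ?K = "real CARD('d) powr a"
  have [measurable]: "N (real n) \<in> measurable M (count_space UNIV)" by (intro measurable_N) simp
  show [measurable]: "(\<lambda>\<omega>. total_length a (N (real n) \<omega>) \<omega>) \<in> borel_measurable M"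
    by (rule measurable_compose_countable[where f="total_length a"]) auto
  have "0 \<le> total_length a k \<omega>" "total_length a k \<omega> \<le> ?K * real k" for k \<omega>
  proof -
    show "0 \<le> total_length a k \<omega>" unfolding total_length_def by (intro sum_nonneg edge_bounds)
    have "total_length a k \<omega> \<le> real (card {1..<k}) * ?K"
      unfolding total_length_def using edge_bounds(2)[OF a] by (intro sum_bounded_above) auto
    also have "\<dots> \<le> real k * ?K" by (intro mult_right_mono) auto
    finally show "total_length a k \<omega> \<le> ?K * real k" by (simp add: mult.commute)
  qed
  then have le: "(total_length a k \<omega>)\<^sup>2 \<le> (?K * real k)\<^sup>2" for k \<omega>
    by (intro power_mono)
  show "integrable M (\<lambda>\<omega>. (total_length a (N (real n) \<omega>) \<omega>)\<^sup>2)"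
  proof (rule Bochner_Integration.integrable_bound)
    show "integrable M (\<lambda>\<omega>. (?K * real (N (real n) \<omega>))\<^sup>2)"
      using square_integrable_cmult[OF square_integrable_N, of ?K n] by (simp add: square_integrable_def)
    show "AE \<omega> in M. norm ((total_length a (N (real n) \<omega>) \<omega>)\<^sup>2) \<le> norm ((?K * real (N (real n) \<omega>))\<^sup>2)"
      using le by (intro AE_I2) simp
  qed simp
qed

text \<open>
With the centring constant \<open>\<alpha> n\<close>, the expected total weight of \<open>n\<close> points, the distance to \<open>Q\<close> is the sum of three terms:
\<open>A\<close> exchanges \<open>N n\<close> for \<open>n\<close> in the centred sum, \<open>B\<close> does so in the expected weight, and \<open>C\<close> is the
distance for a fixed number of points. The bound for \<open>B\<close> uses that \<open>N n\<close> has variance \<open>n\<close>.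
\<close>

lemma total_length_at_N_L2_distance:
  assumes a: "a \<ge> 0" and Q: "tendsto_L2 M (centred_sum a) Q" and n: "n \<ge> 1"
  defines "\<delta> k \<equiv> expectation (\<lambda>\<omega>. (centred_sum a k \<omega> - Q \<omega>)\<^sup>2)"
  shows "expectation (\<lambda>\<omega>. (centred M (\<lambda>\<omega>. total_length a (N (real n) \<omega>) \<omega>) \<omega> - Q \<omega>)\<^sup>2)
    \<le> 3 * (2 * measure_pmf.expectation (poisson_pmf (real n)) \<delta> + 2 * \<delta> n
      + (\<Sum>k<n. expectation (edge a k))\<^sup>2 / real n + \<delta> n)"
proof -
  have [measurable]: "N (real n) \<in> measurable M (count_space UNIV)" by (intro measurable_N) simp
  have [measurable]: "Q \<in> borel_measurable M" and Qsq: "square_integrable M Q"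
    and \<delta>0: "\<delta> \<longlonglongrightarrow> 0"
    using Q by (auto simp: tendsto_L2_def square_integrable_def \<delta>_def[abs_def])
  have Ssq: "square_integrable M (centred_sum a k)" for k
    using a by (rule square_integrable_centred_sum)
  have \<delta>nonneg: "0 \<le> \<delta> k" for k by (simp add: \<delta>_def)
  have SQ: "square_integrable M (\<lambda>\<omega>. centred_sum a k \<omega> - Q \<omega>)" for k
    by (intro square_integrable_diff Ssq Qsq)
  have n0: "real n > 0" using n by simp
  let ?P = "poisson_pmf (real n)"
  define c where "c = (\<Sum>k<n. expectation (edge a k)) / real n"
  define \<alpha> where "\<alpha> k = (\<Sum>j\<in>{1..<k}. expectation (edge a j))" for k
  define Y where "Y \<omega> = total_length a (N (real n) \<omega>) \<omega>" for \<omega>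
  define A where "A \<omega> = centred_sum a (N (real n) \<omega>) \<omega> - centred_sum a n \<omega>" for \<omega>
  define B where "B \<omega> = \<alpha> (N (real n) \<omega>) - \<alpha> n" for \<omega>
  define C where "C \<omega> = centred_sum a n \<omega> - Q \<omega>" for \<omega>
  define X where "X \<omega> = Y \<omega> - \<alpha> n - Q \<omega>" for \<omega>
  have Ysq: "square_integrable M Y"
    unfolding Y_def using a by (rule total_length_at_N_square_integrable)
  have Xsq: "square_integrable M X"
    unfolding X_def by (intro square_integrable_diff Ysq Qsq square_integrable_const)
  have [measurable]: "(\<lambda>\<omega>. centred_sum a (N (real n) \<omega>) \<omega>) \<in> borel_measurable M"
    by (rule measurable_compose_countable[where f="centred_sum a"]) auto
  have [measurable]: "A \<in> borel_measurable M" "B \<in> borel_measurable M" "C \<in> borel_measurable M"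
    unfolding A_def B_def C_def by measurable
  have XABC: "X \<omega> = A \<omega> + B \<omega> + C \<omega>" for \<omega>
    by (simp add: X_def Y_def A_def B_def C_def \<alpha>_def centred_sum_eq_total_length)
  have intY: "integrable M Y" "integrable M Q"
    using Ysq Qsq square_integrable_imp_integrable unfolding square_integrable_def by blast+
  have EQ: "expectation Q = 0"
    using expectation_L2_limit(2)[OF Q] expectation_centred_sum[OF a] by simp
  have "centred M Y \<omega> - Q \<omega> = X \<omega> - expectation X" for \<omega>
    using intY EQ unfolding X_def centred_def by (simp add: prob_space)
  then have le_X: "expectation (\<lambda>\<omega>. (centred M Y \<omega> - Q \<omega>)\<^sup>2) \<le> expectation (\<lambda>\<omega>. (X \<omega>)\<^sup>2)"
    using second_moment_centred_le[OF Xsq] by simp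
  have X_le: "ennreal (expectation (\<lambda>\<omega>. (X \<omega>)\<^sup>2)) \<le> ennreal (3 * (2 * measure_pmf.expectation ?P \<delta> + 2 * \<delta> n
      + (\<Sum>k<n. expectation (edge a k))\<^sup>2 / real n + \<delta> n))"
  proof -
    have sq3: "(x + y + z)\<^sup>2 \<le> 3 * (x\<^sup>2 + y\<^sup>2 + z\<^sup>2)" for x y z :: real
    proof -
      have "0 \<le> (x - y)\<^sup>2 + (y - z)\<^sup>2 + (x - z)\<^sup>2" by simp
      then show ?thesis by (simp add: power2_eq_square algebra_simps)
    qed
    have ennreal3: "3 * (ennreal p + ennreal q + ennreal r) = ennreal (3 * (p + q + r))"
      if "0 \<le> p" "0 \<le> q" "0 \<le> r" for p q r
      using that by (simp add: ennreal_mult ennreal_plus)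
    have "ennreal (expectation (\<lambda>\<omega>. (X \<omega>)\<^sup>2)) = (\<integral>\<^sup>+\<omega>. ennreal ((X \<omega>)\<^sup>2) \<partial>M)"
      using Xsq by (subst nn_integral_eq_integral) (auto simp: square_integrable_def)
    also have "\<dots> \<le> (\<integral>\<^sup>+\<omega>. 3 * (ennreal ((A \<omega>)\<^sup>2) + ennreal ((B \<omega>)\<^sup>2) + ennreal ((C \<omega>)\<^sup>2)) \<partial>M)"
    proof (rule nn_integral_mono)
      fix \<omega>
      have "ennreal ((X \<omega>)\<^sup>2) \<le> ennreal (3 * ((A \<omega>)\<^sup>2 + (B \<omega>)\<^sup>2 + (C \<omega>)\<^sup>2))"
        unfolding XABC by (intro ennreal_leI sq3)
      then show "ennreal ((X \<omega>)\<^sup>2) \<le> 3 * (ennreal ((A \<omega>)\<^sup>2) + ennreal ((B \<omega>)\<^sup>2) + ennreal ((C \<omega>)\<^sup>2))"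
        by (simp add: ennreal_mult ennreal_plus)
    qed
    also have "\<dots> = 3 * ((\<integral>\<^sup>+\<omega>. ennreal ((A \<omega>)\<^sup>2) \<partial>M) + (\<integral>\<^sup>+\<omega>. ennreal ((B \<omega>)\<^sup>2) \<partial>M) + (\<integral>\<^sup>+\<omega>. ennreal ((C \<omega>)\<^sup>2) \<partial>M))"
      by (simp add: nn_integral_cmult nn_integral_add)
    also have "\<dots> \<le> 3 * (ennreal (2 * measure_pmf.expectation ?P \<delta> + 2 * \<delta> n) + ennreal ((\<Sum>k<n. expectation (edge a k))\<^sup>2 / real n) + ennreal (\<delta> n))"
    proof (intro mult_left_mono add_mono)
      obtain D where D: "\<And>k. \<bar>\<delta> k\<bar> \<le> D"
        using convergent_imp_Bseq[of \<delta>] \<delta>0 by (auto simp: convergent_def Bseq_def)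
      have int\<delta>: "integrable (measure_pmf ?P) \<delta>"
        using D by (intro measure_pmf.integrable_const_bound[where B=D]) auto
      have "(\<integral>\<^sup>+\<omega>. ennreal ((A \<omega>)\<^sup>2) \<partial>M) = (\<integral>\<^sup>+k. ennreal (expectation (\<lambda>\<omega>. (centred_sum a k \<omega> - centred_sum a n \<omega>)\<^sup>2)) \<partial>measure_pmf ?P)"
        unfolding A_def by (rule centred_sum_at_N_distance[OF n0 a])
      also have "\<dots> \<le> (\<integral>\<^sup>+k. ennreal (2 * \<delta> k + 2 * \<delta> n) \<partial>measure_pmf ?P)"
      proof (intro nn_integral_mono ennreal_leI)
        fix k
        have "expectation (\<lambda>\<omega>. (centred_sum a k \<omega> - centred_sum a n \<omega>)\<^sup>2)
            \<le> expectation (\<lambda>\<omega>. 2 * (centred_sum a k \<omega> - Q \<omega>)\<^sup>2 + 2 * (centred_sum a n \<omega> - Q \<omega>)\<^sup>2)"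
        proof (rule integral_mono)
          show "(centred_sum a k \<omega> - centred_sum a n \<omega>)\<^sup>2 \<le> 2 * (centred_sum a k \<omega> - Q \<omega>)\<^sup>2 + 2 * (centred_sum a n \<omega> - Q \<omega>)\<^sup>2" for \<omega>
            using square_sum_le[of "centred_sum a k \<omega> - Q \<omega>" "Q \<omega> - centred_sum a n \<omega>"] by (simp add: power2_commute[of "Q \<omega>"])
        qed (use SQ square_integrable_diff[OF Ssq Ssq] in \<open>auto simp: square_integrable_def\<close>)
        also have "\<dots> = 2 * \<delta> k + 2 * \<delta> n"
          using SQ by (simp add: \<delta>_def square_integrable_def)
        finally show "expectation (\<lambda>\<omega>. (centred_sum a k \<omega> - centred_sum a n \<omega>)\<^sup>2) \<le> 2 * \<delta> k + 2 * \<delta> n" .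
      qed
      also have "\<dots> = ennreal (measure_pmf.expectation ?P (\<lambda>k. 2 * \<delta> k + 2 * \<delta> n))"
        using int\<delta> \<delta>nonneg by (intro nn_integral_eq_integral) auto
      also have "measure_pmf.expectation ?P (\<lambda>k. 2 * \<delta> k + 2 * \<delta> n) = 2 * measure_pmf.expectation ?P \<delta> + 2 * \<delta> n"
        using int\<delta> by simp
      finally show "(\<integral>\<^sup>+\<omega>. ennreal ((A \<omega>)\<^sup>2) \<partial>M) \<le> ennreal (2 * measure_pmf.expectation ?P \<delta> + 2 * \<delta> n)" .
      have "(\<integral>\<^sup>+\<omega>. ennreal ((B \<omega>)\<^sup>2) \<partial>M) \<le> (\<integral>\<^sup>+\<omega>. ennreal (c\<^sup>2) * ennreal ((real (N (real n) \<omega>) - real n)\<^sup>2) \<partial>M)"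
      proof (rule nn_integral_mono)
        fix \<omega>
        have "\<bar>B \<omega>\<bar> \<le> \<bar>real (N (real n) \<omega>) - real n\<bar> * c"
          unfolding B_def \<alpha>_def c_def by (rule mean_total_length_increment_le[OF a n])
        then have "\<bar>B \<omega>\<bar>\<^sup>2 \<le> (\<bar>real (N (real n) \<omega>) - real n\<bar> * c)\<^sup>2" by (intro power_mono) auto
        then show "ennreal ((B \<omega>)\<^sup>2) \<le> ennreal (c\<^sup>2) * ennreal ((real (N (real n) \<omega>) - real n)\<^sup>2)"
          by (simp add: power_mult_distrib ennreal_mult[symmetric] mult.commute ennreal_leI)
      qed
      also have "\<dots> = ennreal (c\<^sup>2) * (\<integral>\<^sup>+\<omega>. ennreal ((real (N (real n) \<omega>) - real n)\<^sup>2) \<partial>M)"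
        by (rule nn_integral_cmult) measurable
      also have "(\<integral>\<^sup>+\<omega>. ennreal ((real (N (real n) \<omega>) - real n)\<^sup>2) \<partial>M) = ennreal (real n)"
        using nn_integral_N[OF n0, of "\<lambda>k. ennreal ((real k - real n)\<^sup>2)"] poisson_second_central_moment[OF n0] by simp
      also have "ennreal (c\<^sup>2) * ennreal (real n) = ennreal ((\<Sum>k<n. expectation (edge a k))\<^sup>2 / real n)"
        using n0 by (simp add: ennreal_mult[symmetric] c_def power_divide power2_eq_square)
      finally show "(\<integral>\<^sup>+\<omega>. ennreal ((B \<omega>)\<^sup>2) \<partial>M) \<le> ennreal ((\<Sum>k<n. expectation (edge a k))\<^sup>2 / real n)" .
      show "(\<integral>\<^sup>+\<omega>. ennreal ((C \<omega>)\<^sup>2) \<partial>M) \<le> ennreal (\<delta> n)"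
        using SQ[of n] unfolding C_def \<delta>_def square_integrable_def by (subst nn_integral_eq_integral) auto
    qed simp
    also have "\<dots> = ennreal (3 * (2 * measure_pmf.expectation ?P \<delta> + 2 * \<delta> n
      + (\<Sum>k<n. expectation (edge a k))\<^sup>2 / real n + \<delta> n))"
    proof (rule ennreal3)
      show "0 \<le> 2 * measure_pmf.expectation ?P \<delta> + 2 * \<delta> n"
        using \<delta>nonneg by (intro add_nonneg_nonneg mult_nonneg_nonneg Bochner_Integration.integral_nonneg) auto
    qed (use \<delta>nonneg in auto)
    finally show ?thesis .
  qed
  have nonneg: "0 \<le> 3 * (2 * measure_pmf.expectation ?P \<delta> + 2 * \<delta> n
      + (\<Sum>k<n. expectation (edge a k))\<^sup>2 / real n + \<delta> n)"
    using \<delta>nonneg by (intro add_nonneg_nonneg mult_nonneg_nonneg Bochner_Integration.integral_nonneg divide_nonneg_nonneg) auto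
  have "expectation (\<lambda>\<omega>. (centred M Y \<omega> - Q \<omega>)\<^sup>2) \<le> 3 * (2 * measure_pmf.expectation ?P \<delta> + 2 * \<delta> n
      + (\<Sum>k<n. expectation (edge a k))\<^sup>2 / real n + \<delta> n)"
    by (rule order_trans[OF le_X iffD1[OF ennreal_le_iff[OF nonneg] X_le]])
  then show ?thesis unfolding Y_def .
qed

lemma poissonized_onng_weight_tendsto_L2:
  assumes a: "a > real CARD('d) / 2" and Q: "tendsto_L2 M (centred_sum a) Q"
  shows "tendsto_L2 M (\<lambda>n. centred M (\<lambda>\<omega>. onng_weight a (\<lambda>i. U i \<omega>) (N (real n) \<omega>))) Q"
proof -
  have a0: "a \<ge> 0" using a by (rule order_trans[rotated, OF less_imp_le]) simp
  have N[measurable]: "N (real n) \<in> measurable M (count_space UNIV)" for n by (intro measurable_N) simp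
  have Ysq: "square_integrable M (\<lambda>\<omega>. total_length a (N (real n) \<omega>) \<omega>)" for n
    using a0 by (rule total_length_at_N_square_integrable)
  then have [measurable]: "(\<lambda>\<omega>. total_length a (N (real n) \<omega>) \<omega>) \<in> borel_measurable M" for n
    by (simp add: square_integrable_def)
  have [measurable]: "(\<lambda>\<omega>. onng_weight a (\<lambda>i. U i \<omega>) (N (real n) \<omega>)) \<in> borel_measurable M" for n
    by (rule measurable_compose_countable[where f="\<lambda>m \<omega>. onng_weight a (\<lambda>i. U i \<omega>) m"])
      (auto intro: measurable_onng_weight U_measurable)
  define \<delta> where "\<delta> k = expectation (\<lambda>\<omega>. (centred_sum a k \<omega> - Q \<omega>)\<^sup>2)" for k
  define b where "b n = 3 * (2 * measure_pmf.expectation (poisson_pmf (real n)) \<delta> + 2 * \<delta> n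
      + (\<Sum>k<n. expectation (edge a k))\<^sup>2 / real n + \<delta> n)" for n
  have \<delta>0: "\<delta> \<longlonglongrightarrow> 0" and Qsq: "square_integrable M Q"
    using Q by (auto simp: tendsto_L2_def \<delta>_def[abs_def])
  have "(\<lambda>n. b n) \<longlonglongrightarrow> 3 * (2 * 0 + 2 * 0 + 0 + 0)"
    unfolding b_def
    by (intro tendsto_intros \<delta>0 expected_length_square_over_n[OF a] poisson_mean_of_null_sequence) (simp add: \<delta>_def)
  then have b0: "b \<longlonglongrightarrow> 0" by simp
  have "(\<lambda>n. expectation (\<lambda>\<omega>. (centred M (\<lambda>\<omega>. total_length a (N (real n) \<omega>) \<omega>) \<omega> - Q \<omega>)\<^sup>2)) \<longlonglongrightarrow> 0"
  proof (rule tendsto_sandwich[OF _ _ tendsto_const b0])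
    show "\<forall>\<^sub>F n in sequentially. expectation (\<lambda>\<omega>. (centred M (\<lambda>\<omega>. total_length a (N (real n) \<omega>) \<omega>) \<omega> - Q \<omega>)\<^sup>2) \<le> b n"
      using total_length_at_N_L2_distance[OF a0 Q] unfolding b_def \<delta>_def[abs_def]
      by (intro eventually_sequentiallyI[of 1])
  qed simp
  moreover have "square_integrable M (centred M (\<lambda>\<omega>. total_length a (N (real n) \<omega>) \<omega>))" for n
    unfolding centred_def[abs_def] by (intro square_integrable_diff Ysq square_integrable_const)
  ultimately have "tendsto_L2 M (\<lambda>n. centred M (\<lambda>\<omega>. total_length a (N (real n) \<omega>) \<omega>)) Q"
    using Qsq by (simp add: tendsto_L2_def)
  then show ?thesis
  proof (rule tendsto_L2_cong_AE)
    fix n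
    have ae: "AE \<omega> in M. total_length a (N (real n) \<omega>) \<omega> = onng_weight a (\<lambda>i. U i \<omega>) (N (real n) \<omega>)"
      using AE_onng_weight_eq[of a] by eventually_elim simp
    then have "expectation (\<lambda>\<omega>. total_length a (N (real n) \<omega>) \<omega>) = expectation (\<lambda>\<omega>. onng_weight a (\<lambda>i. U i \<omega>) (N (real n) \<omega>))"
      by (intro integral_cong_AE) auto
    then show "AE \<omega> in M. centred M (\<lambda>\<omega>. total_length a (N (real n) \<omega>) \<omega>) \<omega> = centred M (\<lambda>\<omega>. onng_weight a (\<lambda>i. U i \<omega>) (N (real n) \<omega>)) \<omega>"
      using ae by (simp add: centred_def)
    show "centred M (\<lambda>\<omega>. onng_weight a (\<lambda>i. U i \<omega>) (N (real n) \<omega>)) \<in> borel_measurable M"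
      unfolding centred_def[abs_def] by measurable
  qed
qed

end

theorem theorem2p2:
  fixes M :: "'w measure"
    and U :: "nat \<Rightarrow> 'w \<Rightarrow> real ^ 'd"
    and N :: "real \<Rightarrow> 'w \<Rightarrow> nat"
    and \<alpha> :: real
  assumes "prob_space M"
    and "prob_space.indep_vars M (\<lambda>_. borel) U {1..}"
    and "\<And>i. i \<ge> 1 \<Longrightarrow> distr M borel (U i) = uniform_measure lborel unit_cube"
    and "unit_rate_poisson_process M N"
    and "prob_space.indep_set M
           (process_events M (count_space UNIV) {0..} N) (process_events M borel {1..} U)"
    and "\<alpha> > real CARD('d) / 2"
  shows "\<exists>Q :: 'w \<Rightarrow> real.
           Q \<in> borel_measurable M \<and> integrable M Q \<and> (\<integral>\<omega>. Q \<omega> \<partial>M) = 0 \<and>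
           (\<alpha> > real CARD('d) \<longrightarrow> \<not> has_centred_normal_law M Q) \<and>
           tendsto_L2 M (\<lambda>n. centred M (\<lambda>\<omega>. onng_weight \<alpha> (\<lambda>i. U i \<omega>) n)) Q \<and>
           tendsto_L2 M (\<lambda>n. centred M (\<lambda>\<omega>. onng_weight \<alpha> (\<lambda>i. U i \<omega>) (N (real n) \<omega>))) Q"
proof -
  interpret poissonized_sample M U N
  proof (intro poissonized_sample.intro uniform_sample.intro uniform_sample_axioms.intro poissonized_sample_axioms.intro)
    show "distr M borel (U i) = cube_law" if "i \<ge> 1" for i
      using assms(3)[OF that] by (simp only: cube_law_def)
  qed (fact assms)+
  have \<alpha>0: "\<alpha> \<ge> 0" using assms(6) by (rule order_trans[rotated, OF less_imp_le]) simp
  obtain Q where Q: "square_integrable M Q" "tendsto_L2 M (centred_sum \<alpha>) Q"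
    using centred_sum_L2_limit[OF assms(6)] by blast
  show ?thesis
  proof (intro exI[of _ Q] conjI impI)
    show "Q \<in> borel_measurable M" using Q(1) by (simp add: square_integrable_def)
    show "integrable M Q" "(\<integral>\<omega>. Q \<omega> \<partial>M) = 0"
      using expectation_L2_limit[OF Q(2)] expectation_centred_sum[OF \<alpha>0] by auto
    show "\<not> has_centred_normal_law M Q" if "\<alpha> > real CARD('d)"
      by (rule non_gaussian_limit[OF that Q(2)])
    show "tendsto_L2 M (\<lambda>n. centred M (\<lambda>\<omega>. onng_weight \<alpha> (\<lambda>i. U i \<omega>) n)) Q"
      by (rule centred_onng_weight_tendsto_L2[OF \<alpha>0 Q(2)])
    show "tendsto_L2 M (\<lambda>n. centred M (\<lambda>\<omega>. onng_weight \<alpha> (\<lambda>i. U i \<omega>) (N (real n) \<omega>))) Q"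
      by (rule poissonized_onng_weight_tendsto_L2[OF assms(6) Q(2)])
  qed
qed

end
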